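(* For $1<p,q<\infty$ with $\frac1p+\frac1q<1$, it holds that $$\mathrm{NA}(\ell_p\widehat\otimes_\pi\ell_q)\neq\ell_p\widehat\otimes_\pi\ell_q\qquad\text{while}\qquad\mathrm{INA}(\ell_p\widehat\otimes_\pi\ell_q)=\ell_p\widehat\otimes_\pi\ell_q.$$
   Context: The spaces are over $\mathbb K\in\{\mathbb R,\mathbb C\}$. $E\widehat\otimes_\pi F$ is the projective tensor product, i.e. the completion of $E\otimes F$ under $\|z\|_\pi=\inf\{\sum_{i=1}^n\|x_i\|\|y_i\|:z=\sum_{i=1}^nx_i\otimes y_i\}$. $\mathrm{NA}(E\widehat\otimes_\pi F)$ is the set of $z\in E\widehat\otimes_\pi F$ for which there are sequences $(x_i)$ in $E$, $(y_i)$ in $F$ with $z=\sum_{i=1}^\infty x_i\otimes y_i$ and $\|z\|_\pi=\sum_{i=1}^\infty\|x_i\|\|y_i\|$. $\mathrm{INA}(E\widehat\otimes_\pi F)$ is the set of $u\in E\widehat\otimes_\pi F$ for which there is a finite positive Borel measure $\mu$ on $B_E\times B_F$ (Borel with respect to the product of the norm topologies) with $|\mu|_{\mathrm{TV}}=\mu(B_E\times B_F)=\|u\|_\pi$ such that the map $\psi\colon B_E\times B_F\to E\widehat\otimes_\pi F$, $\psi(x,y)=x\otimes y$, is $\mu$-Bochner integrable and $u=\int_{B_E\times B_F}\psi\,d\mu$. *)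

theory Defs
  imports "HOL-Analysis.Analysis"
begin

text \<open>
  The exponent \<open>p\<close> of \<open>\<ell>\<^sub>p\<close> is a real variable, so neither \<open>\<ell>\<^sub>p\<close> nor a completion built
  from it can be a type carrying the class of Banach spaces.  Normed spaces over the scalar
  field \<open>'k\<close> (used for \<open>real\<close> and \<open>complex\<close>) are therefore records with an explicit carrier.
\<close>

record ('k, 'v) nspace =
  carr :: "'v set"
  zer :: 'v
  add :: "'v \<Rightarrow> 'v \<Rightarrow> 'v"
  scl :: "'k \<Rightarrow> 'v \<Rightarrow> 'v"
  nrm :: "'v \<Rightarrow> real"

definition ndist :: "('k::real_normed_field, 'v) nspace \<Rightarrow> 'v \<Rightarrow> 'v \<Rightarrow> real" where
  "ndist V x y = nrm V (add V x (scl V (- 1) y))"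

definition unit_ball :: "('k::real_normed_field, 'v) nspace \<Rightarrow> 'v set" where
  "unit_ball V = {x \<in> carr V. nrm V x \<le> 1}"

definition norm_topology :: "('k::real_normed_field, 'v) nspace \<Rightarrow> 'v topology" where
  "norm_topology V = Metric_space.mtopology (carr V) (ndist V)"

primrec partial_sum :: "('k::real_normed_field, 'v) nspace \<Rightarrow> (nat \<Rightarrow> 'v) \<Rightarrow> nat \<Rightarrow> 'v" where
  "partial_sum V f 0 = zer V"
| "partial_sum V f (Suc n) = add V (partial_sum V f n) (f n)"

definition nlimit :: "('k::real_normed_field, 'v) nspace \<Rightarrow> (nat \<Rightarrow> 'v) \<Rightarrow> 'v \<Rightarrow> bool" where
  "nlimit V s l \<longleftrightarrow> (\<lambda>n. ndist V (s n) l) \<longlonglongrightarrow> 0"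

definition ell :: "real \<Rightarrow> ('k::real_normed_field, nat \<Rightarrow> 'k) nspace" where
  "ell p =
    \<lparr> carr = {x. summable (\<lambda>n. norm (x n) powr p)},
      zer = (\<lambda>n. 0),
      add = (\<lambda>x y n. x n + y n),
      scl = (\<lambda>c x n. c * x n),
      nrm = (\<lambda>x. (\<Sum>n. norm (x n) powr p) powr (1 / p)) \<rparr>"


subsection \<open>Completion: Cauchy sequences modulo null sequences\<close>

definition cauchy_seqs :: "('k::real_normed_field, 'v) nspace \<Rightarrow> (nat \<Rightarrow> 'v) set" where
  "cauchy_seqs V = {s. (\<forall>n. s n \<in> carr V) \<and>
     (\<forall>e>0. \<exists>N. \<forall>m\<ge>N. \<forall>n\<ge>N. ndist V (s m) (s n) < e)}"

definition null_rel :: "('k::real_normed_field, 'v) nspace \<Rightarrow> ((nat \<Rightarrow> 'v) \<times> (nat \<Rightarrow> 'v)) set" where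
  "null_rel V = {(s, t). s \<in> cauchy_seqs V \<and> t \<in> cauchy_seqs V \<and>
     (\<lambda>n. ndist V (s n) (t n)) \<longlonglongrightarrow> 0}"

definition completion ::
  "('k::real_normed_field, 'v) nspace \<Rightarrow> ('k, (nat \<Rightarrow> 'v) set) nspace" where
  "completion V =
    \<lparr> carr = cauchy_seqs V // null_rel V,
      zer = null_rel V `` {\<lambda>n. zer V},
      add = (\<lambda>X Y. \<Union>s\<in>X. \<Union>t\<in>Y. null_rel V `` {\<lambda>n. add V (s n) (t n)}),
      scl = (\<lambda>c X. \<Union>s\<in>X. null_rel V `` {\<lambda>n. scl V c (s n)}),
      nrm = (\<lambda>X. THE r. \<exists>s\<in>X. (\<lambda>n. nrm V (s n)) \<longlonglongrightarrow> r) \<rparr>"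

definition into_completion :: "('k::real_normed_field, 'v) nspace \<Rightarrow> 'v \<Rightarrow> (nat \<Rightarrow> 'v) set" where
  "into_completion V v = null_rel V `` {\<lambda>n. v}"


subsection \<open>Projective tensor product\<close>

definition bilinear_forms ::
  "('k::real_normed_field, 'a) nspace \<Rightarrow> ('k, 'b) nspace \<Rightarrow> ('a \<Rightarrow> 'b \<Rightarrow> 'k) set" where
  "bilinear_forms E F = {B.
     (\<forall>x\<in>carr E. \<forall>x'\<in>carr E. \<forall>y\<in>carr F. B (add E x x') y = B x y + B x' y) \<and>
     (\<forall>x\<in>carr E. \<forall>y\<in>carr F. \<forall>y'\<in>carr F. B x (add F y y') = B x y + B x y') \<and>
     (\<forall>c. \<forall>x\<in>carr E. \<forall>y\<in>carr F. B (scl E c x) y = c * B x y) \<and>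
     (\<forall>c. \<forall>x\<in>carr E. \<forall>y\<in>carr F. B x (scl F c y) = c * B x y)}"

text \<open>
  \<open>x \<otimes> y\<close> is the evaluation functional \<open>B \<mapsto> B(x, y)\<close> on the space of all (not necessarily
  bounded) bilinear forms on \<open>E \<times> F\<close>; the algebraic tensor product \<open>E \<otimes> F\<close> is the linear span
  of these functionals, that is, the set of their finite sums (scalars are absorbed into a factor).
\<close>

definition elem_tensor ::
  "('k::real_normed_field, 'a) nspace \<Rightarrow> ('k, 'b) nspace \<Rightarrow> 'a \<Rightarrow> 'b \<Rightarrow> ('a \<Rightarrow> 'b \<Rightarrow> 'k) \<Rightarrow> 'k" where
  "elem_tensor E F x y = (\<lambda>B. if B \<in> bilinear_forms E F then B x y else 0)"

definition is_tensor_rep ::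
  "('k::real_normed_field, 'a) nspace \<Rightarrow> ('k, 'b) nspace \<Rightarrow> (('a \<Rightarrow> 'b \<Rightarrow> 'k) \<Rightarrow> 'k) \<Rightarrow>
    nat \<Rightarrow> (nat \<Rightarrow> 'a) \<Rightarrow> (nat \<Rightarrow> 'b) \<Rightarrow> bool" where
  "is_tensor_rep E F z n x y \<longleftrightarrow>
     (\<forall>i<n. x i \<in> carr E \<and> y i \<in> carr F) \<and>
     z = (\<lambda>B. \<Sum>i<n. elem_tensor E F (x i) (y i) B)"

definition alg_tensor ::
  "('k::real_normed_field, 'a) nspace \<Rightarrow> ('k, 'b) nspace \<Rightarrow>
    ('k, ('a \<Rightarrow> 'b \<Rightarrow> 'k) \<Rightarrow> 'k) nspace" where
  "alg_tensor E F =
    \<lparr> carr = {z. \<exists>n x y. is_tensor_rep E F z n x y},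
      zer = (\<lambda>B. 0),
      add = (\<lambda>z w B. z B + w B),
      scl = (\<lambda>c z B. c * z B),
      nrm = (\<lambda>z. Inf {\<Sum>i<n. nrm E (x i) * nrm F (y i) | n x y. is_tensor_rep E F z n x y}) \<rparr>"

type_synonym ('k, 'a, 'b) ptensor = "(nat \<Rightarrow> ('a \<Rightarrow> 'b \<Rightarrow> 'k) \<Rightarrow> 'k) set"

definition proj_tensor ::
  "('k::real_normed_field, 'a) nspace \<Rightarrow> ('k, 'b) nspace \<Rightarrow> ('k, ('k, 'a, 'b) ptensor) nspace" where
  "proj_tensor E F = completion (alg_tensor E F)"

definition tensor ::
  "('k::real_normed_field, 'a) nspace \<Rightarrow> ('k, 'b) nspace \<Rightarrow> 'a \<Rightarrow> 'b \<Rightarrow> ('k, 'a, 'b) ptensor" where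
  "tensor E F x y = into_completion (alg_tensor E F) (elem_tensor E F x y)"


subsection \<open>Bochner integral\<close>

text \<open>
  This follows \<^const>\<open>has_bochner_integral\<close>, which needs the target to be a type of class
  \<open>{real_normed_vector, second_countable_topology}\<close>.  A simple function is given as
  \<open>\<Sum>\<^bsub>i<n\<^esub> indicator (A i) \<cdot> v i\<close> with measurable sets \<open>A i\<close> of finite measure.  Strong
  measurability of \<open>f\<close> (being an almost everywhere limit of simple functions) is implied: the
  functions \<open>\<parallel>f - s\<^sub>k\<parallel>\<close> are measurable and tend to \<open>0\<close> in \<open>L\<^sub>1\<close>, so a subsequence tends to \<open>0\<close>
  almost everywhere.
\<close>

definition simple_data ::
  "('k::real_normed_field, 'v) nspace \<Rightarrow> 'w measure \<Rightarrow> nat \<Rightarrow> (nat \<Rightarrow> 'w set) \<Rightarrow> (nat \<Rightarrow> 'v) \<Rightarrow> bool" where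
  "simple_data V M n A v \<longleftrightarrow>
     (\<forall>i<n. A i \<in> sets M \<and> emeasure M (A i) < \<infinity> \<and> v i \<in> carr V)"

definition simple_fun ::
  "('k::real_normed_field, 'v) nspace \<Rightarrow> nat \<Rightarrow> (nat \<Rightarrow> 'w set) \<Rightarrow> (nat \<Rightarrow> 'v) \<Rightarrow> 'w \<Rightarrow> 'v" where
  "simple_fun V n A v \<omega> = partial_sum V (\<lambda>i. if \<omega> \<in> A i then v i else zer V) n"

definition simple_int ::
  "('k::real_normed_field, 'v) nspace \<Rightarrow> 'w measure \<Rightarrow> nat \<Rightarrow> (nat \<Rightarrow> 'w set) \<Rightarrow> (nat \<Rightarrow> 'v) \<Rightarrow> 'v" where
  "simple_int V M n A v = partial_sum V (\<lambda>i. scl V (of_real (measure M (A i))) (v i)) n"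

definition has_bochner_int ::
  "('k::real_normed_field, 'v) nspace \<Rightarrow> 'w measure \<Rightarrow> ('w \<Rightarrow> 'v) \<Rightarrow> 'v \<Rightarrow> bool" where
  "has_bochner_int V M f u \<longleftrightarrow>
     u \<in> carr V \<and> (\<forall>\<omega>\<in>space M. f \<omega> \<in> carr V) \<and>
     (\<exists>n A v.
        (\<forall>k. simple_data V M (n k) (A k) (v k)) \<and>
        (\<forall>k. (\<lambda>\<omega>. ndist V (f \<omega>) (simple_fun V (n k) (A k) (v k) \<omega>)) \<in> borel_measurable M) \<and>
        (\<lambda>k. \<integral>\<^sup>+\<omega>. ennreal (ndist V (f \<omega>) (simple_fun V (n k) (A k) (v k) \<omega>)) \<partial>M)
          \<longlonglongrightarrow> 0 \<and>
        nlimit V (\<lambda>k. simple_int V M (n k) (A k) (v k)) u)"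


subsection \<open>Norm-attaining and integral norm-attaining tensors\<close>

definition NA ::
  "('k::real_normed_field, 'a) nspace \<Rightarrow> ('k, 'b) nspace \<Rightarrow> ('k, 'a, 'b) ptensor set" where
  "NA E F = {z \<in> carr (proj_tensor E F). \<exists>x y.
     (\<forall>i. x i \<in> carr E \<and> y i \<in> carr F) \<and>
     nlimit (proj_tensor E F) (partial_sum (proj_tensor E F) (\<lambda>i. tensor E F (x i) (y i))) z \<and>
     (\<lambda>i. nrm E (x i) * nrm F (y i)) sums nrm (proj_tensor E F) z}"

definition borel_measure_on_balls ::
  "('k::real_normed_field, 'a) nspace \<Rightarrow> ('k, 'b) nspace \<Rightarrow> ('a \<times> 'b) measure \<Rightarrow> bool" where
  "borel_measure_on_balls E F \<mu> \<longleftrightarrow>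
     space \<mu> = unit_ball E \<times> unit_ball F \<and>
     sets \<mu> = sigma_sets (unit_ball E \<times> unit_ball F)
       {U. openin (subtopology (prod_topology (norm_topology E) (norm_topology F))
              (unit_ball E \<times> unit_ball F)) U}"

definition INA ::
  "('k::real_normed_field, 'a) nspace \<Rightarrow> ('k, 'b) nspace \<Rightarrow> ('k, 'a, 'b) ptensor set" where
  "INA E F = {u \<in> carr (proj_tensor E F). \<exists>\<mu>.
     borel_measure_on_balls E F \<mu> \<and> finite_measure \<mu> \<and>
     measure \<mu> (unit_ball E \<times> unit_ball F) = nrm (proj_tensor E F) u \<and>
     has_bochner_int (proj_tensor E F) \<mu> (\<lambda>(x, y). tensor E F x y) u}"

end

theory Submission
  imports Defs "HOL-Probability.Probability"
begin

text \<open>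
  Not every tensor is norm-attaining: take \<open>u = \<Sum>\<^sub>n w\<^sub>n\<^bsup>1/p + 1/q\<^esup> e\<^sub>n \<otimes> e\<^sub>n\<close> with positive weights
  \<open>w\<^sub>n\<close> of sum \<open>1\<close>.  Averaging over signs gives \<open>\<parallel>u\<parallel>\<^sub>\<pi> \<le> 1\<close>, and the diagonal form with coefficients
  \<open>w\<^sub>n\<^bsup>1 - 1/p - 1/q\<^esup>\<close> has norm at most \<open>1\<close> (Young) and value \<open>1\<close> at \<open>u\<close>.  In a norm-attaining
  representation \<open>u = \<Sum>\<^sub>i x\<^sub>i \<otimes> y\<^sub>i\<close> every summand therefore attains equality in Young's inequality, which
  fixes the moduli of all coordinates.  The off-diagonal entries of \<open>u\<close> vanish, so the phases form an
  infinite orthonormal sequence of unimodular functions in \<open>\<ell>\<^sub>2\<close> of a discrete finite measure, against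
  Bessel's inequality at a single atom.

  Every tensor is integral norm-attaining: almost optimal finite representations of \<open>u\<close> are discrete
  measures on the weakly compact set \<open>B\<^sub>E \<times> B\<^sub>F\<close>, and a weak limit \<open>\<mu>\<close> has mass \<open>\<parallel>u\<parallel>\<^sub>\<pi>\<close>.  The products
  \<open>x\<^sub>n y\<^sub>m\<close> of coordinates are weakly continuous, so \<open>u\<close> and the integral of \<open>x \<otimes> y\<close> have the same
  matrix, and an element of the completed tensor product is determined by its matrix.
\<close>

section \<open>Seminormed function spaces and their completions\<close>

text \<open>The strict inequality \<open>pq\<close> enters through \<open>gap\<close>, the weight of
  the constant w_n in a three-term Young inequality. Because that weight is positive, equality pins
  |x_n|^p and |y_n|^q at w_n instead of merely tying them to each other. All summands of a
  norm-attaining representation then have the same moduli up to scaling, and only the phases are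
  left to cancel the off-diagonal entries. Countably many atoms cannot achieve this, whereas a
  continuous average over independent phases does.

  In the positive half the obstacle is that weak limits control coordinates only, while
  \<open>INA\<close> asks for a measure on the norm-Borel sets and for a Bochner integral in an
  abstract completion. Separability settles the first point: a map into the balls with measurable
  coordinates is norm-Borel measurable. For the second, explicit simple functions are built, namely
  finite matrices with rounded entries. Their distance to x \<otimes> y is bounded and tends to 0
  pointwise, and their integrals are finite matrices close to the moments of the measure.\<close>

locale fun_nspace =
  fixes V :: "('k::real_normed_field, 'i \<Rightarrow> 'k) nspace"
  assumes zer_eq: "zer V = (\<lambda>i. 0)"
    and add_eq: "add V x y = (\<lambda>i. x i + y i)"
    and scl_eq: "scl V c x = (\<lambda>i. c * x i)"
    and zero_carr: "(\<lambda>i. 0) \<in> carr V"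
    and add_carr: "x \<in> carr V \<Longrightarrow> y \<in> carr V \<Longrightarrow> (\<lambda>i. x i + y i) \<in> carr V"
    and scl_carr: "x \<in> carr V \<Longrightarrow> (\<lambda>i. c * x i) \<in> carr V"
    and nrm_add: "x \<in> carr V \<Longrightarrow> y \<in> carr V \<Longrightarrow> nrm V (\<lambda>i. x i + y i) \<le> nrm V x + nrm V y"
    and nrm_scl: "x \<in> carr V \<Longrightarrow> nrm V (\<lambda>i. c * x i) = norm c * nrm V x"
begin

lemma ndist_eq: "ndist V x y = nrm V (\<lambda>i. x i - y i)"
  by (simp add: ndist_def add_eq scl_eq)

lemma diff_carr: "x \<in> carr V \<Longrightarrow> y \<in> carr V \<Longrightarrow> (\<lambda>i. x i - y i) \<in> carr V"
  using add_carr[of x "\<lambda>i. (- 1) * y i"] scl_carr[of y "- 1"] by simp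

lemma sum_carr: "(\<And>j. j \<in> J \<Longrightarrow> f j \<in> carr V) \<Longrightarrow> (\<lambda>i. \<Sum>j\<in>J. f j i) \<in> carr V"
  by (induction J rule: infinite_finite_induct) (auto simp: zero_carr add_carr)

lemma nrm_zero: "nrm V (\<lambda>i. 0) = 0"
  using nrm_scl[OF zero_carr, of 0] by simp

lemma nrm_minus: "x \<in> carr V \<Longrightarrow> nrm V (\<lambda>i. - x i) = nrm V x"
  using nrm_scl[of x "- 1"] by simp

lemma nrm_nonneg: "x \<in> carr V \<Longrightarrow> 0 \<le> nrm V x"
  using nrm_add[of x "\<lambda>i. (- 1) * x i"] scl_carr[of x "- 1"] nrm_minus[of x] nrm_zero by simp

lemma nrm_sum:
  "(\<And>j. j \<in> J \<Longrightarrow> f j \<in> carr V) \<Longrightarrow> nrm V (\<lambda>i. \<Sum>j\<in>J. f j i) \<le> (\<Sum>j\<in>J. nrm V (f j))"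
proof (induction J rule: infinite_finite_induct)
  case (insert a J)
  have "nrm V (\<lambda>i. f a i + (\<Sum>j\<in>J. f j i)) \<le> nrm V (f a) + nrm V (\<lambda>i. \<Sum>j\<in>J. f j i)"
    using insert by (intro nrm_add sum_carr) auto
  with insert show ?case by force
qed (auto simp: nrm_zero)

lemma nrm_triangle_diff:
  "x \<in> carr V \<Longrightarrow> y \<in> carr V \<Longrightarrow> nrm V x \<le> nrm V y + nrm V (\<lambda>i. x i - y i)"
  using nrm_add[of y "\<lambda>i. x i - y i"] diff_carr[of x y] by simp

lemma ndist_nonneg: "x \<in> carr V \<Longrightarrow> y \<in> carr V \<Longrightarrow> 0 \<le> ndist V x y"
  by (simp add: ndist_eq nrm_nonneg diff_carr)

lemma ndist_self: "ndist V x x = 0"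
  by (simp add: ndist_eq nrm_zero)

lemma ndist_commute: "x \<in> carr V \<Longrightarrow> y \<in> carr V \<Longrightarrow> ndist V x y = ndist V y x"
  using nrm_minus[of "\<lambda>i. x i - y i"] diff_carr[of x y] by (simp add: ndist_eq)

lemma ndist_triangle:
  "x \<in> carr V \<Longrightarrow> y \<in> carr V \<Longrightarrow> z \<in> carr V \<Longrightarrow> ndist V x z \<le> ndist V x y + ndist V y z"
  using nrm_add[of "\<lambda>i. x i - y i" "\<lambda>i. y i - z i"] diff_carr[of x y] diff_carr[of y z]
  by (simp add: ndist_eq)

lemma abs_nrm_diff_le: "x \<in> carr V \<Longrightarrow> y \<in> carr V \<Longrightarrow> \<bar>nrm V x - nrm V y\<bar> \<le> ndist V x y"
  using nrm_triangle_diff[of x y] nrm_triangle_diff[of y x] ndist_commute[of x y]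
  by (simp add: ndist_eq)

lemma ndist_add:
  assumes "x \<in> carr V" "y \<in> carr V" "x' \<in> carr V" "y' \<in> carr V"
  shows "ndist V (\<lambda>i. x i + y i) (\<lambda>i. x' i + y' i) \<le> ndist V x x' + ndist V y y'"
  using nrm_add[of "\<lambda>i. x i - x' i" "\<lambda>i. y i - y' i"] assms diff_carr
  by (simp add: ndist_eq algebra_simps)

lemma ndist_scl:
  "x \<in> carr V \<Longrightarrow> y \<in> carr V \<Longrightarrow> ndist V (\<lambda>i. c * x i) (\<lambda>i. c * y i) = norm c * ndist V x y"
  using nrm_scl[of "\<lambda>i. x i - y i" c] diff_carr[of x y] by (simp add: ndist_eq right_diff_distrib)

lemma normalize:
  assumes "x \<in> carr V" "nrm V x > 0"
  shows "(\<lambda>i. x i / of_real (nrm V x)) \<in> carr V" "nrm V (\<lambda>i. x i / of_real (nrm V x)) = 1"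
  using scl_carr[OF assms(1), of "inverse (of_real (nrm V x))"]
    nrm_scl[OF assms(1), of "inverse (of_real (nrm V x))"] assms(2)
  by (simp_all add: field_simps norm_inverse norm_divide)

lemma normalized_in_unit_ball:
  assumes "x \<in> carr V"
  shows "(\<lambda>n. x n / of_real (nrm V x)) \<in> unit_ball V"
proof -
  have "norm (inverse (of_real (nrm V x)) :: 'k) * nrm V x \<le> 1"
    using nrm_nonneg[OF assms] by (cases "nrm V x = 0") (simp_all add: norm_inverse)
  then show ?thesis
    using scl_carr[OF assms, of "inverse (of_real (nrm V x))"]
      nrm_scl[OF assms, of "inverse (of_real (nrm V x))"]
    by (simp add: unit_ball_def divide_inverse mult.commute)
qed

lemma cauchy_seqs_carr: "s \<in> cauchy_seqs V \<Longrightarrow> s n \<in> carr V"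
  by (auto simp: cauchy_seqs_def)

lemma cauchy_seqs_const: "v \<in> carr V \<Longrightarrow> (\<lambda>n. v) \<in> cauchy_seqs V"
  by (auto simp: cauchy_seqs_def ndist_self)

lemma cauchy_seqs_add:
  assumes "s \<in> cauchy_seqs V" "t \<in> cauchy_seqs V"
  shows "(\<lambda>n i. s n i + t n i) \<in> cauchy_seqs V"
  unfolding cauchy_seqs_def
proof (intro CollectI conjI allI impI)
  show "(\<lambda>i. s n i + t n i) \<in> carr V" for n
    using assms by (auto intro: add_carr cauchy_seqs_carr)
  fix e :: real assume "e > 0"
  then have e: "e / 2 > 0" by simp
  obtain N1 N2 where N: "\<forall>m\<ge>N1. \<forall>n\<ge>N1. ndist V (s m) (s n) < e / 2"
      "\<forall>m\<ge>N2. \<forall>n\<ge>N2. ndist V (t m) (t n) < e / 2"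
    using assms e unfolding cauchy_seqs_def by blast
  have "ndist V (\<lambda>i. s m i + t m i) (\<lambda>i. s n i + t n i) < e"
    if "m \<ge> max N1 N2" "n \<ge> max N1 N2" for m n
  proof -
    have "ndist V (\<lambda>i. s m i + t m i) (\<lambda>i. s n i + t n i)
        \<le> ndist V (s m) (s n) + ndist V (t m) (t n)"
      using assms by (intro ndist_add cauchy_seqs_carr)
    moreover have "ndist V (s m) (s n) < e / 2" "ndist V (t m) (t n) < e / 2"
      using N that by auto
    ultimately show ?thesis by linarith
  qed
  then show "\<exists>N. \<forall>m\<ge>N. \<forall>n\<ge>N. ndist V (\<lambda>i. s m i + t m i) (\<lambda>i. s n i + t n i) < e" by blast
qed

lemma cauchy_seqs_scl:
  assumes "s \<in> cauchy_seqs V"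
  shows "(\<lambda>n i. c * s n i) \<in> cauchy_seqs V"
  unfolding cauchy_seqs_def
proof (intro CollectI conjI allI impI)
  show "(\<lambda>i. c * s n i) \<in> carr V" for n
    using assms by (auto intro: scl_carr cauchy_seqs_carr)
  fix e :: real assume "e > 0"
  then have e: "e / (norm c + 1) > 0" by (simp add: add_nonneg_pos)
  obtain N where N: "\<forall>m\<ge>N. \<forall>n\<ge>N. ndist V (s m) (s n) < e / (norm c + 1)"
    using assms e unfolding cauchy_seqs_def by blast
  have "ndist V (\<lambda>i. c * s m i) (\<lambda>i. c * s n i) < e" if "m \<ge> N" "n \<ge> N" for m n
  proof -
    have "ndist V (s m) (s n) * (norm c + 1) < e"
      using N that by (simp add: pos_less_divide_eq add_nonneg_pos)
    moreover have "0 \<le> ndist V (s m) (s n)" using assms by (intro ndist_nonneg cauchy_seqs_carr)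
    ultimately have "norm c * ndist V (s m) (s n) < e" by (simp add: algebra_simps)
    then show ?thesis using assms by (simp add: ndist_scl cauchy_seqs_carr)
  qed
  then show "\<exists>N. \<forall>m\<ge>N. \<forall>n\<ge>N. ndist V (\<lambda>i. c * s m i) (\<lambda>i. c * s n i) < e" by blast
qed

lemma cauchy_seqs_nrm_convergent:
  assumes "s \<in> cauchy_seqs V"
  shows "convergent (\<lambda>n. nrm V (s n))"
proof -
  have "Cauchy (\<lambda>n. nrm V (s n))"
  proof (rule metric_CauchyI)
    fix e :: real assume "e > 0"
    then obtain N where N: "\<forall>m\<ge>N. \<forall>n\<ge>N. ndist V (s m) (s n) < e"
      using assms unfolding cauchy_seqs_def by blast
    then have "dist (nrm V (s m)) (nrm V (s n)) < e" if "m \<ge> N" "n \<ge> N" for m n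
      using abs_nrm_diff_le[of "s m" "s n"] that assms
      by (force simp: dist_real_def cauchy_seqs_carr)
    then show "\<exists>M. \<forall>m\<ge>M. \<forall>n\<ge>M. dist (nrm V (s m)) (nrm V (s n)) < e" by blast
  qed
  then show ?thesis by (simp add: Cauchy_convergent)
qed

lemma equiv_null_rel: "equiv (cauchy_seqs V) (null_rel V)"
proof (rule equivI)
  show "null_rel V \<subseteq> cauchy_seqs V \<times> cauchy_seqs V" by (auto simp: null_rel_def)
  show "refl_on (cauchy_seqs V) (null_rel V)"
    by (auto simp: refl_on_def null_rel_def ndist_self)
  show "sym (null_rel V)"
    by (auto simp: sym_def null_rel_def ndist_commute cauchy_seqs_carr)
  show "trans (null_rel V)"
  proof (rule transI)
    fix s t u assume st: "(s, t) \<in> null_rel V" and tu: "(t, u) \<in> null_rel V"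
    have "(\<lambda>n. ndist V (s n) (t n) + ndist V (t n) (u n)) \<longlonglongrightarrow> 0 + 0"
      using st tu by (intro tendsto_add) (auto simp: null_rel_def)
    then have "(\<lambda>n. ndist V (s n) (u n)) \<longlonglongrightarrow> 0"
      using st tu
      by (intro tendsto_sandwich[of "\<lambda>n. 0" "\<lambda>n. ndist V (s n) (u n)" _
          "\<lambda>n. ndist V (s n) (t n) + ndist V (t n) (u n)"])
        (auto simp: null_rel_def intro!: always_eventually ndist_nonneg ndist_triangle
          cauchy_seqs_carr)
    then show "(s, u) \<in> null_rel V" using st tu by (auto simp: null_rel_def)
  qed
qed

definition cls :: "(nat \<Rightarrow> 'i \<Rightarrow> 'k) \<Rightarrow> (nat \<Rightarrow> 'i \<Rightarrow> 'k) set" where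
  "cls s = null_rel V `` {s}"

lemma into_completion_eq: "into_completion V v = cls (\<lambda>n. v)"
  by (simp add: into_completion_def cls_def)

lemma carr_completion: "carr (completion V) = cls ` cauchy_seqs V"
  by (auto simp: completion_def cls_def quotient_def)

lemma in_cls_iff:
  "s \<in> cauchy_seqs V \<Longrightarrow>
    t \<in> cls s \<longleftrightarrow> t \<in> cauchy_seqs V \<and> (\<lambda>n. ndist V (s n) (t n)) \<longlonglongrightarrow> 0"
  by (auto simp: cls_def null_rel_def)

lemma cls_self: "s \<in> cauchy_seqs V \<Longrightarrow> s \<in> cls s"
  by (simp add: in_cls_iff ndist_self)

lemma cls_eqI:
  "s \<in> cauchy_seqs V \<Longrightarrow> t \<in> cauchy_seqs V \<Longrightarrow> (\<lambda>n. ndist V (s n) (t n)) \<longlonglongrightarrow> 0 \<Longrightarrow> cls s = cls t"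
  unfolding cls_def by (rule equiv_class_eq[OF equiv_null_rel]) (simp add: null_rel_def)

text \<open>The union over representatives in \<open>completion\<close> collapses, because every
  pair of representatives produces the same class.\<close>

lemma completion_add:
  assumes "s \<in> cauchy_seqs V" "t \<in> cauchy_seqs V"
  shows "add (completion V) (cls s) (cls t) = cls (\<lambda>n i. s n i + t n i)"
proof -
  have "null_rel V `` {\<lambda>n. add V (s' n) (t' n)} = cls (\<lambda>n i. s n i + t n i)"
    if s': "s' \<in> cls s" and t': "t' \<in> cls t" for s' t'
  proof -
    have *: "s' \<in> cauchy_seqs V" "t' \<in> cauchy_seqs V"
      "(\<lambda>n. ndist V (s n) (s' n)) \<longlonglongrightarrow> 0" "(\<lambda>n. ndist V (t n) (t' n)) \<longlonglongrightarrow> 0"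
      using s' t' assms by (auto simp: in_cls_iff)
    have "(\<lambda>n. ndist V (s n) (s' n) + ndist V (t n) (t' n)) \<longlonglongrightarrow> 0 + 0"
      using * by (intro tendsto_add)
    then have "(\<lambda>n. ndist V (\<lambda>i. s n i + t n i) (\<lambda>i. s' n i + t' n i)) \<longlonglongrightarrow> 0"
      using * assms
      by (intro tendsto_sandwich[of "\<lambda>n. 0" "\<lambda>n. ndist V (\<lambda>i. s n i + t n i) (\<lambda>i. s' n i + t' n i)" _
          "\<lambda>n. ndist V (s n) (s' n) + ndist V (t n) (t' n)"])
        (auto intro!: always_eventually ndist_nonneg ndist_add add_carr intro: cauchy_seqs_carr)
    then show ?thesis
      using cls_eqI[OF cauchy_seqs_add[OF assms] cauchy_seqs_add[OF *(1,2)]]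
      by (simp add: cls_def add_eq)
  qed
  then show ?thesis
    using cls_self[OF assms(1)] cls_self[OF assms(2)] by (auto simp: completion_def)
qed

lemma completion_scl:
  assumes "s \<in> cauchy_seqs V"
  shows "scl (completion V) c (cls s) = cls (\<lambda>n i. c * s n i)"
proof -
  have "null_rel V `` {\<lambda>n. scl V c (s' n)} = cls (\<lambda>n i. c * s n i)" if s': "s' \<in> cls s" for s'
  proof -
    have *: "s' \<in> cauchy_seqs V" "(\<lambda>n. ndist V (s n) (s' n)) \<longlonglongrightarrow> 0"
      using s' assms by (auto simp: in_cls_iff)
    have "(\<lambda>n. norm c * ndist V (s n) (s' n)) \<longlonglongrightarrow> norm c * 0"
      using * by (intro tendsto_mult_left)
    then have "(\<lambda>n. ndist V (\<lambda>i. c * s n i) (\<lambda>i. c * s' n i)) \<longlonglongrightarrow> 0"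
      using * assms by (simp add: ndist_scl cauchy_seqs_carr)
    then show ?thesis
      using cls_eqI[OF cauchy_seqs_scl[OF assms] cauchy_seqs_scl[OF *(1)]]
      by (simp add: cls_def scl_eq)
  qed
  then show ?thesis using cls_self[OF assms(1)] by (auto simp: completion_def)
qed

text \<open>This resolves the \<open>THE\<close> in \<open>completion\<close>: the norms converge
  along any Cauchy sequence, and equivalent sequences share the limit.\<close>

lemma nrm_completion_tendsto:
  assumes "s \<in> cauchy_seqs V"
  shows "(\<lambda>n. nrm V (s n)) \<longlonglongrightarrow> nrm (completion V) (cls s)"
proof -
  obtain r where r: "(\<lambda>n. nrm V (s n)) \<longlonglongrightarrow> r"
    using cauchy_seqs_nrm_convergent[OF assms] by (auto simp: convergent_def)
  have uniq: "r' = r" if s': "s' \<in> cls s" and r': "(\<lambda>n. nrm V (s' n)) \<longlonglongrightarrow> r'" for s' r'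
  proof -
    have *: "s' \<in> cauchy_seqs V" "(\<lambda>n. ndist V (s n) (s' n)) \<longlonglongrightarrow> 0"
      using s' assms by (auto simp: in_cls_iff)
    have "(\<lambda>n. nrm V (s n) - nrm V (s' n)) \<longlonglongrightarrow> 0"
      using * assms by (intro Lim_null_comparison[OF _ *(2)])
        (auto intro!: always_eventually abs_nrm_diff_le cauchy_seqs_carr)
    moreover have "(\<lambda>n. nrm V (s n) - nrm V (s' n)) \<longlonglongrightarrow> r - r'" using r r' by (rule tendsto_diff)
    ultimately show ?thesis using LIMSEQ_unique by force
  qed
  have "nrm (completion V) (cls s) = (THE r. \<exists>s'\<in>cls s. (\<lambda>n. nrm V (s' n)) \<longlonglongrightarrow> r)"
    by (simp add: completion_def)
  also have "\<dots> = r"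
    using r uniq cls_self[OF assms] by (intro the_equality) blast+
  finally show ?thesis using r by simp
qed

lemma ndist_completion_tendsto:
  assumes "s \<in> cauchy_seqs V" "t \<in> cauchy_seqs V"
  shows "(\<lambda>n. ndist V (s n) (t n)) \<longlonglongrightarrow> ndist (completion V) (cls s) (cls t)"
proof -
  have m: "(\<lambda>n i. - 1 * t n i) \<in> cauchy_seqs V" by (rule cauchy_seqs_scl[OF assms(2)])
  have "(\<lambda>n. nrm V (\<lambda>i. s n i + - 1 * t n i))
      \<longlonglongrightarrow> nrm (completion V) (cls (\<lambda>n i. s n i + - 1 * t n i))"
    by (rule nrm_completion_tendsto[OF cauchy_seqs_add[OF assms(1) m]])
  moreover have "ndist (completion V) (cls s) (cls t)
      = nrm (completion V) (cls (\<lambda>n i. s n i + - 1 * t n i))"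
    unfolding ndist_def by (simp only: completion_scl[OF assms(2)] completion_add[OF assms(1) m])
  ultimately show ?thesis by (simp add: ndist_eq)
qed

lemma into_completion_carr: "v \<in> carr V \<Longrightarrow> into_completion V v \<in> carr (completion V)"
  by (simp add: carr_completion into_completion_eq cauchy_seqs_const)

lemma into_completion_zer: "zer (completion V) = into_completion V (\<lambda>i. 0)"
  by (simp add: completion_def into_completion_def zer_eq)

lemma into_completion_add:
  "v \<in> carr V \<Longrightarrow> w \<in> carr V \<Longrightarrow>
    add (completion V) (into_completion V v) (into_completion V w) = into_completion V (\<lambda>i. v i + w i)"
  by (simp add: into_completion_eq completion_add cauchy_seqs_const)

lemma into_completion_scl:
  "v \<in> carr V \<Longrightarrow> scl (completion V) c (into_completion V v) = into_completion V (\<lambda>i. c * v i)"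
  by (simp add: into_completion_eq completion_scl cauchy_seqs_const)

lemma ndist_into_completion:
  assumes "v \<in> carr V" "w \<in> carr V"
  shows "ndist (completion V) (into_completion V v) (into_completion V w) = ndist V v w"
  using ndist_completion_tendsto[OF cauchy_seqs_const cauchy_seqs_const, OF assms]
  by (simp add: LIMSEQ_const_iff into_completion_eq)

lemma partial_sum_into_completion:
  "(\<And>j. j < n \<Longrightarrow> f j \<in> carr V) \<Longrightarrow>
    partial_sum (completion V) (\<lambda>j. into_completion V (f j)) n
      = into_completion V (\<lambda>i. \<Sum>j<n. f j i)"
proof (induction n)
  case (Suc n)
  then show ?case
    using into_completion_add[OF sum_carr[of "{..<n}" f], of "f n"] by simp
qed (simp add: into_completion_zer)

lemma ndist_into_completion_cls_tendsto:
  "v \<in> carr V \<Longrightarrow> s \<in> cauchy_seqs V \<Longrightarrow>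
    (\<lambda>n. ndist V v (s n)) \<longlonglongrightarrow> ndist (completion V) (into_completion V v) (cls s)"
  using ndist_completion_tendsto[OF cauchy_seqs_const] by (simp add: into_completion_eq)

lemma ndist_into_completion_triangle:
  assumes v: "v \<in> carr V" and w: "w \<in> carr V" and s: "s \<in> cauchy_seqs V"
  shows "ndist (completion V) (into_completion V v) (cls s)
    \<le> ndist V v w + ndist (completion V) (into_completion V w) (cls s)"
proof (rule LIMSEQ_le)
  show "(\<lambda>n. ndist V v (s n)) \<longlonglongrightarrow> ndist (completion V) (into_completion V v) (cls s)"
    by (rule ndist_into_completion_cls_tendsto[OF v s])
  show "(\<lambda>n. ndist V v w + ndist V w (s n))
      \<longlonglongrightarrow> ndist V v w + ndist (completion V) (into_completion V w) (cls s)"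
    by (intro tendsto_intros ndist_into_completion_cls_tendsto w s)
  show "\<exists>N. \<forall>n\<ge>N. ndist V v (s n) \<le> ndist V v w + ndist V w (s n)"
    using ndist_triangle[OF v w cauchy_seqs_carr[OF s]] by blast
qed

lemma ndist_into_completion_cls_nonneg:
  assumes "v \<in> carr V" "s \<in> cauchy_seqs V"
  shows "0 \<le> ndist (completion V) (into_completion V v) (cls s)"
  using ndist_nonneg[OF assms(1) cauchy_seqs_carr[OF assms(2)]]
  by (intro LIMSEQ_le_const[OF ndist_into_completion_cls_tendsto[OF assms]]) auto

text \<open>A Lipschitz functional extends continuously to the completion. Here \<open>L\<close> is
  the value of the extension at the class, read off along the representative \<open>s\<close>, so no
  extended functional has to be defined. It serves to test norm limits against bounded bilinear
  forms.\<close>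

lemma tendsto_functional_completion:
  fixes \<phi> :: "('i \<Rightarrow> 'k) \<Rightarrow> 'k"
  assumes s: "s \<in> cauchy_seqs V" and v: "\<And>n. v n \<in> carr V"
    and lim: "nlimit (completion V) (\<lambda>n. into_completion V (v n)) (cls s)"
    and lip: "\<And>x y. x \<in> carr V \<Longrightarrow> y \<in> carr V \<Longrightarrow> norm (\<phi> x - \<phi> y) \<le> C * ndist V x y"
    and L: "(\<lambda>k. \<phi> (s k)) \<longlonglongrightarrow> L"
  shows "(\<lambda>n. \<phi> (v n)) \<longlonglongrightarrow> L"
proof -
  have bound: "norm (\<phi> (v n) - L) \<le> C * ndist (completion V) (into_completion V (v n)) (cls s)" for n
  proof (rule LIMSEQ_le)
    show "(\<lambda>k. norm (\<phi> (v n) - \<phi> (s k))) \<longlonglongrightarrow> norm (\<phi> (v n) - L)"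
      using L by (intro tendsto_intros)
    show "(\<lambda>k. C * ndist V (v n) (s k))
        \<longlonglongrightarrow> C * ndist (completion V) (into_completion V (v n)) (cls s)"
      using v s by (intro tendsto_mult_left ndist_into_completion_cls_tendsto)
    show "\<exists>N. \<forall>k\<ge>N. norm (\<phi> (v n) - \<phi> (s k)) \<le> C * ndist V (v n) (s k)"
      using lip v s cauchy_seqs_carr by blast
  qed
  have "(\<lambda>n. C * ndist (completion V) (into_completion V (v n)) (cls s)) \<longlonglongrightarrow> C * 0"
    using lim unfolding nlimit_def by (rule tendsto_mult_left)
  then have "(\<lambda>n. \<phi> (v n) - L) \<longlonglongrightarrow> 0"
    by (intro Lim_null_comparison[where f = "\<lambda>n. \<phi> (v n) - L", OF always_eventually])
      (simp_all add: bound)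
  then show ?thesis by (simp add: LIM_zero_iff)
qed

end

section \<open>The spaces \<open>\<ell>\<^sub>p\<close> and the projective norm\<close>

text \<open>Away from 0 this is convexity of the power. If one of the points is 0, the claim reduces
  to s^p \<le> s on [0, 1].\<close>

lemma powr_convex_combination:
  fixes u v s t p :: real
  assumes "1 \<le> p" "0 \<le> u" "0 \<le> v" "0 \<le> s" "0 \<le> t" "s + t = 1"
  shows "(s * u + t * v) powr p \<le> s * u powr p + t * v powr p"
proof -
  have le: "r powr p \<le> r" if "0 \<le> r" "r \<le> 1" for r :: real
    using powr_mono'[of 1 p r] that assms(1) by (cases "r = 0") auto
  show ?thesis
  proof (cases "u = 0 \<or> v = 0")
    case True
    then show ?thesis
      using assms le[of s] le[of t] by (auto simp: powr_mult intro!: mult_right_mono)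
  next
    case False
    then show ?thesis
      using powr_convex[of p] assms by (auto simp: convex_on_def)
  qed
qed

lemma ell_simps:
  "zer (ell p) = (\<lambda>n. 0)" "add (ell p) x y = (\<lambda>n. x n + y n)" "scl (ell p) c x = (\<lambda>n. c * x n)"
  "x \<in> carr (ell p) \<longleftrightarrow> summable (\<lambda>n. norm (x n) powr p)"
  "nrm (ell p) x = (\<Sum>n. norm (x n) powr p) powr (1 / p)"
  by (auto simp: ell_def)

context
  fixes p :: real
  assumes p1: "1 \<le> p"
begin

lemma ell_nrm_powr:
  assumes "x \<in> carr (ell p)"
  shows "nrm (ell p) x powr p = (\<Sum>n. norm (x n) powr p)"
  using assms p1 by (simp add: ell_simps powr_powr suminf_nonneg)

lemma ell_nrm_nonneg: "0 \<le> nrm (ell p) x"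
  by (simp add: ell_simps)

lemma ell_nrm_leI:
  assumes "x \<in> carr (ell p)" "0 \<le> c" "(\<Sum>n. norm (x n) powr p) \<le> c powr p"
  shows "nrm (ell p) x \<le> c"
proof -
  have "nrm (ell p) x \<le> (c powr p) powr (1 / p)"
    using assms p1 by (auto simp: ell_simps intro!: powr_mono2 suminf_nonneg)
  with assms p1 show ?thesis by (simp add: powr_powr)
qed

lemma ell_nrm_le_iff:
  assumes "x \<in> carr (ell p)" "0 \<le> c"
  shows "nrm (ell p) x \<le> c \<longleftrightarrow> (\<Sum>n. norm (x n) powr p) \<le> c powr p"
  using ell_nrm_leI[OF assms] powr_mono2[of p "nrm (ell p) x" c] p1 ell_nrm_nonneg
    ell_nrm_powr[OF assms(1)] by force

text \<open>Minkowski's inequality: divide \<open>x\<close> and \<open>y\<close> by numbers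
  \<open>A\<close> and \<open>B\<close> slightly above their norms, apply convexity of t^p with
  weights A/(A+B) and B/(A+B), and sum. The margin \<open>e\<close> keeps both divisors positive
  even for vectors of norm 0 and is removed at the end.\<close>

lemma
  assumes x: "x \<in> carr (ell p)" and y: "y \<in> carr (ell p)"
  shows ell_add_carr: "(\<lambda>n. x n + y n) \<in> carr (ell p)"
    and ell_nrm_add: "nrm (ell p) (\<lambda>n. x n + y n) \<le> nrm (ell p) x + nrm (ell p) y"
proof -
  let ?S = "\<lambda>x. \<Sum>n. norm (x n :: 'a) powr p"
  have main: "(\<lambda>n. x n + y n) \<in> carr (ell p) \<and>
      nrm (ell p) (\<lambda>n. x n + y n) \<le> nrm (ell p) x + nrm (ell p) y + 2 * e" if e: "e > 0" for e
  proof -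
    define A where "A = nrm (ell p) x + e"
    define B where "B = nrm (ell p) y + e"
    have pos: "A > 0" "B > 0"
      unfolding A_def B_def using e ell_nrm_nonneg[of x] ell_nrm_nonneg[of y] by linarith+
    have SA: "?S x \<le> A powr p" "?S y \<le> B powr p"
      using ell_nrm_le_iff[OF x, of A] ell_nrm_le_iff[OF y, of B] pos e
      by (auto simp: A_def B_def)
    define s where "s = A / (A + B)"
    define t where "t = B / (A + B)"
    have st: "s \<ge> 0" "t \<ge> 0" "s + t = 1"
      using pos by (auto simp: s_def t_def add_divide_distrib[symmetric])
    have bound: "norm (x n + y n) powr p
        \<le> (A + B) powr p * (s * (norm (x n) powr p / A powr p) + t * (norm (y n) powr p / B powr p))" for n
    proof -
      have "norm (x n + y n) \<le> (A + B) * (s * (norm (x n) / A) + t * (norm (y n) / B))"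
      proof -
        have "(A + B) * (s * (norm (x n) / A) + t * (norm (y n) / B)) = norm (x n) + norm (y n)"
          using pos by (simp add: s_def t_def distrib_left)
        then show ?thesis using norm_triangle_ineq[of "x n" "y n"] by simp
      qed
      then have "norm (x n + y n) powr p
          \<le> ((A + B) * (s * (norm (x n) / A) + t * (norm (y n) / B))) powr p"
        using p1 by (intro powr_mono2) auto
      also have "\<dots> = (A + B) powr p * (s * (norm (x n) / A) + t * (norm (y n) / B)) powr p"
        using pos st by (intro powr_mult)
      also have "\<dots> \<le> (A + B) powr p * (s * (norm (x n) / A) powr p + t * (norm (y n) / B) powr p)"
        using pos st p1 by (intro mult_left_mono powr_convex_combination) auto
      finally show ?thesis using pos by (simp add: powr_divide)
    qed
    let ?g = "\<lambda>n. (A + B) powr p * (s * (norm (x n) powr p / A powr p) + t * (norm (y n) powr p / B powr p))"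
    have sx: "summable (\<lambda>n. norm (x n) powr p)" "summable (\<lambda>n. norm (y n) powr p)"
      using x y by (auto simp: ell_simps)
    have g: "?g sums ((A + B) powr p * (s * (?S x / A powr p) + t * (?S y / B powr p)))"
      using sx by (intro sums_mult sums_add sums_divide) (auto simp: summable_sums)
    have car: "(\<lambda>n. x n + y n) \<in> carr (ell p)"
      unfolding ell_simps using bound
      by (intro summable_comparison_test'[OF sums_summable[OF g], of 0]) auto
    have "(\<Sum>n. norm (x n + y n) powr p) \<le> (A + B) powr p * (s * (?S x / A powr p) + t * (?S y / B powr p))"
      using car bound sums_summable[OF g] unfolding sums_unique[OF g] ell_simps
      by (intro suminf_le) auto
    also have "\<dots> \<le> (A + B) powr p * (s * 1 + t * 1)"
      using SA st pos by (intro mult_left_mono add_mono) (auto simp: divide_le_eq)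
    finally have "nrm (ell p) (\<lambda>n. x n + y n) \<le> A + B"
      using car pos st by (intro ell_nrm_leI) auto
    with car show ?thesis by (simp add: A_def B_def)
  qed
  show "(\<lambda>n. x n + y n) \<in> carr (ell p)" using main[of 1] by simp
  show "nrm (ell p) (\<lambda>n. x n + y n) \<le> nrm (ell p) x + nrm (ell p) y"
  proof (rule field_le_epsilon)
    fix e :: real assume "e > 0"
    then show "nrm (ell p) (\<lambda>n. x n + y n) \<le> nrm (ell p) x + nrm (ell p) y + e"
      using main[of "e / 2"] by simp
  qed
qed

lemma fun_nspace_ell: "fun_nspace (ell p)"
proof
  fix x :: "nat \<Rightarrow> 'a" and c :: 'a
  assume x: "x \<in> carr (ell p)"
  then show "(\<lambda>n. c * x n) \<in> carr (ell p)"
    by (simp add: ell_simps norm_mult powr_mult summable_mult)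
  have "(\<Sum>n. norm (c * x n) powr p) = norm c powr p * (\<Sum>n. norm (x n) powr p)"
    using x by (simp add: ell_simps norm_mult powr_mult suminf_mult)
  then show "nrm (ell p) (\<lambda>n. c * x n) = norm c * nrm (ell p) x"
    using x p1 by (simp add: ell_simps powr_mult powr_powr suminf_nonneg)
qed (auto simp: ell_simps(1-3) ell_add_carr ell_nrm_add, simp add: ell_simps)

lemma ell_nrm_mono:
  assumes "y \<in> carr (ell p)" "\<And>n. norm (x n) \<le> norm (y n)"
  shows "nrm (ell p) x \<le> nrm (ell p) y"
proof -
  have le: "norm (x n) powr p \<le> norm (y n) powr p" for n
    using assms(2)[of n] p1 by (intro powr_mono2) auto
  have x: "x \<in> carr (ell p)"
    using summable_comparison_test'[of "\<lambda>n. norm (y n) powr p" 0 "\<lambda>n. norm (x n) powr p"] assms(1) le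
    by (simp add: ell_simps)
  show "nrm (ell p) x \<le> nrm (ell p) y"
    using suminf_le[OF le] suminf_nonneg[of "\<lambda>n. norm (x n) powr p"] x assms(1) p1 unfolding ell_simps
    by (intro powr_mono2) simp_all
qed

lemma
  assumes "\<And>n. n \<ge> N \<Longrightarrow> x n = 0"
  shows ell_finite_support_carr: "x \<in> carr (ell p)"
    and ell_finite_support_nrm: "nrm (ell p) x = (\<Sum>n<N. norm (x n) powr p) powr (1 / p)"
proof -
  have *: "(\<lambda>n. norm (x n) powr p) sums (\<Sum>n<N. norm (x n) powr p)"
    using assms by (intro sums_finite) auto
  then show "x \<in> carr (ell p)" "nrm (ell p) x = (\<Sum>n<N. norm (x n) powr p) powr (1 / p)"
    using sums_summable[OF *] sums_unique[OF *] by (auto simp: ell_simps)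
qed

lemma norm_le_ell_nrm:
  assumes "x \<in> carr (ell p)"
  shows "norm (x n) \<le> nrm (ell p) x"
proof -
  have "norm (x n) powr p \<le> (\<Sum>n. norm (x n) powr p)"
    using assms sum_le_suminf[of "\<lambda>n. norm (x n) powr p" "{n}"] by (auto simp: ell_simps)
  then have "(norm (x n) powr p) powr (1 / p) \<le> nrm (ell p) x"
    using p1 by (auto simp: ell_simps intro: powr_mono2)
  then show ?thesis using p1 by (simp add: powr_powr)
qed

lemma ell_nrm_eq_0D: "x \<in> carr (ell p) \<Longrightarrow> nrm (ell p) x = 0 \<Longrightarrow> x = (\<lambda>n. 0)"
  using norm_le_ell_nrm[of x] by fastforce

text \<open>Membership becomes countably many closed conditions, each on finitely many coordinates.
  This is what makes the ball accessible to coordinatewise limits and to coordinatewise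
  measurability.\<close>

lemma unit_ball_ell_iff:
  "x \<in> unit_ball (ell p) \<longleftrightarrow> (\<forall>N. (\<Sum>n<N. norm (x n) powr p) \<le> 1)"
proof
  assume x: "x \<in> unit_ball (ell p)"
  then have "(\<Sum>n. norm (x n) powr p) \<le> 1"
    using ell_nrm_le_iff[of x 1] by (auto simp: unit_ball_def)
  then show "\<forall>N. (\<Sum>n<N. norm (x n) powr p) \<le> 1"
    using x sum_le_suminf[of "\<lambda>n. norm (x n) powr p" "{..<N}" for N]
    by (auto simp: unit_ball_def ell_simps intro: order_trans)
next
  assume *: "\<forall>N. (\<Sum>n<N. norm (x n) powr p) \<le> 1"
  then have "x \<in> carr (ell p)"
    by (auto simp: ell_simps intro!: summableI_nonneg_bounded[where x = 1])
  moreover have "(\<Sum>n. norm (x n) powr p) \<le> 1"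
    using calculation * by (intro suminf_le_const) (auto simp: ell_simps)
  ultimately show "x \<in> unit_ball (ell p)"
    using ell_nrm_leI[of x 1] by (auto simp: unit_ball_def)
qed

lemma ell_tail_tendsto_0:
  assumes x: "x \<in> carr (ell p)"
  shows "(\<lambda>N. nrm (ell p) (\<lambda>n. x n - (if n < N then x n else 0))) \<longlonglongrightarrow> 0"
proof -
  let ?f = "\<lambda>n. norm (x n) powr p"
  have s: "summable ?f" using x by (simp add: ell_simps)
  have "(\<Sum>n. norm (x n - (if n < N then x n else 0)) powr p) = (\<Sum>n. ?f n) - (\<Sum>n<N. ?f n)" for N
  proof -
    have "(\<lambda>n. ?f n - (if n < N then ?f n else 0)) sums ((\<Sum>n. ?f n) - (\<Sum>n<N. ?f n))"
      using s sums_finite[of "{..<N}" "\<lambda>n. if n < N then ?f n else 0"]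
      by (intro sums_diff) (auto simp: summable_sums)
    moreover have "?f n - (if n < N then ?f n else 0) = norm (x n - (if n < N then x n else 0)) powr p" for n
      by simp
    ultimately show ?thesis by (simp add: sums_iff)
  qed
  moreover have "(\<lambda>N. ((\<Sum>n. ?f n) - (\<Sum>n<N. ?f n)) powr (1 / p)) \<longlonglongrightarrow> 0 powr (1 / p)"
  proof (rule tendsto_powr2)
    show "(\<lambda>N. (\<Sum>n. ?f n) - (\<Sum>n<N. ?f n)) \<longlonglongrightarrow> 0"
      using tendsto_diff[OF tendsto_const summable_LIMSEQ[OF s], of "\<Sum>n. ?f n"] by simp
    show "\<forall>\<^sub>F N in sequentially. 0 \<le> (\<Sum>n. ?f n) - (\<Sum>n<N. ?f n)"
      using s sum_le_suminf[of ?f "{..<N}" for N] by (intro always_eventually) (auto)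
  qed (use p1 in auto)
  ultimately show ?thesis by (simp add: ell_simps(5))
qed

end

section \<open>The projective norm on the algebraic tensor product\<close>

locale tensor_pair = E: fun_nspace E + F: fun_nspace F
  for E :: "('k::real_normed_field, 'i \<Rightarrow> 'k) nspace" and F :: "('k, 'j \<Rightarrow> 'k) nspace"
begin

lemma elem_tensor_add_left:
  "x \<in> carr E \<Longrightarrow> x' \<in> carr E \<Longrightarrow> y \<in> carr F \<Longrightarrow>
    elem_tensor E F (\<lambda>i. x i + x' i) y B = elem_tensor E F x y B + elem_tensor E F x' y B"
  by (auto simp: elem_tensor_def bilinear_forms_def E.add_eq)

lemma elem_tensor_add_right:
  "x \<in> carr E \<Longrightarrow> y \<in> carr F \<Longrightarrow> y' \<in> carr F \<Longrightarrow>
    elem_tensor E F x (\<lambda>i. y i + y' i) B = elem_tensor E F x y B + elem_tensor E F x y' B"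
  by (auto simp: elem_tensor_def bilinear_forms_def F.add_eq)

lemma elem_tensor_scl_left:
  "x \<in> carr E \<Longrightarrow> y \<in> carr F \<Longrightarrow> elem_tensor E F (\<lambda>i. c * x i) y B = c * elem_tensor E F x y B"
  by (auto simp: elem_tensor_def bilinear_forms_def E.scl_eq)

lemma elem_tensor_scl_right:
  "x \<in> carr E \<Longrightarrow> y \<in> carr F \<Longrightarrow> elem_tensor E F x (\<lambda>i. c * y i) B = c * elem_tensor E F x y B"
  by (auto simp: elem_tensor_def bilinear_forms_def F.scl_eq)

lemma elem_tensor_diff_left:
  "x \<in> carr E \<Longrightarrow> x' \<in> carr E \<Longrightarrow> y \<in> carr F \<Longrightarrow>
    elem_tensor E F (\<lambda>i. x i - x' i) y B = elem_tensor E F x y B - elem_tensor E F x' y B"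
  using elem_tensor_add_left[of "\<lambda>i. x i - x' i" x' y B] E.diff_carr[of x x'] by simp

lemma elem_tensor_diff_right:
  "x \<in> carr E \<Longrightarrow> y \<in> carr F \<Longrightarrow> y' \<in> carr F \<Longrightarrow>
    elem_tensor E F x (\<lambda>i. y i - y' i) B = elem_tensor E F x y B - elem_tensor E F x y' B"
  using elem_tensor_add_right[of x "\<lambda>i. y i - y' i" y' B] F.diff_carr[of y y'] by simp

lemma elem_tensor_zero_left: "y \<in> carr F \<Longrightarrow> elem_tensor E F (\<lambda>i. 0) y B = 0"
  using elem_tensor_scl_left[OF E.zero_carr, of y 0 B] by simp

lemma elem_tensor_zero_right: "x \<in> carr E \<Longrightarrow> elem_tensor E F x (\<lambda>i. 0) B = 0"
  using elem_tensor_scl_right[OF _ F.zero_carr, of x 0 B] by simp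

lemma elem_tensor_sum_left:
  "(\<And>j. j \<in> J \<Longrightarrow> f j \<in> carr E) \<Longrightarrow> y \<in> carr F \<Longrightarrow>
    elem_tensor E F (\<lambda>i. \<Sum>j\<in>J. f j i) y B = (\<Sum>j\<in>J. elem_tensor E F (f j) y B)"
  by (induction J rule: infinite_finite_induct)
    (auto simp: elem_tensor_zero_left elem_tensor_add_left E.sum_carr)

lemma elem_tensor_sum_right:
  "(\<And>j. j \<in> J \<Longrightarrow> f j \<in> carr F) \<Longrightarrow> x \<in> carr E \<Longrightarrow>
    elem_tensor E F x (\<lambda>i. \<Sum>j\<in>J. f j i) B = (\<Sum>j\<in>J. elem_tensor E F x (f j) B)"
  by (induction J rule: infinite_finite_induct)
    (auto simp: elem_tensor_zero_right elem_tensor_add_right F.sum_carr)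

lemma alg_simps:
  "zer (alg_tensor E F) = (\<lambda>B. 0)" "add (alg_tensor E F) z w = (\<lambda>B. z B + w B)"
  "scl (alg_tensor E F) c z = (\<lambda>B. c * z B)"
  "z \<in> carr (alg_tensor E F) \<longleftrightarrow> (\<exists>n x y. is_tensor_rep E F z n x y)"
  "nrm (alg_tensor E F) z = Inf {\<Sum>i<n. nrm E (x i) * nrm F (y i) | n x y. is_tensor_rep E F z n x y}"
  by (auto simp: alg_tensor_def)

lemma rep_sum_nonneg:
  "is_tensor_rep E F z n x y \<Longrightarrow> 0 \<le> (\<Sum>i<n. nrm E (x i) * nrm F (y i))"
  by (intro sum_nonneg mult_nonneg_nonneg E.nrm_nonneg F.nrm_nonneg) (auto simp: is_tensor_rep_def)

lemma alg_nrm_le: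
  "is_tensor_rep E F z n x y \<Longrightarrow> nrm (alg_tensor E F) z \<le> (\<Sum>i<n. nrm E (x i) * nrm F (y i))"
  unfolding alg_simps by (rule cInf_lower) (auto intro!: bdd_belowI[of _ 0] rep_sum_nonneg)

lemma alg_rep_approx:
  assumes "z \<in> carr (alg_tensor E F)" "e > 0"
  obtains n x y where "is_tensor_rep E F z n x y"
    "(\<Sum>i<n. nrm E (x i) * nrm F (y i)) < nrm (alg_tensor E F) z + e"
proof -
  have "Inf {\<Sum>i<n. nrm E (x i) * nrm F (y i) | n x y. is_tensor_rep E F z n x y}
      < nrm (alg_tensor E F) z + e"
    using assms(2) by (simp add: alg_simps)
  from cInf_lessD[OF _ this] assms(1) that show thesis by (auto simp: alg_simps(4))
qed

lemma rep_add:
  assumes "is_tensor_rep E F z n x y" "is_tensor_rep E F w m x' y'"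
  shows "is_tensor_rep E F (\<lambda>B. z B + w B) (n + m)
      (\<lambda>i. if i < n then x i else x' (i - n)) (\<lambda>i. if i < n then y i else y' (i - n))"
    and "(\<Sum>i<n + m. nrm E (if i < n then x i else x' (i - n)) * nrm F (if i < n then y i else y' (i - n)))
      = (\<Sum>i<n. nrm E (x i) * nrm F (y i)) + (\<Sum>i<m. nrm E (x' i) * nrm F (y' i))"
proof -
  have split: "(\<Sum>i<n + m. f (if i < n then x i else x' (i - n)) (if i < n then y i else y' (i - n)))
      = (\<Sum>i<n. f (x i) (y i)) + (\<Sum>i<m. f (x' i) (y' i))" for f :: "_ \<Rightarrow> _ \<Rightarrow> 'z::comm_monoid_add"
    by (induction m) (simp_all add: add.assoc)
  show "is_tensor_rep E F (\<lambda>B. z B + w B) (n + m)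
      (\<lambda>i. if i < n then x i else x' (i - n)) (\<lambda>i. if i < n then y i else y' (i - n))"
    using assms split[of "\<lambda>x y. elem_tensor E F x y B" for B] by (auto simp: is_tensor_rep_def)
  show "(\<Sum>i<n + m. nrm E (if i < n then x i else x' (i - n)) * nrm F (if i < n then y i else y' (i - n)))
      = (\<Sum>i<n. nrm E (x i) * nrm F (y i)) + (\<Sum>i<m. nrm E (x' i) * nrm F (y' i))"
    by (rule split)
qed

lemma rep_scl:
  assumes "is_tensor_rep E F z n x y"
  shows "is_tensor_rep E F (\<lambda>B. c * z B) n (\<lambda>i j. c * x i j) y"
  using assms
  by (auto simp: is_tensor_rep_def sum_distrib_left elem_tensor_scl_left E.scl_carr intro!: ext sum.cong)

lemma rep_elem_tensor:
  "x \<in> carr E \<Longrightarrow> y \<in> carr F \<Longrightarrow> is_tensor_rep E F (elem_tensor E F x y) 1 (\<lambda>_. x) (\<lambda>_. y)"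
  by (auto simp: is_tensor_rep_def)

lemma alg_nrm_nonneg:
  assumes "z \<in> carr (alg_tensor E F)"
  shows "0 \<le> nrm (alg_tensor E F) z"
  using assms unfolding alg_simps by (intro cInf_greatest) (auto intro!: rep_sum_nonneg)

lemma alg_nrm_scl_le:
  assumes z: "z \<in> carr (alg_tensor E F)"
  shows "nrm (alg_tensor E F) (\<lambda>B. c * z B) \<le> norm c * nrm (alg_tensor E F) z"
proof -
  have *: "nrm (alg_tensor E F) (\<lambda>B. c * z B) \<le> norm c * (nrm (alg_tensor E F) z + e)" if e: "e > 0" for e
  proof -
    obtain n x y where r: "is_tensor_rep E F z n x y"
      "(\<Sum>i<n. nrm E (x i) * nrm F (y i)) < nrm (alg_tensor E F) z + e"
      using alg_rep_approx[OF z e] by blast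
    have "nrm (alg_tensor E F) (\<lambda>B. c * z B) \<le> (\<Sum>i<n. nrm E (\<lambda>j. c * x i j) * nrm F (y i))"
      by (rule alg_nrm_le[OF rep_scl[OF r(1)]])
    also have "\<dots> = norm c * (\<Sum>i<n. nrm E (x i) * nrm F (y i))"
      using r(1) by (simp add: is_tensor_rep_def E.nrm_scl sum_distrib_left mult.assoc)
    also have "\<dots> \<le> norm c * (nrm (alg_tensor E F) z + e)"
      using r(2) by (intro mult_left_mono) auto
    finally show ?thesis .
  qed
  show ?thesis
  proof (rule LIMSEQ_le_const)
    show "(\<lambda>k. norm c * (nrm (alg_tensor E F) z + 1 / real (Suc k))) \<longlonglongrightarrow> norm c * nrm (alg_tensor E F) z"
      using tendsto_mult_left[OF tendsto_add[OF tendsto_const LIMSEQ_Suc[OF lim_1_over_n]]]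
      by (metis add.right_neutral)
  qed (use * in auto)
qed

text \<open>\<open>fun_nspace\<close> describes seminorms, and the passage to the completion divides
  out null vectors. The triangle inequality comes from concatenating almost optimal representations;
  homogeneity follows from \<open>alg_nrm_scl_le\<close> applied to both \<open>c\<close> and its
  inverse.\<close>

lemma fun_nspace_alg_tensor: "fun_nspace (alg_tensor E F)"
proof
  show "(\<lambda>B. 0) \<in> carr (alg_tensor E F)"
    unfolding alg_simps
    by (rule exI[of _ 0], rule exI[of _ "\<lambda>_ _. 0"], rule exI[of _ "\<lambda>_ _. 0"]) (simp add: is_tensor_rep_def)
  fix z w and c :: 'k
  assume z: "z \<in> carr (alg_tensor E F)"
  then show cz: "(\<lambda>B. c * z B) \<in> carr (alg_tensor E F)"
    unfolding alg_simps using rep_scl by blast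
  show "nrm (alg_tensor E F) (\<lambda>B. c * z B) = norm c * nrm (alg_tensor E F) z"
  proof (cases "c = 0")
    case True
    have "nrm (alg_tensor E F) (\<lambda>B. 0) \<le> 0"
      using alg_nrm_scl_le[OF z, of 0] by simp
    then show ?thesis
      using True alg_nrm_nonneg[OF \<open>(\<lambda>B. 0) \<in> carr (alg_tensor E F)\<close>] by simp
  next
    case False
    have "nrm (alg_tensor E F) z \<le> norm (inverse c) * nrm (alg_tensor E F) (\<lambda>B. c * z B)"
      using alg_nrm_scl_le[OF cz, of "inverse c"] False by (simp add: mult.assoc[symmetric])
    then have "norm c * nrm (alg_tensor E F) z \<le> nrm (alg_tensor E F) (\<lambda>B. c * z B)"
      using False by (simp add: norm_inverse norm_divide field_simps)
    then show ?thesis using alg_nrm_scl_le[OF z, of c] by simp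
  qed
  assume w: "w \<in> carr (alg_tensor E F)"
  show "(\<lambda>B. z B + w B) \<in> carr (alg_tensor E F)"
    using z w rep_add(1) unfolding alg_simps by blast
  show "nrm (alg_tensor E F) (\<lambda>B. z B + w B) \<le> nrm (alg_tensor E F) z + nrm (alg_tensor E F) w"
  proof (rule field_le_epsilon)
    fix e :: real assume "e > 0"
    then have e: "e / 2 > 0" by simp
    obtain n x y where r: "is_tensor_rep E F z n x y"
      "(\<Sum>i<n. nrm E (x i) * nrm F (y i)) < nrm (alg_tensor E F) z + e / 2"
      using alg_rep_approx[OF z e] by blast
    obtain m x' y' where r': "is_tensor_rep E F w m x' y'"
      "(\<Sum>i<m. nrm E (x' i) * nrm F (y' i)) < nrm (alg_tensor E F) w + e / 2"
      using alg_rep_approx[OF w e] by blast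
    show "nrm (alg_tensor E F) (\<lambda>B. z B + w B) \<le> nrm (alg_tensor E F) z + nrm (alg_tensor E F) w + e"
      using alg_nrm_le[OF rep_add(1)[OF r(1) r'(1)]] rep_add(2)[OF r(1) r'(1)] r(2) r'(2) by linarith
  qed
qed (simp_all add: alg_simps(1-3))

sublocale T: fun_nspace "alg_tensor E F"
  by (rule fun_nspace_alg_tensor)

lemma elem_tensor_carr:
  "x \<in> carr E \<Longrightarrow> y \<in> carr F \<Longrightarrow> elem_tensor E F x y \<in> carr (alg_tensor E F)"
  unfolding alg_simps using rep_elem_tensor by blast

lemma nrm_elem_tensor_le:
  "x \<in> carr E \<Longrightarrow> y \<in> carr F \<Longrightarrow> nrm (alg_tensor E F) (elem_tensor E F x y) \<le> nrm E x * nrm F y"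
  using alg_nrm_le[OF rep_elem_tensor] by force

lemma ndist_elem_tensor_le:
  assumes "x \<in> carr E" "x' \<in> carr E" "y \<in> carr F" "y' \<in> carr F"
  shows "ndist (alg_tensor E F) (elem_tensor E F x y) (elem_tensor E F x' y')
    \<le> ndist E x x' * nrm F y + nrm E x' * ndist F y y'"
proof -
  have "elem_tensor E F x y B - elem_tensor E F x' y' B
      = elem_tensor E F (\<lambda>i. x i - x' i) y B + elem_tensor E F x' (\<lambda>j. y j - y' j) B" for B
    using assms by (simp add: elem_tensor_diff_left elem_tensor_diff_right)
  then have "ndist (alg_tensor E F) (elem_tensor E F x y) (elem_tensor E F x' y')
      \<le> nrm (alg_tensor E F) (elem_tensor E F (\<lambda>i. x i - x' i) y)
        + nrm (alg_tensor E F) (elem_tensor E F x' (\<lambda>j. y j - y' j))"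
    unfolding T.ndist_eq using assms
    by (auto intro!: T.nrm_add elem_tensor_carr E.diff_carr F.diff_carr)
  also have "\<dots> \<le> nrm E (\<lambda>i. x i - x' i) * nrm F y + nrm E x' * nrm F (\<lambda>j. y j - y' j)"
    using assms by (intro add_mono nrm_elem_tensor_le E.diff_carr F.diff_carr)
  finally show ?thesis by (simp add: E.ndist_eq F.ndist_eq)
qed

text \<open>The easy half of the duality between the projective norm and bounded bilinear forms: the
  bound holds termwise in every representation, hence also for the infimum.\<close>

lemma bilinear_form_bound:
  assumes B: "B \<in> bilinear_forms E F" and C: "0 \<le> C"
    and le: "\<And>x y. x \<in> carr E \<Longrightarrow> y \<in> carr F \<Longrightarrow> norm (B x y) \<le> C * (nrm E x * nrm F y)"
    and z: "z \<in> carr (alg_tensor E F)"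
  shows "norm (z B) \<le> C * nrm (alg_tensor E F) z"
proof -
  have *: "norm (z B) \<le> C * (nrm (alg_tensor E F) z + e)" if e: "e > 0" for e
  proof -
    obtain n x y where r: "is_tensor_rep E F z n x y"
      "(\<Sum>i<n. nrm E (x i) * nrm F (y i)) < nrm (alg_tensor E F) z + e"
      using alg_rep_approx[OF z e] by blast
    have "z B = (\<Sum>i<n. B (x i) (y i))"
      using r(1) B by (simp add: is_tensor_rep_def elem_tensor_def)
    also have "norm \<dots> \<le> (\<Sum>i<n. C * (nrm E (x i) * nrm F (y i)))"
      using r(1) by (intro sum_norm_le le) (auto simp: is_tensor_rep_def)
    also have "\<dots> \<le> C * (nrm (alg_tensor E F) z + e)"
      using r(2) C unfolding sum_distrib_left[symmetric] by (intro mult_left_mono) auto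
    finally show ?thesis .
  qed
  show ?thesis
  proof (rule LIMSEQ_le_const)
    show "(\<lambda>k. C * (nrm (alg_tensor E F) z + 1 / real (Suc k))) \<longlonglongrightarrow> C * nrm (alg_tensor E F) z"
      using tendsto_mult_left[OF tendsto_add[OF tendsto_const LIMSEQ_Suc[OF lim_1_over_n]]]
      by (metis add.right_neutral)
  qed (use * in auto)
qed

lemma bilinear_form_lipschitz:
  assumes "B \<in> bilinear_forms E F" "0 \<le> C"
    and "\<And>x y. x \<in> carr E \<Longrightarrow> y \<in> carr F \<Longrightarrow> norm (B x y) \<le> C * (nrm E x * nrm F y)"
    and "z \<in> carr (alg_tensor E F)" "w \<in> carr (alg_tensor E F)"
  shows "norm (z B - w B) \<le> C * ndist (alg_tensor E F) z w"
  using bilinear_form_bound[OF assms(1-3) T.diff_carr[OF assms(4,5)]] by (simp add: T.ndist_eq)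

lemma tensor_eq: "tensor E F x y = into_completion (alg_tensor E F) (elem_tensor E F x y)"
  by (simp add: tensor_def)

end

section \<open>A tensor that is not norm-attaining\<close>

text \<open>Multiplication by a unimodular scalar is an isometry, and polarization carries this over
  to \<open>inner\<close>. The class constraints cover the real and the complex case together, with
  \<open>inner 1 z\<close> in the role of the real part of z.\<close>

lemma inner_mult_unit:
  fixes a b c :: "'k::{real_normed_field, real_inner}"
  assumes "norm c = 1"
  shows "inner (c * a) (c * b) = inner a b"
proof -
  have "norm (c * a + c * b) = norm (a + b)"
    using assms by (simp add: norm_mult flip: distrib_left)
  moreover have "norm (c * a) = norm a" "norm (c * b) = norm b"
    using assms by (simp_all add: norm_mult)
  ultimately show ?thesis
    using dot_norm[of "c * a" "c * b"] dot_norm[of a b] by simp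
qed

text \<open>Equality in Cauchy-Schwarz against 1: the squared norm of z - |z| expands to 0.\<close>

lemma eq_of_real_norm_if_inner_1_eq_norm:
  fixes z :: "'k::{real_normed_field, real_inner}"
  assumes "inner 1 z = norm z"
  shows "z = of_real (norm z)"
proof -
  have "inner (1 :: 'k) 1 = 1" by (simp add: dot_square_norm)
  then have "inner (z - norm z *\<^sub>R 1) (z - norm z *\<^sub>R 1) = 0"
    using assms unfolding inner_diff_left inner_diff_right
    by (simp add: dot_square_norm inner_commute power2_eq_square)
  then have "z - norm z *\<^sub>R 1 = 0" by (simp only: inner_eq_zero_iff)
  then show ?thesis by (simp add: of_real_def)
qed

text \<open>Bessel's inequality at the atom \<open>i\<close>. The function \<open>f N\<close> is the
  sum of the first N orthogonal functions, each rotated to have value 1 at \<open>i\<close>. Its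
  weighted square norm is N L, while the atom \<open>i\<close> alone contributes N^2 times
  \<open>l i\<close>, so \<open>l i\<close> \<le> L/N for every N. Quotients of unimodular numbers
  stand in for conjugation.\<close>

lemma weighted_orthonormal_sequence_False:
  fixes \<epsilon> :: "nat \<Rightarrow> nat \<Rightarrow> 'k::{real_normed_field, real_inner}" and l :: "nat \<Rightarrow> real"
  assumes l: "\<And>i. 0 \<le> l i" and L: "l sums L" and unit: "\<And>i n. norm (\<epsilon> i n) = 1"
    and orth: "\<And>n m. n \<noteq> m \<Longrightarrow> (\<lambda>i. l i *\<^sub>R (\<epsilon> i n / \<epsilon> i m)) sums 0"
  shows "l i = 0"
proof (rule ccontr)
  assume "l i \<noteq> 0"
  then have pos: "l i > 0" using l[of i] by simp
  have nz: "\<epsilon> j n \<noteq> 0" for j n using unit[of j n] by auto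
  define f where "f N j = (\<Sum>n<N. \<epsilon> j n / \<epsilon> i n)" for N j
  \<comment> \<open>Taking out the common unimodular factor leaves a single ratio that depends on
    \<open>j\<close>, to which \<open>orth\<close> applies by linearity.\<close>
  have inner_eq: "inner (\<epsilon> j n / \<epsilon> i n) (\<epsilon> j m / \<epsilon> i m)
      = inner 1 ((\<epsilon> i n / \<epsilon> i m) * (\<epsilon> j m / \<epsilon> j n))" for j n m
  proof -
    have "inner ((\<epsilon> j n / \<epsilon> i n) * 1) ((\<epsilon> j n / \<epsilon> i n) * ((\<epsilon> i n / \<epsilon> i m) * (\<epsilon> j m / \<epsilon> j n)))
        = inner 1 ((\<epsilon> i n / \<epsilon> i m) * (\<epsilon> j m / \<epsilon> j n))"
      by (rule inner_mult_unit) (simp add: norm_divide unit)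
    then show ?thesis by (simp add: nz)
  qed
  have pair: "(\<lambda>j. l j * inner (\<epsilon> j n / \<epsilon> i n) (\<epsilon> j m / \<epsilon> i m)) sums (if n = m then L else 0)" for n m
  proof (cases "n = m")
    case True
    then show ?thesis using L by (simp add: dot_square_norm norm_divide unit)
  next
    case False
    have bl: "bounded_linear (\<lambda>z. inner 1 ((\<epsilon> i n / \<epsilon> i m) * z))"
      by (intro bounded_linear_intros)
    have "(\<lambda>j. l j *\<^sub>R (\<epsilon> j m / \<epsilon> j n)) sums 0" using orth[of m n] False by simp
    from bounded_linear.sums[OF bl this] show ?thesis
      unfolding inner_eq using False by simp
  qed
  have sq: "(\<lambda>j. l j * (norm (f N j))\<^sup>2) sums (real N * L)" for N
  proof -
    have "(\<lambda>j. \<Sum>n<N. \<Sum>m<N. l j * inner (\<epsilon> j n / \<epsilon> i n) (\<epsilon> j m / \<epsilon> i m))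
        sums (\<Sum>n<N. \<Sum>m<N. if n = m then L else 0)"
      by (intro sums_sum pair)
    also have "(\<Sum>n<N. \<Sum>m<N. if n = m then L else 0) = real N * L"
      by simp
    also have "(\<lambda>j. \<Sum>n<N. \<Sum>m<N. l j * inner (\<epsilon> j n / \<epsilon> i n) (\<epsilon> j m / \<epsilon> i m))
        = (\<lambda>j. l j * (norm (f N j))\<^sup>2)"
      unfolding f_def dot_square_norm[symmetric] inner_sum_left inner_sum_right sum_distrib_left
      by (rule ext, rule sum.swap)
    finally show ?thesis .
  qed
  have "real N * l i \<le> L" if "N > 0" for N
  proof -
    have "f N i = of_nat N" by (simp add: f_def nz)
    then have "l i * (real N)\<^sup>2 \<le> real N * L"
      using l sum_le_suminf[OF sums_summable[OF sq[of N]], of "{i}"] sums_unique[OF sq[of N]]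
      by simp
    then show ?thesis using that by (simp add: power2_eq_square mult.assoc mult.commute)
  qed
  moreover obtain N where "real N * l i > L" using ex_less_of_nat_mult[OF pos] by blast
  ultimately show False
    using pos by (metis gr_zeroI not_less sums_le[OF _ sums_zero L] l mult_zero_left of_nat_0)
qed

text \<open>With G the weighted geometric mean, apply ln t \<le> t - 1 to w/G, A/G and B/G. The
  weighted logarithms cancel, and equality forces all three ratios to be 1. Since \<open>w\<close>
  carries positive weight, equality names the common value.\<close>

lemma weighted_am_gm_three:
  fixes w A B s a b :: real
  assumes "0 < w" "0 \<le> A" "0 \<le> B" "0 < s" "0 < a" "0 < b" "s + a + b = 1"
  shows "w powr s * A powr a * B powr b \<le> s * w + a * A + b * B"
    and "w powr s * A powr a * B powr b = s * w + a * A + b * B \<Longrightarrow> A = w \<and> B = w"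
proof -
  define G where "G = w powr s * A powr a * B powr b"
  let ?S = "s * w + a * A + b * B"
  have "G \<le> ?S \<and> (G = ?S \<longrightarrow> A = w \<and> B = w)"
  proof (cases "A = 0 \<or> B = 0")
    case True
    have "?S > 0" using assms by (intro add_pos_nonneg) auto
    with True show ?thesis by (auto simp: G_def)
  next
    case False
    then have pos: "A > 0" "B > 0" "G > 0" using assms by (auto simp: G_def)
    have lnG: "ln G = s * ln w + a * ln A + b * ln B"
      using pos(1,2) assms by (simp add: G_def ln_mult ln_powr)
    have le: "ln (t / G) \<le> t / G - 1" "t > 0 \<Longrightarrow> ln (t / G) = t / G - 1 \<Longrightarrow> t = G" if "t > 0" for t
      using ln_le_minus_one[of "t / G"] ln_eq_minus_one[of "t / G"] that pos by auto
    have "s * ln (w / G) + a * ln (A / G) + b * ln (B / G) = (s * ln w + a * ln A + b * ln B) - (s + a + b) * ln G"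
      using pos assms(1-6) by (simp add: ln_div algebra_simps)
    also have "\<dots> = 0" using assms lnG by simp
    finally have z: "s * ln (w / G) + a * ln (A / G) + b * ln (B / G) = 0" .
    have terms: "s * ln (w / G) \<le> s * (w / G - 1)" "a * ln (A / G) \<le> a * (A / G - 1)"
      "b * ln (B / G) \<le> b * (B / G - 1)"
      using le(1) pos assms by (auto intro!: mult_left_mono)
    have sum: "s * (w / G - 1) + a * (A / G - 1) + b * (B / G - 1) = ?S / G - 1"
      using assms(7) by (simp add: algebra_simps add_divide_distrib)
    have "?S / G \<ge> 1" using z terms sum by linarith
    then have "G \<le> ?S" using pos by (simp add: le_divide_eq)
    moreover have "A = w \<and> B = w" if "G = ?S"
    proof -
      have "?S / G = 1" using that pos by simp
      then have "s * ln (w / G) = s * (w / G - 1)" "a * ln (A / G) = a * (A / G - 1)"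
        "b * ln (B / G) = b * (B / G - 1)"
        using z terms sum by linarith+
      then have "w = G" "A = G" "B = G" using le(2) pos assms by auto
      then show ?thesis by simp
    qed
    ultimately show ?thesis by blast
  qed
  then show "w powr s * A powr a * B powr b \<le> ?S"
    "w powr s * A powr a * B powr b = ?S \<Longrightarrow> A = w \<and> B = w"
    by (auto simp: G_def)
qed

text \<open>The type class is shared by the real and the complex numbers.
  \<open>euclidean_space\<close> supplies compact scalar balls, used for rounding, and real
  coordinates, used for the space-filling curve.\<close>

locale ell_pair =
  fixes p q :: real and E F :: "('k::{real_normed_field, euclidean_space}, nat \<Rightarrow> 'k) nspace"
  assumes E_eq: "E = ell p" and F_eq: "F = ell q" and p: "1 \<le> p" and q: "1 \<le> q"

sublocale ell_pair \<subseteq> tensor_pair E F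
  by (simp add: tensor_pair_def E_eq F_eq fun_nspace_ell p q)

section \<open>Diagonal tensors and coordinate forms\<close>

context ell_pair
begin

definition diag_tensor ::
  "(nat \<Rightarrow> 'k) \<Rightarrow> (nat \<Rightarrow> 'k) \<Rightarrow> nat \<Rightarrow> ((nat \<Rightarrow> 'k) \<Rightarrow> (nat \<Rightarrow> 'k) \<Rightarrow> 'k) \<Rightarrow> 'k" where
  "diag_tensor c d N = (\<lambda>B. \<Sum>n<N. elem_tensor E F (\<lambda>k. if k = n then c n else 0) (\<lambda>k. if k = n then d n else 0) B)"

lemma single_carr: "(\<lambda>k. if k = n then c else 0) \<in> carr E" "(\<lambda>k. if k = n then c else 0) \<in> carr F"
  unfolding E_eq F_eq
  by (rule ell_finite_support_carr[OF p, of "Suc n"], simp)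
    (rule ell_finite_support_carr[OF q, of "Suc n"], simp)

lemma truncate_carr:
  "(\<lambda>k. if k < N then x k else 0) \<in> carr E" "(\<lambda>k. if k < N then x k else 0) \<in> carr F"
  unfolding E_eq F_eq
  by (rule ell_finite_support_carr[OF p, of N], simp) (rule ell_finite_support_carr[OF q, of N], simp)

lemma diag_tensor_carr: "diag_tensor c d N \<in> carr (alg_tensor E F)"
  unfolding diag_tensor_def by (intro T.sum_carr elem_tensor_carr single_carr)

text \<open>Induction on \<open>M\<close> averages over the signs of the coordinates: with \<open>e, f\<close> carried by the
  \<open>M\<close>-th coordinate, \<open>x \<otimes> y + e \<otimes> f\<close> is the mean of \<open>(x + e) \<otimes> (y + f)\<close> and \<open>(x - e) \<otimes> (y - f)\<close>.\<close>

lemma nrm_elem_plus_diag_le: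
  assumes "x \<in> carr E" "y \<in> carr F" "\<And>n. n < M \<Longrightarrow> x n = 0 \<and> y n = 0"
  shows "nrm (alg_tensor E F) (\<lambda>B. elem_tensor E F x y B + diag_tensor c d M B)
    \<le> nrm E (\<lambda>k. if k < M then c k else x k) * nrm F (\<lambda>k. if k < M then d k else y k)"
  using assms
proof (induction M arbitrary: x y)
  case 0
  then show ?case by (simp add: diag_tensor_def nrm_elem_tensor_le)
next
  case (Suc M)
  define e where "e = (\<lambda>k. if k = M then c M else 0)"
  define f where "f = (\<lambda>k. if k = M then d M else 0)"
  have ef: "e \<in> carr E" "f \<in> carr F" by (auto simp: e_def f_def single_carr)
  let ?x = "\<lambda>k. if k < Suc M then c k else x k" and ?y = "\<lambda>k. if k < Suc M then d k else y k"
  let ?z = "\<lambda>x y B. elem_tensor E F x y B + diag_tensor c d M B"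
  have glue: "(\<lambda>k. if k < Suc M then c k else x k) \<in> carr E" "(\<lambda>k. if k < Suc M then d k else y k) \<in> carr F"
  proof -
    have "(\<lambda>k. if k < Suc M then c k else x k) = (\<lambda>k. x k + (if k < Suc M then c k else 0))"
      "(\<lambda>k. if k < Suc M then d k else y k) = (\<lambda>k. y k + (if k < Suc M then d k else 0))"
      using Suc.prems(3) by auto
    then show "(\<lambda>k. if k < Suc M then c k else x k) \<in> carr E" "(\<lambda>k. if k < Suc M then d k else y k) \<in> carr F"
      using E.add_carr[OF Suc.prems(1) truncate_carr(1)[of "Suc M" c]]
        F.add_carr[OF Suc.prems(2) truncate_carr(2)[of "Suc M" d]] by simp_all
  qed
  have bound: "nrm (alg_tensor E F) (?z (\<lambda>k. x k + \<sigma> * e k) (\<lambda>k. y k + \<sigma> * f k)) \<le> nrm E ?x * nrm F ?y"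
    if \<sigma>: "norm \<sigma> = 1" for \<sigma> :: 'k
  proof -
    have car: "(\<lambda>k. x k + \<sigma> * e k) \<in> carr E" "(\<lambda>k. y k + \<sigma> * f k) \<in> carr F"
      using Suc.prems ef by (auto intro: E.add_carr E.scl_carr F.add_carr F.scl_carr)
    have "nrm (alg_tensor E F) (?z (\<lambda>k. x k + \<sigma> * e k) (\<lambda>k. y k + \<sigma> * f k))
        \<le> nrm E (\<lambda>k. if k < M then c k else x k + \<sigma> * e k) * nrm F (\<lambda>k. if k < M then d k else y k + \<sigma> * f k)"
      using Suc.prems(3) by (intro Suc.IH car) (auto simp: e_def f_def)
    also have "\<dots> \<le> nrm E ?x * nrm F ?y"
    proof (rule mult_mono)
      show "nrm E (\<lambda>k. if k < M then c k else x k + \<sigma> * e k) \<le> nrm E ?x"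
        using glue(1) \<sigma> Suc.prems(3) unfolding E_eq
        by (intro ell_nrm_mono[OF p]) (auto simp: e_def norm_mult less_Suc_eq)
      show "nrm F (\<lambda>k. if k < M then d k else y k + \<sigma> * f k) \<le> nrm F ?y"
        using glue(2) \<sigma> Suc.prems(3) unfolding F_eq
        by (intro ell_nrm_mono[OF q]) (auto simp: f_def norm_mult less_Suc_eq)
    qed (simp_all add: E_eq F_eq ell_nrm_nonneg[OF p] ell_nrm_nonneg[OF q])
    finally show ?thesis .
  qed
  define z1 where "z1 = ?z (\<lambda>k. x k + e k) (\<lambda>k. y k + f k)"
  define z2 where "z2 = ?z (\<lambda>k. x k - e k) (\<lambda>k. y k - f k)"
  have zc: "z1 \<in> carr (alg_tensor E F)" "z2 \<in> carr (alg_tensor E F)"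
    unfolding z1_def z2_def using Suc.prems ef
    by (auto intro!: T.add_carr elem_tensor_carr diag_tensor_carr E.add_carr F.add_carr E.diff_carr F.diff_carr)
  have mean: "elem_tensor E F x y B + diag_tensor c d (Suc M) B = (1 / 2) * (z1 B + z2 B)" for B
    unfolding z1_def z2_def using Suc.prems ef
    by (simp add: diag_tensor_def e_def[symmetric] f_def[symmetric] elem_tensor_add_left elem_tensor_add_right
      elem_tensor_diff_left elem_tensor_diff_right E.add_carr F.add_carr E.diff_carr F.diff_carr algebra_simps)
  have "nrm (alg_tensor E F) (\<lambda>B. elem_tensor E F x y B + diag_tensor c d (Suc M) B)
      = 1 / 2 * nrm (alg_tensor E F) (\<lambda>B. z1 B + z2 B)"
    unfolding mean using T.nrm_scl[OF T.add_carr[OF zc], of "1 / 2"] by (simp add: norm_divide)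
  also have "\<dots> \<le> 1 / 2 * (nrm (alg_tensor E F) z1 + nrm (alg_tensor E F) z2)"
    using T.nrm_add[OF zc] by simp
  also have "\<dots> \<le> nrm E ?x * nrm F ?y"
    using bound[of 1] bound[of "- 1"] by (simp add: z1_def z2_def)
  finally show ?case .
qed

text \<open>The difference of two partial sums is itself a diagonal tensor, built from the tails of
  \<open>c\<close> and \<open>d\<close>, so \<open>nrm_elem_plus_diag_le\<close> with a zero
  elementary tensor bounds it by the product of the tail norms.\<close>

lemma ndist_diag_tensor_le:
  assumes c: "c \<in> carr E" and d: "d \<in> carr F" and "N \<le> M"
  shows "ndist (alg_tensor E F) (diag_tensor c d M) (diag_tensor c d N)
    \<le> nrm E (\<lambda>k. c k - (if k < N then c k else 0)) * nrm F (\<lambda>k. d k - (if k < N then d k else 0))"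
proof -
  define c' where "c' = (\<lambda>k. c k - (if k < N then c k else 0))"
  define d' where "d' = (\<lambda>k. d k - (if k < N then d k else 0))"
  have cd': "c' \<in> carr E" "d' \<in> carr F"
    using E.diff_carr[OF c truncate_carr(1)] F.diff_carr[OF d truncate_carr(2)] by (auto simp: c'_def d'_def)
  have eq: "diag_tensor c d M B - diag_tensor c d N B
      = elem_tensor E F (\<lambda>k. 0) (\<lambda>k. 0) B + diag_tensor c' d' M B" for B
  proof -
    let ?t = "\<lambda>c d n. elem_tensor E F (\<lambda>k. if k = n then c n else 0) (\<lambda>k. if k = n then d n else 0) B"
    have "(\<Sum>n<M. ?t c' d' n) = (\<Sum>n\<in>{N..<M}. ?t c' d' n)"
    proof (rule sum.mono_neutral_right)
      have "?t c' d' n = 0" if "n < N" for n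
      proof -
        have "(\<lambda>k. if k = n then c' n else 0) = (\<lambda>k. 0)" using that by (auto simp: c'_def)
        then show ?thesis by (simp only: elem_tensor_zero_left single_carr)
      qed
      then show "\<forall>n\<in>{..<M} - {N..<M}. ?t c' d' n = 0" by auto
    qed auto
    also have "\<dots> = (\<Sum>n\<in>{N..<M}. ?t c d n)"
      by (rule sum.cong) (auto simp: c'_def d'_def cong: if_cong)
    also have "\<dots> = (\<Sum>n<M. ?t c d n) - (\<Sum>n<N. ?t c d n)"
      using \<open>N \<le> M\<close> sum_diff_nat_ivl[of 0 N M "?t c d"] by (simp add: lessThan_atLeast0)
    finally show ?thesis by (simp add: diag_tensor_def elem_tensor_zero_left F.zero_carr)
  qed
  have "ndist (alg_tensor E F) (diag_tensor c d M) (diag_tensor c d N)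
      = nrm (alg_tensor E F) (\<lambda>B. elem_tensor E F (\<lambda>k. 0) (\<lambda>k. 0) B + diag_tensor c' d' M B)"
    unfolding T.ndist_eq eq ..
  also have "\<dots> \<le> nrm E (\<lambda>k. if k < M then c' k else 0) * nrm F (\<lambda>k. if k < M then d' k else 0)"
    by (rule nrm_elem_plus_diag_le) (auto simp: E.zero_carr F.zero_carr)
  also have "\<dots> \<le> nrm E c' * nrm F d'"
    using cd' unfolding E_eq F_eq
    by (intro mult_mono ell_nrm_mono[OF p] ell_nrm_mono[OF q] ell_nrm_nonneg[OF p] ell_nrm_nonneg[OF q]) auto
  finally show ?thesis by (simp add: c'_def d'_def)
qed

lemma diag_tensor_cauchy:
  assumes c: "c \<in> carr E" and d: "d \<in> carr F"
  shows "diag_tensor c d \<in> cauchy_seqs (alg_tensor E F)"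
proof -
  let ?r = "\<lambda>N. nrm E (\<lambda>k. c k - (if k < N then c k else 0)) * nrm F (\<lambda>k. d k - (if k < N then d k else 0))"
  have "?r \<longlonglongrightarrow> 0 * 0"
    using ell_tail_tendsto_0[OF p, of c] ell_tail_tendsto_0[OF q, of d] c d unfolding E_eq F_eq
    by (intro tendsto_mult) auto
  then have lim: "?r \<longlonglongrightarrow> 0" by simp
  have "\<exists>N. \<forall>m\<ge>N. \<forall>n\<ge>N. ndist (alg_tensor E F) (diag_tensor c d m) (diag_tensor c d n) < e" if e: "e > 0" for e
  proof -
    obtain N where N: "\<And>n. n \<ge> N \<Longrightarrow> ?r n < e"
      using order_tendstoD(2)[OF lim e] unfolding eventually_sequentially by blast
    have "ndist (alg_tensor E F) (diag_tensor c d m) (diag_tensor c d n) < e" if "m \<ge> N" "n \<ge> N" for m n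
    proof (cases "n \<le> m")
      case True
      then show ?thesis using ndist_diag_tensor_le[OF c d True] N[OF that(2)] by linarith
    next
      case False
      then show ?thesis
        using ndist_diag_tensor_le[OF c d, of m n] N[OF that(1)]
          T.ndist_commute[OF diag_tensor_carr diag_tensor_carr, of c d m c d n] by linarith
    qed
    then show ?thesis by blast
  qed
  then show ?thesis by (auto simp: cauchy_seqs_def diag_tensor_carr)
qed

lemma nrm_diag_tensor_le:
  assumes c: "c \<in> carr E" and d: "d \<in> carr F"
  shows "nrm (completion (alg_tensor E F)) (T.cls (diag_tensor c d)) \<le> nrm E c * nrm F d"
proof (rule LIMSEQ_le_const2[OF T.nrm_completion_tendsto[OF diag_tensor_cauchy[OF c d]]])
  have "nrm (alg_tensor E F) (diag_tensor c d N) \<le> nrm E c * nrm F d" for N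
    using ndist_diag_tensor_le[OF c d, of 0 N] by (simp add: T.ndist_eq diag_tensor_def)
  then show "\<exists>N. \<forall>n\<ge>N. nrm (alg_tensor E F) (diag_tensor c d n) \<le> nrm E c * nrm F d" by blast
qed

lemma coord_form_bilinear: "(\<lambda>x y. x n * y m) \<in> bilinear_forms E F"
  by (simp add: bilinear_forms_def E.add_eq F.add_eq E.scl_eq F.scl_eq algebra_simps)

lemma coord_form_bound:
  "x \<in> carr E \<Longrightarrow> y \<in> carr F \<Longrightarrow> norm (x n * y m) \<le> 1 * (nrm E x * nrm F y)"
  unfolding norm_mult E_eq F_eq mult_1
  by (intro mult_mono norm_le_ell_nrm[OF p] norm_le_ell_nrm[OF q] ell_nrm_nonneg[OF p]) simp_all

lemma elem_tensor_coord: "elem_tensor E F x y (\<lambda>x y. x n * y m) = x n * y m"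
  by (simp add: elem_tensor_def coord_form_bilinear)

end

section \<open>The extremal diagonal tensor and its norming form\<close>

locale ell_pair_strict = ell_pair p q E F
  for p q :: real and E F :: "('k::{real_normed_field, euclidean_space}, nat \<Rightarrow> 'k) nspace" +
  assumes p1: "1 < p" and q1: "1 < q" and pq: "1 / p + 1 / q < 1"
begin

text \<open>The exponent that completes 1/p and 1/q to total weight 1 in Young's inequality.\<close>

definition gap :: real where "gap = 1 - 1 / p - 1 / q"
definition wt :: "nat \<Rightarrow> real" where "wt n = (1 / 2) ^ Suc n"
definition wtp :: "nat \<Rightarrow> real" where "wtp n = wt n powr (1 / p)"
definition wtq :: "nat \<Rightarrow> real" where "wtq n = wt n powr (1 / q)"
text \<open>The form that norms the extremal tensor: at the factors \<open>wtp n\<close> and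
  \<open>wtq n\<close> its n-th term is exactly \<open>wt n\<close> (see \<open>wt_prod\<close>),
  and these weights sum to 1.\<close>

definition diag_form :: "(nat \<Rightarrow> 'k) \<Rightarrow> (nat \<Rightarrow> 'k) \<Rightarrow> 'k" where
  "diag_form x y = (\<Sum>n. of_real (wt n powr gap) * (x n * y n))"

lemma gap_pos: "0 < gap" and gap_sum: "gap + 1 / p + 1 / q = 1"
  using pq by (auto simp: gap_def)

lemma wt_pos: "0 < wt n" by (simp add: wt_def)

lemma wt_sums: "wt sums 1"
  using power_half_series by (simp add: wt_def[abs_def])

lemma wtp_pos: "0 < wtp n" and wtq_pos: "0 < wtq n" using wt_pos[of n] by (auto simp: wtp_def wtq_def)

lemma wt_prod: "wt n powr gap * (wtp n * wtq n) = wt n"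
  using wt_pos[of n] by (simp add: wtp_def wtq_def gap_def flip: powr_add)

lemma wtp_carr: "(\<lambda>n. of_real (wtp n)) \<in> carr E" and wtp_nrm: "nrm E (\<lambda>n. of_real (wtp n)) = 1"
proof -
  have "norm (of_real (wtp n) :: 'k) powr p = wt n" for n
    using wtp_pos[of n] wt_pos[of n] p1 by (simp add: wtp_def powr_powr)
  then show "(\<lambda>n. of_real (wtp n)) \<in> carr E" "nrm E (\<lambda>n. of_real (wtp n)) = 1"
    using wt_sums by (simp_all add: E_eq ell_simps sums_iff)
qed

lemma wtq_carr: "(\<lambda>n. of_real (wtq n)) \<in> carr F" and wtq_nrm: "nrm F (\<lambda>n. of_real (wtq n)) = 1"
proof -
  have "norm (of_real (wtq n) :: 'k) powr q = wt n" for n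
    using wtq_pos[of n] wt_pos[of n] q1 by (simp add: wtq_def powr_powr)
  then show "(\<lambda>n. of_real (wtq n)) \<in> carr F" "nrm F (\<lambda>n. of_real (wtq n)) = 1"
    using wt_sums by (simp_all add: F_eq ell_simps sums_iff)
qed

lemma young_term:
  fixes x y :: 'k
  shows "wt n powr gap * (norm x * norm y) \<le> gap * wt n + norm x powr p / p + norm y powr q / q"
    and "wt n powr gap * (norm x * norm y) = gap * wt n + norm x powr p / p + norm y powr q / q \<Longrightarrow>
      norm x powr p = wt n \<and> norm y powr q = wt n"
  using weighted_am_gm_three[of "wt n" "norm x powr p" "norm y powr q" gap "1 / p" "1 / q"]
    wt_pos[of n] gap_pos gap_sum p1 q1
  by (simp_all add: powr_powr mult.assoc)

lemma young_bound_sums: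
  assumes "x \<in> carr E" "y \<in> carr F"
  shows "(\<lambda>n. gap * wt n + norm (x n) powr p / p + norm (y n) powr q / q)
    sums (gap + (nrm E x) powr p / p + (nrm F y) powr q / q)"
  using assms ell_nrm_powr[OF p, of x] ell_nrm_powr[OF q, of y] wt_sums unfolding E_eq F_eq ell_simps(4)
  by (intro sums_add sums_divide) (auto simp: summable_sums sums_mult[of wt 1 gap, simplified])

lemma diag_form_summable:
  assumes "x \<in> carr E" "y \<in> carr F"
  shows "summable (\<lambda>n. norm (of_real (wt n powr gap) * (x n * y n)))"
    "summable (\<lambda>n. of_real (wt n powr gap) * (x n * y n))"
proof -
  show *: "summable (\<lambda>n. norm (of_real (wt n powr gap) * (x n * y n)))"
    using young_term(1)
    by (intro summable_comparison_test'[OF sums_summable[OF young_bound_sums[OF assms]], of 0])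
      (simp add: norm_mult)
  then show "summable (\<lambda>n. of_real (wt n powr gap) * (x n * y n))" by (rule summable_norm_cancel)
qed

lemma diag_form_bilinear: "diag_form \<in> bilinear_forms E F"
proof -
  have "diag_form (\<lambda>n. x n + x' n) y = diag_form x y + diag_form x' y"
    if "x \<in> carr E" "x' \<in> carr E" "y \<in> carr F" for x x' y
    unfolding diag_form_def using that
    by (subst suminf_add) (auto intro: diag_form_summable(2) simp: distrib_left distrib_right)
  moreover have "diag_form x (\<lambda>n. y n + y' n) = diag_form x y + diag_form x y'"
    if "x \<in> carr E" "y \<in> carr F" "y' \<in> carr F" for x y y'
    unfolding diag_form_def using that
    by (subst suminf_add) (auto intro: diag_form_summable(2) simp: distrib_left distrib_right)
  moreover have "diag_form (\<lambda>n. a * x n) y = a * diag_form x y" "diag_form x (\<lambda>n. a * y n) = a * diag_form x y"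
    if "x \<in> carr E" "y \<in> carr F" for x y a
    unfolding diag_form_def using suminf_mult[OF diag_form_summable(2)[OF that], of a]
    by (simp_all add: mult_ac)
  ultimately show ?thesis
    by (simp add: bilinear_forms_def E.add_eq F.add_eq E.scl_eq F.scl_eq)
qed

lemma diag_form_le_1:
  assumes x: "x \<in> carr E" "nrm E x = 1" and y: "y \<in> carr F" "nrm F y = 1"
  shows "norm (diag_form x y) \<le> 1"
proof -
  have "norm (diag_form x y) \<le> (\<Sum>n. norm (of_real (wt n powr gap) * (x n * y n)))"
    unfolding diag_form_def by (rule summable_norm[OF diag_form_summable(1)[OF x(1) y(1)]])
  also have "\<dots> \<le> gap + (nrm E x) powr p / p + (nrm F y) powr q / q"
    using young_term(1) unfolding sums_unique[OF young_bound_sums[OF x(1) y(1)]]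
    by (intro suminf_le diag_form_summable(1)[OF x(1) y(1)] sums_summable[OF young_bound_sums[OF x(1) y(1)]])
      (simp add: norm_mult)
  finally show ?thesis using x y gap_sum by simp
qed

lemma diag_form_normalize:
  assumes "x \<in> carr E" "nrm E x > 0" "y \<in> carr F" "nrm F y > 0"
  shows "diag_form (\<lambda>n. x n / of_real (nrm E x)) (\<lambda>n. y n / of_real (nrm F y))
    = diag_form x y / of_real (nrm E x * nrm F y)"
proof -
  have "(\<lambda>n. of_real (wt n powr gap) * (x n * y n) / of_real (nrm E x * nrm F y))
      sums (diag_form x y / of_real (nrm E x * nrm F y))"
    unfolding diag_form_def
    by (intro sums_divide summable_sums diag_form_summable(2)[OF assms(1,3)])
  then show ?thesis
    unfolding diag_form_def[of "\<lambda>n. x n / of_real (nrm E x)"] by (simp add: sums_iff mult.assoc)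
qed

lemma diag_form_bound:
  assumes "x \<in> carr E" "y \<in> carr F"
  shows "norm (diag_form x y) \<le> 1 * (nrm E x * nrm F y)"
proof (cases "nrm E x = 0 \<or> nrm F y = 0")
  case True
  then have "x = (\<lambda>n. 0) \<or> y = (\<lambda>n. 0)"
    using assms ell_nrm_eq_0D[OF p, of x] ell_nrm_eq_0D[OF q, of y] unfolding E_eq F_eq by blast
  with True show ?thesis by (auto simp: diag_form_def)
next
  case False
  then have pos: "nrm E x > 0" "nrm F y > 0"
    using E.nrm_nonneg[OF assms(1)] F.nrm_nonneg[OF assms(2)] by auto
  have "norm (diag_form x y / of_real (nrm E x * nrm F y)) \<le> 1"
    using diag_form_le_1[OF E.normalize[OF assms(1) pos(1)] F.normalize[OF assms(2) pos(2)]]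
    unfolding diag_form_normalize[OF assms(1) pos(1) assms(2) pos(2)] .
  then show ?thesis using pos by (simp add: norm_divide norm_mult divide_le_eq)
qed

text \<open>Termwise, the real part of x_n y_n is at most |x_n| |y_n|, and after weighting this is
  at most the Young bound \<open>?r n\<close>. Both ends sum to 1, so the nonnegative slack
  \<open>?t\<close> vanishes in every term. Equality in Young's inequality gives the moduli, and
  equality in the first estimate makes each product positive.\<close>

lemma diag_form_eq_1D:
  assumes x: "x \<in> carr E" "nrm E x = 1" and y: "y \<in> carr F" "nrm F y = 1"
    and one: "inner 1 (diag_form x y) = 1"
  shows "norm (x n) = wtp n" "norm (y n) = wtq n" "x n * y n = of_real (wtp n * wtq n)"
proof -
  let ?r = "\<lambda>n. gap * wt n + norm (x n) powr p / p + norm (y n) powr q / q"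
  let ?t = "\<lambda>n. ?r n - wt n powr gap * inner 1 (x n * y n)"
  have inner_le: "inner 1 (x n * y n) \<le> norm (x n) * norm (y n)" for n
    using norm_cauchy_schwarz[of 1 "x n * y n"] by (simp add: norm_mult)
  have le: "wt n powr gap * inner 1 (x n * y n) \<le> wt n powr gap * (norm (x n) * norm (y n))" for n
    using inner_le by (intro mult_left_mono) auto
  have "(\<lambda>n. inner 1 (of_real (wt n powr gap) * (x n * y n))) sums inner 1 (diag_form x y)"
    unfolding diag_form_def
    by (intro bounded_linear.sums[OF bounded_linear_inner_right] summable_sums
        diag_form_summable(2)[OF x(1) y(1)])
  then have "(\<lambda>n. wt n powr gap * inner 1 (x n * y n)) sums 1"
    using one by (simp flip: scaleR_conv_of_real)
  then have "?t sums (gap + (nrm E x) powr p / p + (nrm F y) powr q / q - 1)"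
    by (intro sums_diff young_bound_sums x y)
  then have t: "?t sums 0" using x y gap_sum by simp
  have nonneg: "0 \<le> ?t n" for n using young_term(1)[of n "x n" "y n"] le[of n] by linarith
  have "?t n = 0"
    using t nonneg suminf_eq_zero_iff[of ?t] by (simp add: sums_iff)
  then have eq: "wt n powr gap * inner 1 (x n * y n) = wt n powr gap * (norm (x n) * norm (y n))"
    "wt n powr gap * (norm (x n) * norm (y n)) = ?r n"
    using young_term(1)[of n "x n" "y n"] le[of n] by linarith+
  have "norm (x n) powr p = wt n" "norm (y n) powr q = wt n"
    using young_term(2)[OF eq(2)] by auto
  then have "(norm (x n) powr p) powr (1 / p) = wtp n" "(norm (y n) powr q) powr (1 / q) = wtq n"
    by (simp_all add: wtp_def wtq_def)
  then show xy: "norm (x n) = wtp n" "norm (y n) = wtq n"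
    using p1 q1 by (simp_all add: powr_powr)
  have "inner 1 (x n * y n) = norm (x n * y n)"
    using eq(1) wt_pos[of n] by (simp add: norm_mult)
  from eq_of_real_norm_if_inner_1_eq_norm[OF this]
  show "x n * y n = of_real (wtp n * wtq n)" using xy by (simp add: norm_mult)
qed

text \<open>The values of the form sum to 1 and are dominated by the \<open>l i\<close>, whose sum
  is at most 1, so there is no slack and each value equals \<open>l i\<close>. Each x_n y_n is then
  positive, so y has the inverse phases of x and one family \<open>\<epsilon>\<close> describes
  both. The entry x_n y_m becomes a positive constant depending on n and m times l (\<epsilon>_n /
  \<epsilon>_m), which turns \<open>off\<close> into the orthogonality of the phases.\<close>

lemma no_norm_attaining_diag_representation:
  assumes xy: "\<And>i. x i \<in> carr E" "\<And>i. y i \<in> carr F"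
    and L: "(\<lambda>i. nrm E (x i) * nrm F (y i)) sums L" "L \<le> 1"
    and diag: "(\<lambda>i. diag_form (x i) (y i)) sums 1"
    and off: "\<And>n m. n \<noteq> m \<Longrightarrow> (\<lambda>i. x i n * y i m) sums 0"
  shows False
proof -
  define l where "l i = nrm E (x i) * nrm F (y i)" for i
  have l: "0 \<le> l i" "l sums L" for i
    using L xy by (auto simp: l_def[abs_def] E.nrm_nonneg F.nrm_nonneg)
  have le: "inner 1 (diag_form (x i) (y i)) \<le> l i" for i
    using norm_cauchy_schwarz[of 1 "diag_form (x i) (y i)"] diag_form_bound[OF xy, of i i] by (simp add: l_def)
  have "(\<lambda>i. inner 1 (diag_form (x i) (y i))) sums inner 1 (1 :: 'k)"
    by (rule bounded_linear.sums[OF bounded_linear_inner_right diag])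
  then have in1: "(\<lambda>i. inner 1 (diag_form (x i) (y i))) sums 1" by (simp add: dot_square_norm)
  have diff: "(\<lambda>i. l i - inner 1 (diag_form (x i) (y i))) sums (L - 1)"
    by (rule sums_diff[OF l(2) in1])
  have "0 \<le> L - 1" using le by (intro sums_le[OF _ sums_zero diff]) simp
  then have "L = 1" using L by simp
  then have eq: "inner 1 (diag_form (x i) (y i)) = l i" for i
    using diff le suminf_eq_zero_iff[of "\<lambda>i. l i - inner 1 (diag_form (x i) (y i))"] by (simp add: sums_iff)
  \<comment> \<open>The value 1 for vanishing summands keeps \<open>\<epsilon>\<close> unimodular
    everywhere; the weight \<open>l i\<close> is 0 there.\<close>
  define \<epsilon> where "\<epsilon> i n = (if l i = 0 then 1 else x i n / of_real (nrm E (x i) * wtp n))" for i n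
  have key: "norm (x i n) = nrm E (x i) * wtp n \<and> x i n * y i n = of_real (l i * (wtp n * wtq n))"
    if "l i \<noteq> 0" for i n
  proof -
    have pos: "nrm E (x i) > 0" "nrm F (y i) > 0"
      using that E.nrm_nonneg[OF xy(1), of i] F.nrm_nonneg[OF xy(2), of i] by (auto simp: l_def)
    have "diag_form (x i) (y i) / of_real (nrm E (x i) * nrm F (y i)) = inverse (l i) *\<^sub>R diag_form (x i) (y i)"
      by (simp add: l_def scaleR_conv_of_real field_simps)
    then have one: "inner 1 (diag_form (\<lambda>n. x i n / of_real (nrm E (x i))) (\<lambda>n. y i n / of_real (nrm F (y i)))) = 1"
      unfolding diag_form_normalize[OF xy(1) pos(1) xy(2) pos(2)] using eq[of i] that by simp
    note D = diag_form_eq_1D[OF E.normalize[OF xy(1) pos(1)] F.normalize[OF xy(2) pos(2)] one, of n]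
    have "norm (x i n) = nrm E (x i) * wtp n" using D(1) pos by (simp add: norm_divide field_simps)
    moreover have "x i n * y i n = of_real (l i * (wtp n * wtq n))"
      using D(3) pos by (simp add: l_def field_simps)
    ultimately show ?thesis ..
  qed
  have unit: "norm (\<epsilon> i n) = 1" for i n
    using key[of i n] wtp_pos[of n] E.nrm_nonneg[OF xy(1), of i]
    by (auto simp: \<epsilon>_def norm_divide norm_mult l_def)
  have ratio: "l i *\<^sub>R (\<epsilon> i n / \<epsilon> i m) = x i n * y i m * of_real (1 / (wtp n * wtq m))" for i n m
  proof (cases "l i = 0")
    case True
    then have "x i = (\<lambda>n. 0) \<or> y i = (\<lambda>n. 0)"
      using xy ell_nrm_eq_0D[OF p, of "x i"] ell_nrm_eq_0D[OF q, of "y i"]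
      unfolding E_eq F_eq l_def by auto
    with True show ?thesis by auto
  next
    case False
    have pos: "nrm E (x i) > 0"
      using False E.nrm_nonneg[OF xy(1), of i] by (auto simp: l_def)
    have nz: "x i m \<noteq> 0" using key[OF False, of m] pos wtp_pos[of m] by auto
    have ym: "y i m = of_real (l i * (wtp m * wtq m)) / x i m"
      using key[OF False, of m] nz by (simp add: field_simps)
    show ?thesis
      using False nz pos wtp_pos[of n] wtp_pos[of m] wtq_pos[of m]
      by (simp add: \<epsilon>_def ym scaleR_conv_of_real field_simps)
  qed
  have orth: "(\<lambda>i. l i *\<^sub>R (\<epsilon> i n / \<epsilon> i m)) sums 0" if "n \<noteq> m" for n m
    unfolding ratio using sums_mult2[OF off[OF that], of "of_real (1 / (wtp n * wtq m))"] by simp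
  have "l i = 0" for i
    by (rule weighted_orthonormal_sequence_False[OF l unit orth])
  then have "l = (\<lambda>_. 0)" by auto
  then have "L = 0" using l(2) by (simp add: sums_iff)
  then show False using \<open>L = 1\<close> by simp
qed

lemma diag_tensor_diag_form:
  "diag_tensor (\<lambda>n. of_real (wtp n)) (\<lambda>n. of_real (wtq n)) N diag_form = of_real (\<Sum>n<N. wt n)"
proof -
  have "diag_form (\<lambda>k. if k = n then of_real (wtp n) else 0) (\<lambda>k. if k = n then of_real (wtq n) else 0)
      = of_real (wt n)" for n
  proof -
    have "(\<lambda>k. of_real (wt k powr gap) * ((if k = n then of_real (wtp n) else 0) * (if k = n then of_real (wtq n) else 0)))
        = (\<lambda>k. if k = n then of_real (wt n) else (0 :: 'k))"
      by (rule ext) (simp add: wt_prod flip: of_real_mult)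
    then show ?thesis
      using sums_single[of n "\<lambda>_. of_real (wt n) :: 'k"] by (simp add: diag_form_def sums_iff eq_commute)
  qed
  then show ?thesis by (simp add: diag_tensor_def elem_tensor_def diag_form_bilinear)
qed

lemma diag_tensor_coord_form:
  "n \<noteq> m \<Longrightarrow> diag_tensor a b N (\<lambda>x y. x n * y m) = 0"
  by (auto simp: diag_tensor_def elem_tensor_coord intro!: sum.neutral)

theorem NA_neq_carr: "NA E F \<noteq> carr (proj_tensor E F)"
proof
  assume NA: "NA E F = carr (proj_tensor E F)"
  define u where "u = diag_tensor (\<lambda>n. of_real (wtp n)) (\<lambda>n. of_real (wtq n))"
  have u: "u \<in> cauchy_seqs (alg_tensor E F)"
    unfolding u_def by (rule diag_tensor_cauchy[OF wtp_carr wtq_carr])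
  then have "T.cls u \<in> carr (proj_tensor E F)" by (simp add: proj_tensor_def T.carr_completion)
  then have "T.cls u \<in> NA E F" using NA by simp
  then obtain x y where xy: "\<And>i. x i \<in> carr E" "\<And>i. y i \<in> carr F"
    and lim: "nlimit (proj_tensor E F) (partial_sum (proj_tensor E F) (\<lambda>i. tensor E F (x i) (y i))) (T.cls u)"
    and nrm: "(\<lambda>i. nrm E (x i) * nrm F (y i)) sums nrm (proj_tensor E F) (T.cls u)"
    unfolding NA_def by blast
  let ?v = "\<lambda>n B. \<Sum>i<n. elem_tensor E F (x i) (y i) B"
  have v: "?v n \<in> carr (alg_tensor E F)" for n
    using xy by (intro T.sum_carr elem_tensor_carr)
  have "partial_sum (proj_tensor E F) (\<lambda>i. tensor E F (x i) (y i)) = (\<lambda>n. into_completion (alg_tensor E F) (?v n))"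
    unfolding tensor_eq proj_tensor_def
    using xy by (intro ext T.partial_sum_into_completion elem_tensor_carr)
  then have lim': "nlimit (completion (alg_tensor E F)) (\<lambda>n. into_completion (alg_tensor E F) (?v n)) (T.cls u)"
    using lim by (simp add: proj_tensor_def)
  \<comment> \<open>A bounded form turns the norm limit in the completion into a scalar series.
    Applied to \<open>diag_form\<close> it yields the value 1, applied to coordinate forms with n
    \<noteq> m the vanishing off-diagonal entries.\<close>
  have form: "(\<lambda>i. B (x i) (y i)) sums b"
    if B: "B \<in> bilinear_forms E F"
      and le: "\<And>x y. x \<in> carr E \<Longrightarrow> y \<in> carr F \<Longrightarrow> norm (B x y) \<le> 1 * (nrm E x * nrm F y)"
      and b: "(\<lambda>k. u k B) \<longlonglongrightarrow> b" for B b
  proof -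
    have "(\<lambda>n. ?v n B) \<longlonglongrightarrow> b"
    proof (rule T.tendsto_functional_completion[where \<phi> = "\<lambda>z. z B" and s = u and C = 1, OF u _ lim'])
      show "norm (z B - z' B) \<le> 1 * ndist (alg_tensor E F) z z'"
        if "z \<in> carr (alg_tensor E F)" "z' \<in> carr (alg_tensor E F)" for z z'
        using bilinear_form_lipschitz[OF B _ le that] by simp
    qed (rule v, rule b)
    then show ?thesis using B by (simp add: sums_def elem_tensor_def)
  qed
  show False
  proof (rule no_norm_attaining_diag_representation[OF xy nrm])
    show "nrm (proj_tensor E F) (T.cls u) \<le> 1"
      using nrm_diag_tensor_le[OF wtp_carr wtq_carr] wtp_nrm wtq_nrm by (simp add: u_def proj_tensor_def)
    show "(\<lambda>i. diag_form (x i) (y i)) sums 1"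
    proof (rule form[OF diag_form_bilinear diag_form_bound])
      have "(\<lambda>k. of_real (\<Sum>n<k. wt n) :: 'k) \<longlonglongrightarrow> of_real 1"
        using wt_sums unfolding sums_def by (rule tendsto_of_real)
      then show "(\<lambda>k. u k diag_form) \<longlonglongrightarrow> 1" by (simp add: u_def diag_tensor_diag_form)
    qed
    show "(\<lambda>i. x i n * y i m) sums 0" if "n \<noteq> m" for n m
      by (rule form[OF coord_form_bilinear coord_form_bound])
        (simp_all add: u_def diag_tensor_coord_form[OF that])
  qed
qed

end

section \<open>Weak limits of discrete measures on the balls\<close>

text \<open>Schoenberg's function: 2-periodic, \<open>0\<close> on \<open>[0, 1/3]\<close> and \<open>1\<close> on \<open>[2/3, 1]\<close>, so that it reads
  off the ternary digits of a point of the Cantor set from its multiples by powers of \<open>3\<close>.\<close>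

definition schoenberg :: "real \<Rightarrow> real" where
  "schoenberg t = max 0 (min 1 (1 / 2 - cos (pi * t)))"

lemma schoenberg_bounds: "0 \<le> schoenberg t" "schoenberg t \<le> 1"
  by (auto simp: schoenberg_def)

lemma continuous_on_schoenberg: "continuous_on UNIV schoenberg"
  unfolding schoenberg_def by (intro continuous_intros)

lemma schoenberg_add_even: "schoenberg (2 * real m + r) = schoenberg r"
proof -
  have "cos (pi * (2 * real m + r)) = cos (pi * r)"
    using cos.plus_of_nat[of "pi * r" m] by (simp add: algebra_simps)
  then show ?thesis by (simp add: schoenberg_def)
qed

lemma schoenberg_eq_0: "0 \<le> r \<Longrightarrow> r \<le> 1 / 3 \<Longrightarrow> schoenberg r = 0"
  using cos_monotone_0_pi_le[of "pi * r" "pi / 3"] by (simp add: schoenberg_def cos_60)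

lemma schoenberg_eq_1: "2 / 3 \<le> r \<Longrightarrow> r \<le> 1 \<Longrightarrow> schoenberg r = 1"
  using cos_monotone_0_pi_le[of "2 * pi / 3" "pi * r"] by (simp add: schoenberg_def cos_120)

definition ternary :: "(nat \<Rightarrow> bool) \<Rightarrow> real" where
  "ternary a = (\<Sum>k. 2 * of_bool (a k) / 3 ^ Suc k)"

lemma summable_ternary: "summable (\<lambda>k. 2 * of_bool (a k) / 3 ^ Suc k :: real)"
proof (rule summable_comparison_test'[of "\<lambda>k. 2 / 3 * (1 / 3) ^ k" 0])
  show "summable (\<lambda>k. 2 / 3 * (1 / 3) ^ k :: real)" by (intro summable_mult summable_geometric) simp
qed (auto simp: power_one_over field_simps)

lemma ternary_bounds: "0 \<le> ternary a" "ternary a \<le> 1"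
proof -
  show "0 \<le> ternary a" unfolding ternary_def by (intro suminf_nonneg summable_ternary) auto
  have "(\<lambda>k. 2 / 3 * (1 / 3) ^ k :: real) sums (2 / 3 * (1 / (1 - 1 / 3)))"
    by (intro sums_mult geometric_sums) simp
  then have g: "(\<lambda>k. 2 / 3 * (1 / 3) ^ k :: real) sums 1" by simp
  have "ternary a \<le> (\<Sum>k. 2 / 3 * (1 / 3) ^ k)"
    unfolding ternary_def using g
    by (intro suminf_le summable_ternary) (auto simp: power_one_over field_simps sums_iff)
  then show "ternary a \<le> 1" using g by (simp add: sums_iff)
qed

lemma ternary_unfold: "3 * ternary a = 2 * of_bool (a 0) + ternary (\<lambda>k. a (Suc k))"
proof -
  have "ternary a = 2 * of_bool (a 0) / 3 + (\<Sum>k. (2 * of_bool (a (Suc k)) / 3 ^ Suc k) / 3)"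
    unfolding ternary_def using suminf_split_head[OF summable_ternary[of a]]
    by (simp add: mult.commute)
  also have "(\<Sum>k. (2 * of_bool (a (Suc k)) / 3 ^ Suc k) / 3) = ternary (\<lambda>k. a (Suc k)) / 3"
    unfolding ternary_def by (rule suminf_divide[OF summable_ternary])
  finally show ?thesis by simp
qed

text \<open>Multiplication by 3^k shifts the digits. As all digits are 0 or 2, the part moved in
  front of the point is an even integer, which the period removes, and the remainder lies in
  [0, 1/3] or [2/3, 1] according to the next digit.\<close>

lemma schoenberg_digit: "schoenberg (3 ^ k * ternary a) = of_bool (a k)"
proof -
  have "\<exists>m. 3 ^ k * ternary a = 2 * real m + ternary (\<lambda>j. a (k + j))"
  proof (induction k)
    case (Suc k)
    then obtain m where "3 ^ k * ternary a = 2 * real m + ternary (\<lambda>j. a (k + j))" by blast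
    then have "3 ^ Suc k * ternary a = 2 * real (3 * m + of_bool (a k)) + ternary (\<lambda>j. a (Suc k + j))"
      using ternary_unfold[of "\<lambda>j. a (k + j)"] by simp
    then show ?case by blast
  qed (auto intro: exI[of _ 0])
  then obtain m where m: "3 ^ k * ternary a = 2 * real m + ternary (\<lambda>j. a (k + j))" by blast
  have "schoenberg (3 ^ k * ternary a) = schoenberg (ternary (\<lambda>j. a (k + j)))"
    unfolding m by (rule schoenberg_add_even)
  also have "\<dots> = of_bool (a k)"
    using ternary_unfold[of "\<lambda>j. a (k + j)"] ternary_bounds[of "\<lambda>j. a (k + Suc j)"]
    by (cases "a k") (auto intro!: schoenberg_eq_0 schoenberg_eq_1)
  finally show ?thesis .
qed

text \<open>The digits are the increments between successive floors of 2^j c, so the N-th partial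
  sum is the floor of 2^N c divided by 2^N. The bound c < 1 makes the initial floor 0.\<close>

lemma binary_expansion:
  fixes c :: real
  assumes "0 \<le> c" "c < 1"
  obtains a :: "nat \<Rightarrow> bool" where "(\<lambda>j. of_bool (a j) * (1 / 2) ^ Suc j) sums c"
proof -
  define a where "a j \<longleftrightarrow> \<lfloor>2 ^ Suc j * c\<rfloor> = 2 * \<lfloor>2 ^ j * c\<rfloor> + 1" for j
  have digit: "\<lfloor>2 ^ Suc j * c\<rfloor> = 2 * \<lfloor>2 ^ j * c\<rfloor> + of_bool (a j)" for j
  proof -
    have "\<lfloor>2 * (2 ^ j * c)\<rfloor> = 2 * \<lfloor>2 ^ j * c\<rfloor> \<or> \<lfloor>2 * (2 ^ j * c)\<rfloor> = 2 * \<lfloor>2 ^ j * c\<rfloor> + 1" by linarith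
    then show ?thesis by (auto simp: a_def mult.assoc)
  qed
  have partial: "(\<Sum>j<N. of_bool (a j) * (1 / 2) ^ Suc j) = (of_int \<lfloor>2 ^ N * c\<rfloor> / 2 ^ N :: real)" for N
  proof (induction N)
    case 0
    have "\<lfloor>c\<rfloor> = 0" using assms by linarith
    then show ?case by simp
  next
    case (Suc N)
    have "of_int \<lfloor>2 ^ Suc N * c\<rfloor> / 2 ^ Suc N
        = of_int \<lfloor>2 ^ N * c\<rfloor> / 2 ^ N + of_bool (a N) * (1 / 2 :: real) ^ Suc N"
      unfolding digit by (simp add: field_simps)
    with Suc show ?case by simp
  qed
  have "(\<lambda>N. of_int \<lfloor>2 ^ N * c\<rfloor> / 2 ^ N - c) \<longlonglongrightarrow> 0"
  proof (rule Lim_null_comparison)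
    show "\<forall>\<^sub>F N in sequentially. norm (of_int \<lfloor>2 ^ N * c\<rfloor> / 2 ^ N - c) \<le> (1 / 2) ^ N"
    proof (intro always_eventually allI)
      fix N :: nat
      have "of_int \<lfloor>2 ^ N * c\<rfloor> / 2 ^ N - c = (of_int \<lfloor>2 ^ N * c\<rfloor> - 2 ^ N * c) / 2 ^ N"
        by (simp add: field_simps)
      moreover have "\<bar>of_int \<lfloor>2 ^ N * c\<rfloor> - 2 ^ N * c\<bar> \<le> 1" by linarith
      ultimately show "norm (of_int \<lfloor>2 ^ N * c\<rfloor> / 2 ^ N - c) \<le> (1 / 2) ^ N"
        by (simp add: power_one_over abs_divide divide_right_mono)
    qed
    show "(\<lambda>N. (1 / 2 :: real) ^ N) \<longlonglongrightarrow> 0" by (rule LIMSEQ_realpow_zero) auto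
  qed
  then have "(\<lambda>j. of_bool (a j) * (1 / 2) ^ Suc j) sums c"
    unfolding sums_def partial by (simp add: LIM_zero_iff)
  then show thesis by (rule that)
qed

text \<open>Coordinate \<open>n\<close> of Schoenberg's curve into the Hilbert cube.
  \<open>prod_encode\<close> distributes the ternary digits of \<open>t\<close> over the binary
  digits of all coordinates, so they can be prescribed simultaneously.\<close>

definition curve :: "nat \<Rightarrow> real \<Rightarrow> real" where
  "curve n t = (\<Sum>j. schoenberg (3 ^ prod_encode (n, j) * t) * (1 / 2) ^ Suc j)"

lemma curve_term_bound: "norm (schoenberg s * (1 / 2) ^ Suc j) \<le> (1 / 2) ^ Suc j"
  using schoenberg_bounds[of s] by (simp add: abs_mult mult_left_le_one_le)

lemma continuous_on_curve: "continuous_on UNIV (curve n)"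
proof -
  have "uniform_limit UNIV (\<lambda>N t. \<Sum>j<N. schoenberg (3 ^ prod_encode (n, j) * t) * (1 / 2) ^ Suc j)
      (\<lambda>t. \<Sum>j. schoenberg (3 ^ prod_encode (n, j) * t) * (1 / 2) ^ Suc j) sequentially"
    by (rule Weierstrass_m_test[OF curve_term_bound sums_summable[OF power_half_series]])
  then show ?thesis
    unfolding curve_def[abs_def]
    by (rule uniform_limit_theorem[rotated])
      (auto intro!: always_eventually continuous_intros continuous_on_compose2[OF continuous_on_schoenberg])
qed

lemma curve_bounds: "0 \<le> curve n t" "curve n t \<le> 1"
proof -
  have s: "summable (\<lambda>j. schoenberg (3 ^ prod_encode (n, j) * t) * (1 / 2) ^ Suc j)"
    by (rule summable_comparison_test'[OF sums_summable[OF power_half_series] curve_term_bound])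
  show "0 \<le> curve n t" unfolding curve_def by (intro suminf_nonneg s) (simp add: schoenberg_bounds)
  have "curve n t \<le> (\<Sum>j. (1 / 2) ^ Suc j)"
    unfolding curve_def using power_half_series
    by (intro suminf_le s) (auto simp: sums_iff schoenberg_bounds mult_left_le_one_le)
  then show "curve n t \<le> 1" using power_half_series by (simp add: sums_iff)
qed

lemma curve_surj:
  assumes "\<And>n. 0 \<le> c n \<and> c n < 1"
  obtains t where "0 \<le> t" "t \<le> 1" "\<And>n. curve n t = c n"
proof -
  have "\<exists>a :: nat \<Rightarrow> bool. (\<lambda>j. of_bool (a j) * (1 / 2) ^ Suc j) sums c n" for n
    using binary_expansion[of "c n"] assms[of n] by blast
  then obtain a :: "nat \<Rightarrow> nat \<Rightarrow> bool" where a: "\<And>n. (\<lambda>j. of_bool (a n j) * (1 / 2) ^ Suc j) sums c n"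
    by metis
  define t where "t = ternary (\<lambda>k. a (fst (prod_decode k)) (snd (prod_decode k)))"
  have "curve n t = c n" for n
    unfolding curve_def t_def schoenberg_digit using a[of n] by (simp add: sums_iff)
  then show thesis using that ternary_bounds by (auto simp: t_def)
qed

lemma space_filling_curve:
  obtains h :: "nat \<Rightarrow> real \<Rightarrow> 'a::euclidean_space" and C :: real
  where "\<And>n. continuous_on UNIV (h n)" "\<And>n t. norm (h n t) \<le> C"
    "\<And>x. (\<And>n. norm (x n) \<le> 1) \<Longrightarrow> \<exists>t\<in>{0..1}. \<forall>n. h n t = x n"
proof -
  obtain idx :: "'a \<Rightarrow> nat" where idx: "inj_on idx Basis"
    using finite_imp_inj_to_nat_seg[OF finite_Basis] by blast
  \<comment> \<open>The interval [0, 1] is stretched onto [-2, 2]: the required coordinates in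
    [-1, 1] then come from [1/4, 3/4], safely below the value 1 that \<open>curve_surj\<close>
    excludes.\<close>
  define h :: "nat \<Rightarrow> real \<Rightarrow> 'a" where
    "h n t = (\<Sum>b\<in>Basis. (4 * curve (prod_encode (n, idx b)) t - 2) *\<^sub>R b)" for n t
  have "continuous_on UNIV (h n)" for n
    unfolding h_def by (intro continuous_intros continuous_on_curve)
  moreover have "norm (h n t) \<le> 2 * DIM('a)" for n t
  proof -
    have "norm (h n t) \<le> (\<Sum>b\<in>(Basis :: 'a set). 2)"
      unfolding h_def
    proof (rule sum_norm_le)
      fix b :: 'a assume "b \<in> Basis"
      then show "norm ((4 * curve (prod_encode (n, idx b)) t - 2) *\<^sub>R b) \<le> 2"
        using curve_bounds[of "prod_encode (n, idx b)" t] by (auto simp: abs_le_iff)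
    qed
    then show ?thesis by simp
  qed
  moreover have "\<exists>t\<in>{0..1}. \<forall>n. h n t = x n" if x: "\<And>n. norm (x n) \<le> 1" for x
  proof -
    \<comment> \<open>Codes that belong to no basis vector receive the harmless value 0.\<close>
    define c where "c k = (if snd (prod_decode k) \<in> idx ` Basis
        then (inner (x (fst (prod_decode k))) (inv_into Basis idx (snd (prod_decode k))) + 2) / 4 else 0)" for k
    have in_le: "\<bar>inner (x n) b\<bar> \<le> 1" if "b \<in> Basis" for n b
      using Basis_le_norm[OF that, of "x n"] x[of n] by linarith
    have "0 \<le> c k \<and> c k < 1" for k
      using in_le[OF inv_into_into, of "snd (prod_decode k)" idx "fst (prod_decode k)"]
      by (auto simp: c_def abs_le_iff)
    then obtain t where t: "0 \<le> t" "t \<le> 1" "\<And>n. curve n t = c n" using curve_surj by blast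
    have "h n t = x n" for n
    proof -
      have "h n t = (\<Sum>b\<in>Basis. inner (x n) b *\<^sub>R b)"
        unfolding h_def t(3) using idx by (intro sum.cong) (auto simp: c_def add_divide_distrib)
      then show ?thesis by (simp add: euclidean_representation)
    qed
    with t(1,2) show ?thesis by (intro bexI[of _ t]) auto
  qed
  ultimately show thesis by (rule that)
qed

text \<open>The atoms are numbered 0 to \<open>N\<close> inclusive: for a representation with
  \<open>N\<close> terms, the last atom is reserved for the mass missing to 1.\<close>

definition atomic_distribution :: "nat \<Rightarrow> (nat \<Rightarrow> real) \<Rightarrow> (nat \<Rightarrow> real) \<Rightarrow> real measure" where
  "atomic_distribution N l t = distr (point_measure {..N} l) borel t"

lemma real_distribution_atomic:
  assumes "\<And>i. i \<le> N \<Longrightarrow> 0 \<le> l i" "(\<Sum>i\<le>N. l i) = 1"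
  shows "real_distribution (atomic_distribution N l t)"
proof -
  interpret prob_space "point_measure {..N} l"
    using assms sum_ennreal[of "{..N}" l] by (intro prob_space_point_measure) auto
  have "prob_space (atomic_distribution N l t)"
    unfolding atomic_distribution_def by (intro prob_space_distr) auto
  then show ?thesis
    by (simp add: real_distribution_def real_distribution_axioms_def atomic_distribution_def)
qed

lemma integral_atomic_distribution:
  fixes g :: "real \<Rightarrow> 'b::{banach, second_countable_topology}"
  assumes "\<And>i. i \<le> N \<Longrightarrow> 0 \<le> l i" "g \<in> borel_measurable borel"
  shows "integral\<^sup>L (atomic_distribution N l t) g = (\<Sum>i\<le>N. l i *\<^sub>R g (t i))"
  unfolding atomic_distribution_def using assms lebesgue_integral_point_measure_finite[of "{..N}" l "\<lambda>i. g (t i)"]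
  by (simp add: integral_distr)

lemma tight_atomic_distribution:
  assumes "\<And>k i. i \<le> N k \<Longrightarrow> 0 \<le> l k i" "\<And>k. (\<Sum>i\<le>N k. l k i) = 1" "\<And>k i. t k i \<in> {0..1}"
  shows "tight (\<lambda>k. atomic_distribution (N k) (l k) (t k))"
  unfolding tight_def
proof (intro conjI allI impI)
  show rd: "real_distribution (atomic_distribution (N k) (l k) (t k))" for k
    using assms by (intro real_distribution_atomic) auto
  fix e :: real assume "e > 0"
  \<comment> \<open>All atoms lie in [0, 1]; the interval is open on the left and therefore has to
    begin below 0.\<close>
  have "measure (atomic_distribution (N k) (l k) (t k)) {-1<..2} = 1" for k
  proof -
    interpret real_distribution "atomic_distribution (N k) (l k) (t k)" by (rule rd)
    have "measure (atomic_distribution (N k) (l k) (t k)) {-1<..2}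
        = integral\<^sup>L (atomic_distribution (N k) (l k) (t k)) (indicator {-1<..2})"
      by simp
    also have "\<dots> = (\<Sum>i\<le>N k. l k i *\<^sub>R indicator {-1<..2} (t k i))"
      using assms by (intro integral_atomic_distribution) auto
    also have "\<dots> = (\<Sum>i\<le>N k. l k i)"
    proof (rule sum.cong[OF refl])
      fix i
      have "0 \<le> t k i" "t k i \<le> 1" using assms(3)[of k i] by auto
      then show "l k i *\<^sub>R indicator {-1<..2} (t k i) = l k i" by (simp add: indicator_def)
    qed
    finally show ?thesis using assms by simp
  qed
  then show "\<exists>a b. a < b \<and> (\<forall>n. 1 - e < measure (atomic_distribution (N n) (l n) (t n)) {a<..b})"
    using \<open>e > 0\<close> by (intro exI[of _ "-1"] exI[of _ 2]) auto
qed

text \<open>Weak compactness of the unit balls: discrete measures on the balls are transported to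
  \<open>[0, 1]\<close> along a space-filling curve, where Helly's theorem applies.\<close>

lemma limit_measure_on_balls:
  fixes x y :: "nat \<Rightarrow> nat \<Rightarrow> nat \<Rightarrow> 'k::{real_normed_field, euclidean_space}"
  assumes p: "1 \<le> p" and q: "1 \<le> q"
    and x: "\<And>k i. x k i \<in> unit_ball (ell p)" and y: "\<And>k i. y k i \<in> unit_ball (ell q)"
    and l: "\<And>k i. i < N k \<Longrightarrow> 0 \<le> l k i" "\<And>k. (\<Sum>i<N k. l k i) \<le> W k" "\<And>k. 0 < W k"
    and W: "W \<longlonglongrightarrow> W0"
    and u: "\<And>n m. (\<lambda>k. \<Sum>i<N k. l k i *\<^sub>R (x k i n * y k i m)) \<longlonglongrightarrow> u n m"
  obtains M :: "real measure" and X Y :: "real \<Rightarrow> nat \<Rightarrow> 'k"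
  where "real_distribution M"
    "\<And>n. (\<lambda>t. X t n) \<in> borel_measurable borel" "\<And>n. (\<lambda>t. Y t n) \<in> borel_measurable borel"
    "AE t in M. X t \<in> unit_ball (ell p) \<and> Y t \<in> unit_ball (ell q)"
    "\<And>n m. W0 *\<^sub>R (\<integral>t. X t n * Y t m \<partial>M) = u n m"
proof -
  obtain h :: "nat \<Rightarrow> real \<Rightarrow> 'k" and C where h: "\<And>n. continuous_on UNIV (h n)" "\<And>n t. norm (h n t) \<le> C"
    and surj: "\<And>z. (\<And>n. norm (z n) \<le> 1) \<Longrightarrow> \<exists>t\<in>{0..1}. \<forall>n. h n t = z n"
    using space_filling_curve by blast
  have C0: "0 \<le> C" using h(2)[of 0 0] norm_ge_zero order_trans by blast
  \<comment> \<open>Even coordinates of the curve encode the point of the first ball and odd ones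
    that of the second, so one real parameter covers the product.\<close>
  define X where "X t n = h (2 * n) t" for t n
  define Y where "Y t n = h (Suc (2 * n)) t" for t n
  have cont: "continuous_on UNIV (\<lambda>t. X t n)" "continuous_on UNIV (\<lambda>t. Y t n)" for n
    using h(1) by (simp_all add: X_def Y_def)
  have meas: "(\<lambda>t. X t n) \<in> borel_measurable borel" "(\<lambda>t. Y t n) \<in> borel_measurable borel" for n
    using cont by (auto intro: borel_measurable_continuous_onI)
  have code: "\<exists>t\<in>{0..1}. X t = a \<and> Y t = b" if a: "a \<in> unit_ball (ell p)" and b: "b \<in> unit_ball (ell q)" for a b
  proof -
    have "norm (a n) \<le> 1" "norm (b n) \<le> 1" for n
      using a b norm_le_ell_nrm[OF p, of a n] norm_le_ell_nrm[OF q, of b n] by (auto simp: unit_ball_def)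
    then have "\<exists>t\<in>{0..1}. \<forall>n. h n t = (if even n then a (n div 2) else b (n div 2))"
      by (intro surj) auto
    then obtain t where "t \<in> {0..1}" "\<And>n. h n t = (if even n then a (n div 2) else b (n div 2))" by blast
    then show ?thesis by (intro bexI[of _ t]) (auto simp: X_def Y_def)
  qed
  have zero: "(\<lambda>n. 0) \<in> unit_ball (ell p)" "(\<lambda>n. 0) \<in> unit_ball (ell q)"
    by (simp_all add: unit_ball_def ell_simps)
  \<comment> \<open>Index \<open>N k\<close> is the atom with the surplus mass; placed at the origin
    it contributes nothing to the moments.\<close>
  define x' where "x' k i = (if i < N k then x k i else (\<lambda>n. 0))" for k i
  define y' where "y' k i = (if i < N k then y k i else (\<lambda>n. 0))" for k i
  have ball': "x' k i \<in> unit_ball (ell p)" "y' k i \<in> unit_ball (ell q)" for k i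
    using x y zero by (auto simp: x'_def y'_def)
  have "\<exists>s\<in>{0..1}. X s = x' k i \<and> Y s = y' k i" for k i
    using code[OF ball'] .
  then obtain t where t: "\<And>k i. t k i \<in> {0..1}" "\<And>k i. X (t k i) = x' k i" "\<And>k i. Y (t k i) = y' k i"
    by metis
  have t_ball: "X (t k i) \<in> unit_ball (ell p)" "Y (t k i) \<in> unit_ball (ell q)" for k i
    using ball' by (simp_all add: t)
  \<comment> \<open>Dividing by the bound \<open>W k\<close>, rather than by the actual sum, gives a
    positive divisor and a known limit of the total mass; the deficit is assigned to the atom at the
    origin.\<close>
  define a where "a k i = (if i < N k then l k i / W k else 1 - (\<Sum>i<N k. l k i) / W k)" for k i
  have a_nonneg: "0 \<le> a k i" for k i
    using l(1)[of i k] l(2,3)[of k] by (auto simp: a_def)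
  have a_sum: "(\<Sum>i\<le>N k. a k i) = 1" for k
    by (simp add: a_def lessThan_Suc_atMost[symmetric] sum_divide_distrib)
  define \<nu> where "\<nu> k = atomic_distribution (N k) (a k) (t k)" for k
  have "tight \<nu>"
    unfolding \<nu>_def using a_nonneg a_sum t(1) by (intro tight_atomic_distribution) auto
  then obtain r M where r: "strict_mono r" and M: "real_distribution M" and conv: "weak_conv_m (\<nu> \<circ> id \<circ> r) M"
    using tight_imp_convergent_subsubsequence[of \<nu> id] by (auto simp: strict_mono_id)
  have rd: "real_distribution ((\<nu> \<circ> id \<circ> r) k)" for k
    using a_nonneg a_sum by (auto simp: \<nu>_def intro: real_distribution_atomic)
  have int_conv: "(\<lambda>k. integral\<^sup>L (\<nu> (r k)) f) \<longlonglongrightarrow> integral\<^sup>L M f"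
    if "continuous_on UNIV f" "\<And>s. norm (f s) \<le> D" for f :: "real \<Rightarrow> 'b::{banach, second_countable_topology}" and D
    using weak_conv_imp_integral_bdd_continuous_conv[OF rd M conv, of f D] that
    by (simp add: continuous_on_eq_continuous_at)
  have int_\<nu>: "integral\<^sup>L (\<nu> k) f = (\<Sum>i\<le>N k. a k i *\<^sub>R f (t k i))"
    if "continuous_on UNIV f" for f :: "real \<Rightarrow> 'b::{banach, second_countable_topology}" and k
    unfolding \<nu>_def using a_nonneg that
    by (intro integral_atomic_distribution) (auto intro: borel_measurable_continuous_onI)
  interpret real_distribution M by (rule M)
  \<comment> \<open>Off the coded points the curve may leave the ball. The continuous bounded
    function \<open>?g\<close> measures by how much \<open>K\<close> coordinates violate the ball
    condition; it is 0 at all atoms, so its integral against \<open>M\<close> is 0 and it vanishes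
    almost everywhere.\<close>
  have ball: "AE s in M. Z s \<in> unit_ball (ell e)"
    if e: "1 \<le> e" and Z: "\<And>n. continuous_on UNIV (\<lambda>s. Z s n)" "\<And>s n. norm (Z s n) \<le> C"
      "\<And>k i. Z (t k i) \<in> unit_ball (ell e)" for Z :: "real \<Rightarrow> nat \<Rightarrow> 'k" and e
  proof -
    have "AE s in M. (\<Sum>n<K. norm (Z s n) powr e) \<le> 1" for K
    proof -
      let ?g = "\<lambda>s. max 0 ((\<Sum>n<K. norm (Z s n) powr e) - 1)"
      have c: "continuous_on UNIV ?g"
        using Z(1) e by (intro continuous_intros continuous_on_powr') auto
      have b: "norm (?g s) \<le> real K * C powr e" for s
      proof -
        have "(\<Sum>n<K. norm (Z s n) powr e) \<le> (\<Sum>n<K. C powr e)"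
          using Z(2) e by (intro sum_mono powr_mono2) auto
        moreover have "0 \<le> real K * C powr e" by simp
        ultimately show ?thesis by (simp add: max_def)
      qed
      have "integral\<^sup>L (\<nu> k) ?g = 0" for k
        unfolding int_\<nu>[OF c] using Z(3) by (simp add: unit_ball_ell_iff[OF e])
      then have "integral\<^sup>L M ?g = 0"
        using int_conv[OF c b] by (simp add: LIMSEQ_const_iff)
      moreover have "integrable M ?g"
        using b borel_measurable_continuous_onI[OF c]
        by (intro integrable_const_bound[of _ "real K * C powr e"])
          (auto simp only: measurable_cong_sets[OF events_eq_borel refl] intro!: AE_I2)
      ultimately have "AE s in M. ?g s = 0"
        using integral_nonneg_eq_0_iff_AE[of M ?g] by simp
      then show ?thesis by eventually_elim (simp add: max_def split: if_splits)
    qed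
    then show ?thesis by (simp add: unit_ball_ell_iff[OF e] AE_all_countable)
  qed
  have "AE t in M. X t \<in> unit_ball (ell p) \<and> Y t \<in> unit_ball (ell q)"
  proof (rule AE_conjI)
    show "AE t in M. X t \<in> unit_ball (ell p)"
      by (rule ball[OF p cont(1) _ t_ball(1)]) (simp add: X_def h(2))
    show "AE t in M. Y t \<in> unit_ball (ell q)"
      by (rule ball[OF q cont(2) _ t_ball(2)]) (simp add: Y_def h(2))
  qed
  moreover have "W0 *\<^sub>R (\<integral>t. X t n * Y t m \<partial>M) = u n m" for n m
  proof -
    let ?f = "\<lambda>t. X t n * Y t m"
    have c: "continuous_on UNIV ?f" by (intro continuous_intros cont)
    have b: "norm (?f s) \<le> C * C" for s
      unfolding norm_mult X_def Y_def using h(2) C0 by (intro mult_mono) auto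
    have "W k *\<^sub>R integral\<^sup>L (\<nu> k) ?f = (\<Sum>i<N k. l k i *\<^sub>R (x k i n * y k i m))" for k
    proof -
      have "integral\<^sup>L (\<nu> k) ?f = (\<Sum>i<N k. (l k i / W k) *\<^sub>R (x k i n * y k i m))"
        unfolding int_\<nu>[OF c] by (simp add: lessThan_Suc_atMost[symmetric] t a_def x'_def y'_def)
      then show ?thesis using l(3)[of k] by (simp add: scaleR_sum_right)
    qed
    then have "(\<lambda>k. W k *\<^sub>R integral\<^sup>L (\<nu> k) ?f) \<longlonglongrightarrow> u n m" using u by simp
    then have "(\<lambda>k. W (r k) *\<^sub>R integral\<^sup>L (\<nu> (r k)) ?f) \<longlonglongrightarrow> u n m"
      using LIMSEQ_subseq_LIMSEQ[OF _ r] by (auto simp: o_def)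
    moreover have "(\<lambda>k. W (r k) *\<^sub>R integral\<^sup>L (\<nu> (r k)) ?f) \<longlonglongrightarrow> W0 *\<^sub>R integral\<^sup>L M ?f"
      using LIMSEQ_subseq_LIMSEQ[OF W r] int_conv[OF c b] by (intro tendsto_scaleR) (auto simp: o_def)
    ultimately show ?thesis using LIMSEQ_unique by blast
  qed
  ultimately show thesis by (intro that[of M X Y] M meas)
qed

section \<open>Matrices of tensors and measurability on the balls\<close>

context ell_pair
begin

definition unit_tensor :: "nat \<Rightarrow> nat \<Rightarrow> ((nat \<Rightarrow> 'k) \<Rightarrow> (nat \<Rightarrow> 'k) \<Rightarrow> 'k) \<Rightarrow> 'k" where
  "unit_tensor n m = elem_tensor E F (\<lambda>k. if k = n then 1 else 0) (\<lambda>k. if k = m then 1 else 0)"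

definition matrix_tensor :: "nat \<Rightarrow> (nat \<Rightarrow> nat \<Rightarrow> 'k) \<Rightarrow> ((nat \<Rightarrow> 'k) \<Rightarrow> (nat \<Rightarrow> 'k) \<Rightarrow> 'k) \<Rightarrow> 'k" where
  "matrix_tensor N a = (\<lambda>B. \<Sum>n<N. \<Sum>m<N. a n m * unit_tensor n m B)"

text \<open>Tensors are functionals on bilinear forms, so a matrix coefficient is the value at a
  coordinate form.\<close>

definition entry :: "(((nat \<Rightarrow> 'k) \<Rightarrow> (nat \<Rightarrow> 'k) \<Rightarrow> 'k) \<Rightarrow> 'k) \<Rightarrow> nat \<Rightarrow> nat \<Rightarrow> 'k" where
  "entry v n m = v (\<lambda>x y. x n * y m)"

lemma nrm_single:
  "nrm E (\<lambda>k. if k = n then a else 0) = norm a" "nrm F (\<lambda>k. if k = n then a else 0) = norm a"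
proof -
  have *: "nrm (ell e) (\<lambda>k. if k = n then a else 0) = norm a" if e: "1 \<le> e" for e
  proof -
    have "(\<Sum>k<Suc n. norm (if k = n then a else 0) powr e) = norm a powr e" by simp
    then show ?thesis
      using ell_finite_support_nrm[OF e, of "Suc n" "\<lambda>k. if k = n then a else 0"] e by (simp add: powr_powr)
  qed
  show "nrm E (\<lambda>k. if k = n then a else 0) = norm a" "nrm F (\<lambda>k. if k = n then a else 0) = norm a"
    unfolding E_eq F_eq using *[OF p] *[OF q] .
qed

lemma unit_tensor_carr: "unit_tensor n m \<in> carr (alg_tensor E F)"
  unfolding unit_tensor_def by (intro elem_tensor_carr single_carr)

lemma nrm_unit_tensor_le: "nrm (alg_tensor E F) (unit_tensor n m) \<le> 1"
  unfolding unit_tensor_def using nrm_elem_tensor_le[OF single_carr, of n 1 m 1] by (simp add: nrm_single)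

lemma matrix_tensor_carr: "matrix_tensor N a \<in> carr (alg_tensor E F)"
  unfolding matrix_tensor_def by (intro T.sum_carr T.scl_carr unit_tensor_carr)

lemma ndist_matrix_tensor_le:
  "ndist (alg_tensor E F) (matrix_tensor N a) (matrix_tensor N b) \<le> (\<Sum>n<N. \<Sum>m<N. norm (a n m - b n m))"
proof -
  have "ndist (alg_tensor E F) (matrix_tensor N a) (matrix_tensor N b)
      = nrm (alg_tensor E F) (\<lambda>B. \<Sum>n<N. \<Sum>m<N. (a n m - b n m) * unit_tensor n m B)"
    by (simp add: T.ndist_eq matrix_tensor_def left_diff_distrib sum_subtractf)
  also have "\<dots> \<le> (\<Sum>n<N. nrm (alg_tensor E F) (\<lambda>B. \<Sum>m<N. (a n m - b n m) * unit_tensor n m B))"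
    by (intro T.nrm_sum T.sum_carr T.scl_carr unit_tensor_carr)
  also have "\<dots> \<le> (\<Sum>n<N. \<Sum>m<N. nrm (alg_tensor E F) (\<lambda>B. (a n m - b n m) * unit_tensor n m B))"
    by (intro sum_mono T.nrm_sum T.scl_carr unit_tensor_carr)
  also have "\<dots> \<le> (\<Sum>n<N. \<Sum>m<N. norm (a n m - b n m))"
    using nrm_unit_tensor_le
    by (intro sum_mono) (simp add: T.nrm_scl unit_tensor_carr mult_left_le)
  finally show ?thesis .
qed

lemma truncate_eq_sum:
  fixes x :: "nat \<Rightarrow> 'k"
  shows "(\<lambda>k. if k < N then x k else 0) = (\<lambda>k. \<Sum>n<N. x n * (if k = n then 1 else 0))"
  by (rule ext) (simp add: if_distrib[of "(*) _"] cong: if_cong)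

lemma elem_tensor_truncate:
  "elem_tensor E F (\<lambda>k. if k < N then x k else 0) (\<lambda>k. if k < N then y k else 0)
    = matrix_tensor N (\<lambda>n m. x n * y m)"
proof
  fix B
  have sy: "(\<lambda>k. \<Sum>n<N. y n * (if k = n then 1 else 0)) \<in> carr F"
    by (intro F.sum_carr F.scl_carr single_carr)
  show "elem_tensor E F (\<lambda>k. if k < N then x k else 0) (\<lambda>k. if k < N then y k else 0) B
      = matrix_tensor N (\<lambda>n m. x n * y m) B"
    unfolding truncate_eq_sum
    by (simp add: elem_tensor_sum_left elem_tensor_sum_right E.scl_carr F.scl_carr single_carr sy
        elem_tensor_scl_left elem_tensor_scl_right matrix_tensor_def unit_tensor_def mult.assoc
        sum_distrib_left)
qed

lemma entry_sum_elem_tensor: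
  "entry (\<lambda>B. \<Sum>i<n. elem_tensor E F (x i) (y i) B) j l = (\<Sum>i<n. x i j * y i l)"
  by (simp add: entry_def elem_tensor_coord)

lemma norm_entry_diff_le:
  "v \<in> carr (alg_tensor E F) \<Longrightarrow> w \<in> carr (alg_tensor E F) \<Longrightarrow>
    norm (entry v n m - entry w n m) \<le> ndist (alg_tensor E F) v w"
  unfolding entry_def
  using bilinear_form_lipschitz[OF coord_form_bilinear zero_le_one coord_form_bound] by simp

text \<open>Cutting the matrix to its leading corner is the action of P_N \<otimes> P_N, with P_N
  the truncation to N coordinates; it can be carried out on the factors of any representation, which
  makes it contractive for the projective norm.\<close>

lemma matrix_tensor_entry_rep:
  assumes "is_tensor_rep E F v n x y"
  shows "is_tensor_rep E F (matrix_tensor N (entry v)) n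
    (\<lambda>i k. if k < N then x i k else 0) (\<lambda>i k. if k < N then y i k else 0)"
proof -
  have v: "v = (\<lambda>B. \<Sum>i<n. elem_tensor E F (x i) (y i) B)"
    using assms by (simp add: is_tensor_rep_def)
  have "matrix_tensor N (entry v) = (\<lambda>B. \<Sum>i<n. matrix_tensor N (\<lambda>j l. x i j * y i l) B)"
    unfolding v by (intro ext) (simp add: matrix_tensor_def entry_sum_elem_tensor sum_distrib_right sum.swap[of _ _ "{..<n}"])
  then show ?thesis
    by (simp add: is_tensor_rep_def elem_tensor_truncate truncate_carr)
qed

lemma truncate_nrm_le:
  "x \<in> carr E \<Longrightarrow> nrm E (\<lambda>k. if k < N then x k else 0) \<le> nrm E x"
  "y \<in> carr F \<Longrightarrow> nrm F (\<lambda>k. if k < N then y k else 0) \<le> nrm F y"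
  unfolding E_eq F_eq by (rule ell_nrm_mono[OF p]; simp) (rule ell_nrm_mono[OF q]; simp)

lemma nrm_matrix_tensor_entry_le:
  assumes v: "v \<in> carr (alg_tensor E F)"
  shows "nrm (alg_tensor E F) (matrix_tensor N (entry v)) \<le> nrm (alg_tensor E F) v"
proof (rule field_le_epsilon)
  fix e :: real assume "e > 0"
  then obtain n x y where r: "is_tensor_rep E F v n x y"
    "(\<Sum>i<n. nrm E (x i) * nrm F (y i)) < nrm (alg_tensor E F) v + e"
    using alg_rep_approx[OF v] by blast
  have c: "x i \<in> carr E" "y i \<in> carr F" if "i < n" for i using r(1) that by (auto simp: is_tensor_rep_def)
  have "nrm (alg_tensor E F) (matrix_tensor N (entry v))
      \<le> (\<Sum>i<n. nrm E (\<lambda>k. if k < N then x i k else 0) * nrm F (\<lambda>k. if k < N then y i k else 0))"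
    by (rule alg_nrm_le[OF matrix_tensor_entry_rep[OF r(1)]])
  also have "\<dots> \<le> (\<Sum>i<n. nrm E (x i) * nrm F (y i))"
    using c by (intro sum_mono mult_mono truncate_nrm_le E.nrm_nonneg F.nrm_nonneg truncate_carr) auto
  finally show "nrm (alg_tensor E F) (matrix_tensor N (entry v)) \<le> nrm (alg_tensor E F) v + e"
    using r(2) by simp
qed

definition tail_E :: "nat \<Rightarrow> (nat \<Rightarrow> 'k) \<Rightarrow> real" where
  "tail_E N x = nrm E (\<lambda>k. x k - (if k < N then x k else 0))"
definition tail_F :: "nat \<Rightarrow> (nat \<Rightarrow> 'k) \<Rightarrow> real" where
  "tail_F N y = nrm F (\<lambda>k. y k - (if k < N then y k else 0))"

lemma tails_tendsto_0:
  "x \<in> carr E \<Longrightarrow> (\<lambda>N. tail_E N x) \<longlonglongrightarrow> 0" "y \<in> carr F \<Longrightarrow> (\<lambda>N. tail_F N y) \<longlonglongrightarrow> 0"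
  unfolding tail_E_def tail_F_def unfolding E_eq F_eq using ell_tail_tendsto_0[OF p] ell_tail_tendsto_0[OF q] by auto

lemma ndist_elem_tensor_matrix_tensor_le:
  assumes x: "x \<in> carr E" and y: "y \<in> carr F"
  shows "ndist (alg_tensor E F) (elem_tensor E F x y) (matrix_tensor N (\<lambda>n m. x n * y m))
    \<le> tail_E N x * nrm F y + nrm E x * tail_F N y"
proof -
  have "ndist (alg_tensor E F) (elem_tensor E F x y) (matrix_tensor N (\<lambda>n m. x n * y m))
      \<le> tail_E N x * nrm F y + nrm E (\<lambda>k. if k < N then x k else 0) * tail_F N y"
    unfolding elem_tensor_truncate[symmetric] tail_E_def tail_F_def
    using ndist_elem_tensor_le[OF x truncate_carr(1) y truncate_carr(2), of N x N y]
    by (simp add: E.ndist_eq F.ndist_eq)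
  also have "nrm E (\<lambda>k. if k < N then x k else 0) * tail_F N y \<le> nrm E x * tail_F N y"
    unfolding tail_F_def using truncate_nrm_le(1)[OF x]
    by (intro mult_right_mono F.nrm_nonneg F.diff_carr y truncate_carr)
  finally show ?thesis by simp
qed

text \<open>Any single finite representation does: each of its summands converges because the tails
  of both factors tend to 0.\<close>

lemma matrix_tensor_entry_tendsto:
  assumes v: "v \<in> carr (alg_tensor E F)"
  shows "(\<lambda>N. ndist (alg_tensor E F) v (matrix_tensor N (entry v))) \<longlonglongrightarrow> 0"
proof -
  obtain n x y where r: "is_tensor_rep E F v n x y" using v by (auto simp: alg_simps)
  have c: "x i \<in> carr E" "y i \<in> carr F" if "i < n" for i using r that by (auto simp: is_tensor_rep_def)
  let ?t = "\<lambda>N. \<Sum>i<n. tail_E N (x i) * nrm F (y i) + nrm E (x i) * tail_F N (y i)"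
  have "ndist (alg_tensor E F) v (matrix_tensor N (entry v)) \<le> ?t N" for N
  proof -
    have v_eq: "v = (\<lambda>B. \<Sum>i<n. elem_tensor E F (x i) (y i) B)"
      using r by (simp add: is_tensor_rep_def)
    have "ndist (alg_tensor E F) v (matrix_tensor N (entry v))
        = nrm (alg_tensor E F) (\<lambda>B. \<Sum>i<n. elem_tensor E F (x i) (y i) B - matrix_tensor N (\<lambda>j l. x i j * y i l) B)"
      using matrix_tensor_entry_rep[OF r, of N]
      by (subst v_eq) (simp add: T.ndist_eq sum_subtractf is_tensor_rep_def elem_tensor_truncate)
    also have "\<dots> \<le> (\<Sum>i<n. ndist (alg_tensor E F) (elem_tensor E F (x i) (y i)) (matrix_tensor N (\<lambda>j l. x i j * y i l)))"
      unfolding T.ndist_eq using c by (intro T.nrm_sum T.diff_carr elem_tensor_carr matrix_tensor_carr) auto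
    also have "\<dots> \<le> ?t N"
      using c by (intro sum_mono ndist_elem_tensor_matrix_tensor_le) auto
    finally show ?thesis .
  qed
  moreover have "?t \<longlonglongrightarrow> (\<Sum>i<n. 0 * nrm F (y i) + nrm E (x i) * 0)"
    using c by (intro tendsto_sum tendsto_add tendsto_mult tendsto_const tails_tendsto_0) auto
  then have "?t \<longlonglongrightarrow> 0" by simp
  ultimately show ?thesis
    using T.ndist_nonneg[OF v matrix_tensor_carr]
    by (intro tendsto_sandwich[of "\<lambda>N. 0" "\<lambda>N. ndist (alg_tensor E F) v (matrix_tensor N (entry v))" _ ?t])
      (simp_all add: always_eventually)
qed

lemma entry_convergent:
  assumes s: "s \<in> cauchy_seqs (alg_tensor E F)"
  shows "convergent (\<lambda>k. entry (s k) n m)"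
proof -
  have "Cauchy (\<lambda>k. entry (s k) n m)"
  proof (rule metric_CauchyI)
    fix e :: real assume "e > 0"
    then obtain N where N: "\<forall>i\<ge>N. \<forall>j\<ge>N. ndist (alg_tensor E F) (s i) (s j) < e"
      using s unfolding cauchy_seqs_def by blast
    have "dist (entry (s i) n m) (entry (s j) n m) < e" if "i \<ge> N" "j \<ge> N" for i j
      using N that norm_entry_diff_le[OF T.cauchy_seqs_carr[OF s] T.cauchy_seqs_carr[OF s], of i n m j]
      unfolding dist_norm by (meson le_less_trans)
    then show "\<exists>M. \<forall>i\<ge>M. \<forall>j\<ge>M. dist (entry (s i) n m) (entry (s j) n m) < e" by blast
  qed
  then show ?thesis by (simp add: Cauchy_convergent)
qed

text \<open>The truncations are contractions converging strongly to the identity.\<close>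

lemma nlimit_matrix_tensor:
  assumes s: "s \<in> cauchy_seqs (alg_tensor E F)"
    and a: "\<And>n m. (\<lambda>k. entry (s k) n m) \<longlonglongrightarrow> a n m"
  shows "nlimit (completion (alg_tensor E F))
    (\<lambda>N. into_completion (alg_tensor E F) (matrix_tensor N a)) (T.cls s)"
  unfolding nlimit_def
proof (rule LIMSEQ_I)
  fix r :: real assume "r > 0"
  define e where "e = r / 4"
  have e: "e > 0" using \<open>r > 0\<close> by (simp add: e_def)
  let ?d = "ndist (alg_tensor E F)"
  note sc = T.cauchy_seqs_carr[OF s]
  obtain K where K: "\<And>i j. i \<ge> K \<Longrightarrow> j \<ge> K \<Longrightarrow> ?d (s i) (s j) < e"
    using s e unfolding cauchy_seqs_def by blast
  obtain N0 where N0: "\<And>N. N \<ge> N0 \<Longrightarrow> ?d (s K) (matrix_tensor N (entry (s K))) < e"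
    using order_tendstoD(2)[OF matrix_tensor_entry_tendsto[OF sc[of K]] e]
    unfolding eventually_sequentially by blast
  have "ndist (completion (alg_tensor E F)) (into_completion (alg_tensor E F) (matrix_tensor N a)) (T.cls s) \<le> 3 * e"
    if N: "N \<ge> N0" for N
  proof (rule LIMSEQ_le[OF T.ndist_into_completion_cls_tendsto[OF matrix_tensor_carr s]])
    \<comment> \<open>For fixed \<open>N\<close> only finitely many entries occur, so
      \<open>?r\<close> tends to 0 in \<open>k\<close>. The remaining 3e pass through the truncation
      of the fixed \<open>s K\<close>, once by contractivity, once by \<open>N0\<close> and once by
      the Cauchy property.\<close>
    let ?r = "\<lambda>k. \<Sum>n<N. \<Sum>m<N. norm (a n m - entry (s k) n m)"
    have "?r \<longlonglongrightarrow> (\<Sum>n<N. \<Sum>m<N. norm (a n m - a n m))"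
      by (intro tendsto_intros a)
    then have "(\<lambda>k. ?r k + 3 * e) \<longlonglongrightarrow> 0 + 3 * e" by (intro tendsto_add) auto
    then show "(\<lambda>k. ?r k + 3 * e) \<longlonglongrightarrow> 3 * e" by simp
    have "?d (matrix_tensor N a) (s k) \<le> ?r k + 3 * e" if k: "k \<ge> K" for k
    proof -
      let ?T = "\<lambda>k. matrix_tensor N (entry (s k))"
      have "?d (?T k) (?T K) = nrm (alg_tensor E F) (matrix_tensor N (entry (\<lambda>B. s k B - s K B)))"
        by (simp add: T.ndist_eq matrix_tensor_def entry_def left_diff_distrib sum_subtractf)
      also have "\<dots> \<le> ?d (s k) (s K)"
        unfolding T.ndist_eq by (intro nrm_matrix_tensor_entry_le T.diff_carr sc)
      finally have 1: "?d (?T k) (?T K) \<le> e" using K[OF k, of K] by simp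
      have "?d (matrix_tensor N a) (s k) \<le> ?d (matrix_tensor N a) (?T k) + ?d (?T k) (s k)"
        by (intro T.ndist_triangle matrix_tensor_carr sc)
      also have "?d (?T k) (s k) \<le> ?d (?T k) (?T K) + ?d (?T K) (s k)"
        by (intro T.ndist_triangle matrix_tensor_carr sc)
      also have "?d (?T K) (s k) \<le> ?d (?T K) (s K) + ?d (s K) (s k)"
        by (intro T.ndist_triangle matrix_tensor_carr sc)
      finally show ?thesis
        using 1 ndist_matrix_tensor_le[of N a "entry (s k)"] N0[OF N] K[of K k] k
          T.ndist_commute[OF matrix_tensor_carr sc, of N "entry (s K)" K] by linarith
    qed
    then show "\<exists>N'. \<forall>k\<ge>N'. ?d (matrix_tensor N a) (s k) \<le> ?r k + 3 * e" by blast
  qed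
  moreover have "3 * e < r" using \<open>r > 0\<close> by (simp add: e_def)
  ultimately show "\<exists>N0. \<forall>N\<ge>N0. norm (ndist (completion (alg_tensor E F))
      (into_completion (alg_tensor E F) (matrix_tensor N a)) (T.cls s) - 0) < r"
    using T.ndist_into_completion_cls_nonneg[OF matrix_tensor_carr s]
    by (intro exI[of _ N0]) (auto intro: le_less_trans)
qed

end

section \<open>Separability and the Borel sets of the product of balls\<close>

lemma Metric_space_ell:
  assumes e: "1 \<le> e"
  shows "Metric_space (carr (ell e)) (ndist (ell e :: ('k::real_normed_field, nat \<Rightarrow> 'k) nspace))"
proof -
  interpret fun_nspace "ell e :: ('k, nat \<Rightarrow> 'k) nspace" by (rule fun_nspace_ell[OF e])
  show ?thesis
  proof
    \<comment> \<open>\<open>Metric_space\<close> demands nonnegativity and symmetry on the whole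
      type; outside the carrier they come from the formula for the norm.\<close>
    show "0 \<le> ndist (ell e) x y" for x y :: "nat \<Rightarrow> 'k" by (simp add: ndist_eq ell_nrm_nonneg[OF e])
    show "ndist (ell e) x y = ndist (ell e) y x" for x y :: "nat \<Rightarrow> 'k"
      by (simp add: ndist_eq ell_simps norm_minus_commute)
    show "ndist (ell e) x y = 0 \<longleftrightarrow> x = y" if "x \<in> carr (ell e)" "y \<in> carr (ell e)" for x y :: "nat \<Rightarrow> 'k"
      using ell_nrm_eq_0D[OF e diff_carr[OF that]] by (auto simp: ndist_eq nrm_zero fun_eq_iff)
  qed (rule ndist_triangle)
qed

lemma ell_separable:
  fixes e :: real
  assumes e: "1 \<le> e"
  obtains D :: "(nat \<Rightarrow> 'k::{real_normed_field, euclidean_space}) set"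
  where "countable D" "D \<subseteq> carr (ell e)"
    "\<And>x r. x \<in> carr (ell e) \<Longrightarrow> 0 < r \<Longrightarrow> \<exists>a\<in>D. ndist (ell e) x a < r"
proof -
  interpret fun_nspace "ell e :: ('k, nat \<Rightarrow> 'k) nspace" by (rule fun_nspace_ell[OF e])
  obtain D0 :: "'k set" where D0: "countable D0" "\<And>X. open X \<Longrightarrow> X \<noteq> {} \<Longrightarrow> \<exists>d\<in>D0. d \<in> X"
    using countable_dense_setE by blast
  define D where "D = (\<lambda>xs k. if k < length xs then xs ! k else 0) ` lists D0"
  have fin: "(\<lambda>k. if k < N then x k else (0 :: 'k)) \<in> carr (ell e)" for N x
    by (rule ell_finite_support_carr[OF e, of N]) simp
  have "\<exists>a\<in>D. ndist (ell e) x a < r" if x: "x \<in> carr (ell e)" and r: "0 < r" for x r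
  proof -
    have "\<forall>\<^sub>F N in sequentially. nrm (ell e) (\<lambda>n. x n - (if n < N then x n else 0)) < r / 2"
      using r by (intro order_tendstoD(2)[OF ell_tail_tendsto_0[OF e x]]) simp
    then obtain N where N: "nrm (ell e) (\<lambda>n. x n - (if n < N then x n else 0)) < r / 2"
      by (auto simp: eventually_sequentially)
    \<comment> \<open>N coordinates with error below \<open>\<delta>\<close> must add up to less
      than r/2; the summand 1 also covers N = 0.\<close>
    define \<delta> where "\<delta> = r / (2 * (real N + 1))"
    have \<delta>: "\<delta> > 0" using r by (simp add: \<delta>_def)
    have "\<exists>d\<in>D0. d \<in> ball (x k) \<delta>" for k using \<delta> by (intro D0(2)) auto
    then obtain f where f: "\<And>k. f k \<in> D0" "\<And>k. dist (x k) (f k) < \<delta>" unfolding mem_ball by metis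
    let ?a = "\<lambda>k. if k < N then f k else 0" and ?x = "\<lambda>k. if k < N then x k else 0"
    have a: "?a \<in> D"
      unfolding D_def by (rule image_eqI[of _ _ "map f [0..<N]"]) (auto simp: f in_lists_conv_set fun_eq_iff)
    have "ndist (ell e) ?x ?a = nrm (ell e) (\<lambda>k. \<Sum>n<N. if k = n then x n - f n else 0)"
      unfolding ndist_eq by (rule arg_cong[of _ _ "nrm (ell e)"]) (auto simp: fun_eq_iff)
    also have "\<dots> \<le> (\<Sum>n<N. nrm (ell e) (\<lambda>k. if k = n then x n - f n else 0))"
    proof (rule nrm_sum)
      show "(\<lambda>k. if k = n then x n - f n else 0) \<in> carr (ell e)" for n
        by (rule ell_finite_support_carr[OF e, of "Suc n"]) simp
    qed
    also have "\<dots> \<le> (\<Sum>n<N. \<delta>)"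
    proof (rule sum_mono)
      fix n
      have "nrm (ell e) (\<lambda>k. if k = n then x n - f n else 0) = norm (x n - f n)"
      proof -
        have "(\<Sum>k<Suc n. norm (if k = n then x n - f n else 0) powr e) = norm (x n - f n) powr e" by simp
        then show ?thesis
          using ell_finite_support_nrm[OF e, of "Suc n" "\<lambda>k. if k = n then x n - f n else 0"] e
          by (simp add: powr_powr)
      qed
      then show "nrm (ell e) (\<lambda>k. if k = n then x n - f n else 0) \<le> \<delta>"
        using f(2)[of n] by (simp add: dist_norm)
    qed
    also have "\<dots> < r / 2" using r by (simp add: \<delta>_def field_simps)
    finally have "ndist (ell e) x ?a < r"
      using ndist_triangle[OF x fin[of N x] fin[of N f]] N by (simp add: ndist_eq)
    with a show ?thesis by blast
  qed
  moreover have "countable D" "D \<subseteq> carr (ell e)"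
    using D0(1) fin by (auto simp: D_def)
  ultimately show thesis using that by blast
qed

context ell_pair
begin

abbreviation balls :: "((nat \<Rightarrow> 'k) \<times> (nat \<Rightarrow> 'k)) set" where
  "balls \<equiv> unit_ball E \<times> unit_ball F"

text \<open>The sigma-algebra demanded by \<open>borel_measure_on_balls\<close>, packaged as a
  \<open>measure\<close> so that it can be the target of measurable maps.\<close>

definition ball_space :: "((nat \<Rightarrow> 'k) \<times> (nat \<Rightarrow> 'k)) measure" where
  "ball_space = sigma balls
     {U. openin (subtopology (prod_topology (norm_topology E) (norm_topology F)) balls) U}"

lemma balls_open_subset:
  "{U. openin (subtopology (prod_topology (norm_topology E) (norm_topology F)) balls) U} \<subseteq> Pow balls"
  by (auto simp: openin_subtopology)

lemma space_ball_space: "space ball_space = balls"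
  unfolding ball_space_def by (rule space_measure_of[OF balls_open_subset])

lemma sets_ball_space:
  "sets ball_space = sigma_sets balls
     {U. openin (subtopology (prod_topology (norm_topology E) (norm_topology F)) balls) U}"
  unfolding ball_space_def by (rule sets_measure_of[OF balls_open_subset])

lemma openin_norm_prod_iff:
  "openin (prod_topology (norm_topology E) (norm_topology F)) S \<longleftrightarrow>
    S \<subseteq> carr E \<times> carr F \<and> (\<forall>x y. (x, y) \<in> S \<longrightarrow> (\<exists>r>0. \<forall>x'\<in>carr E. \<forall>y'\<in>carr F.
      ndist E x x' < r \<longrightarrow> ndist F y y' < r \<longrightarrow> (x', y') \<in> S))"
proof -
  interpret ME: Metric_space "carr E" "ndist E" unfolding E_eq by (rule Metric_space_ell[OF p])
  interpret MF: Metric_space "carr F" "ndist F" unfolding F_eq by (rule Metric_space_ell[OF q])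
  show ?thesis (is "?L \<longleftrightarrow> ?R")
  proof
    assume L: ?L
    have sub: "S \<subseteq> carr E \<times> carr F"
      using openin_subset[OF L] by (simp add: norm_topology_def)
    have "\<exists>r>0. \<forall>x'\<in>carr E. \<forall>y'\<in>carr F. ndist E x x' < r \<longrightarrow> ndist F y y' < r \<longrightarrow> (x', y') \<in> S"
      if xy: "(x, y) \<in> S" for x y
    proof -
      obtain U V where UV: "openin ME.mtopology U" "openin MF.mtopology V" "x \<in> U" "y \<in> V" "U \<times> V \<subseteq> S"
        using iffD1[OF openin_prod_topology_alt L, rule_format, OF xy] unfolding norm_topology_def by metis
      obtain r1 r2 where r: "r1 > 0" "ME.mball x r1 \<subseteq> U" "r2 > 0" "MF.mball y r2 \<subseteq> V"
        using UV unfolding ME.openin_mtopology MF.openin_mtopology by blast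
      have "(x', y') \<in> S" if "x' \<in> carr E" "y' \<in> carr F" "ndist E x x' < min r1 r2" "ndist F y y' < min r1 r2" for x' y'
      proof -
        have "x' \<in> ME.mball x r1" "y' \<in> MF.mball y r2" using that sub xy by auto
        then show ?thesis using r UV(5) by blast
      qed
      then show ?thesis using r by (intro exI[of _ "min r1 r2"]) auto
    qed
    with sub show ?R by blast
  next
    assume R: ?R
    show ?L
      unfolding openin_prod_topology_alt norm_topology_def
    proof (intro allI impI)
      fix x y assume xy: "(x, y) \<in> S"
      then obtain r where r: "r > 0" "\<And>x' y'. x' \<in> carr E \<Longrightarrow> y' \<in> carr F \<Longrightarrow>
          ndist E x x' < r \<Longrightarrow> ndist F y y' < r \<Longrightarrow> (x', y') \<in> S" using R by blast
      have "ME.mball x r \<times> MF.mball y r \<subseteq> S" using r(2) by auto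
      then show "\<exists>U V. openin ME.mtopology U \<and> openin MF.mtopology V \<and> x \<in> U \<and> y \<in> V \<and> U \<times> V \<subseteq> S"
        using xy R r(1) by (intro exI[of _ "ME.mball x r"] exI[of _ "MF.mball y r"]) auto
    qed
  qed
qed

text \<open>By separability, a norm-open set meets the carriers in a countable union of products of
  balls with centres in the dense sets and rational radii. The preimage of such a product is
  described by two distances, and these are measurable because the norm is a series in the
  coordinates. This passes from weak to norm-Borel measurability.\<close>

lemma measurable_into_ball_space:
  assumes X: "\<And>n. (\<lambda>t. X t n) \<in> borel_measurable M" and Y: "\<And>n. (\<lambda>t. Y t n) \<in> borel_measurable M"
    and ball: "\<And>t. X t \<in> unit_ball E" "\<And>t. Y t \<in> unit_ball F"
  shows "(\<lambda>t. (X t, Y t)) \<in> measurable M ball_space"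
  unfolding ball_space_def
proof (rule measurable_measure_of[OF balls_open_subset])
  show "(\<lambda>t. (X t, Y t)) \<in> space M \<rightarrow> balls" using ball by auto
  fix U assume "U \<in> {U. openin (subtopology (prod_topology (norm_topology E) (norm_topology F)) balls) U}"
  then obtain S where S: "openin (prod_topology (norm_topology E) (norm_topology F)) S" "U = S \<inter> balls"
    by (auto simp: openin_subtopology)
  obtain DE :: "(nat \<Rightarrow> 'k) set" where DE: "countable DE" "DE \<subseteq> carr E"
    "\<And>x r. x \<in> carr E \<Longrightarrow> 0 < r \<Longrightarrow> \<exists>a\<in>DE. ndist E x a < r"
    using ell_separable[OF p] unfolding E_eq by blast
  obtain DF :: "(nat \<Rightarrow> 'k) set" where DF: "countable DF" "DF \<subseteq> carr F"
    "\<And>x r. x \<in> carr F \<Longrightarrow> 0 < r \<Longrightarrow> \<exists>a\<in>DF. ndist F x a < r"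
    using ell_separable[OF q] unfolding F_eq by blast
  have carr: "X t \<in> carr E" "Y t \<in> carr F" for t using ball[of t] by (auto simp: unit_ball_def)
  define G where "G = {(a, b, r) \<in> DE \<times> DF \<times> \<rat>. \<forall>x\<in>carr E. \<forall>y\<in>carr F.
      ndist E x a < r \<longrightarrow> ndist F y b < r \<longrightarrow> (x, y) \<in> S}"
  have "countable G"
    using DE(1) DF(1) by (intro countable_subset[OF _ countable_SIGMA[OF DE(1) countable_SIGMA[OF DF(1) countable_rat]]])
      (auto simp: G_def)
  have mE: "(\<lambda>t. ndist E (X t) a) \<in> borel_measurable M" and mF: "(\<lambda>t. ndist F (Y t) b) \<in> borel_measurable M" for a b
    unfolding E.ndist_eq F.ndist_eq unfolding E_eq F_eq ell_simps using X Y by measurable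
  have "(\<lambda>t. (X t, Y t)) -` U \<inter> space M
      = (\<Union>(a, b, r)\<in>G. {t\<in>space M. ndist E (X t) a < r \<and> ndist F (Y t) b < r})"
  proof (intro set_eqI iffI)
    fix t assume t: "t \<in> (\<lambda>t. (X t, Y t)) -` U \<inter> space M"
    then have "(X t, Y t) \<in> S" using S by simp
    then obtain r where r: "r > 0" "\<And>x' y'. x' \<in> carr E \<Longrightarrow> y' \<in> carr F \<Longrightarrow>
        ndist E (X t) x' < r \<Longrightarrow> ndist F (Y t) y' < r \<Longrightarrow> (x', y') \<in> S"
      using S(1) unfolding openin_norm_prod_iff by blast
    obtain r' where r': "r' \<in> \<rat>" "0 < r'" "r' < r / 2" using Rats_dense_in_real[of 0 "r / 2"] r(1) by auto
    obtain a b where ab: "a \<in> DE" "ndist E (X t) a < r'" "b \<in> DF" "ndist F (Y t) b < r'"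
      using DE(3)[OF carr(1) r'(2)] DF(3)[OF carr(2) r'(2)] by blast
    have abc: "a \<in> carr E" "b \<in> carr F" using ab DE(2) DF(2) by auto
    have "(x, y) \<in> S" if "x \<in> carr E" "y \<in> carr F" "ndist E x a < r'" "ndist F y b < r'" for x y
    proof (rule r(2)[OF that(1,2)])
      show "ndist E (X t) x < r"
        using E.ndist_triangle[OF carr(1)[of t] abc(1) that(1)] E.ndist_commute[OF that(1) abc(1)] that ab r' by linarith
      show "ndist F (Y t) y < r"
        using F.ndist_triangle[OF carr(2)[of t] abc(2) that(2)] F.ndist_commute[OF that(2) abc(2)] that ab r' by linarith
    qed
    then have "(a, b, r') \<in> G" using ab r' by (simp add: G_def)
    then show "t \<in> (\<Union>(a, b, r)\<in>G. {t\<in>space M. ndist E (X t) a < r \<and> ndist F (Y t) b < r})"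
      using t ab by (intro UN_I[of "(a, b, r')"]) auto
  next
    fix t assume "t \<in> (\<Union>(a, b, r)\<in>G. {t\<in>space M. ndist E (X t) a < r \<and> ndist F (Y t) b < r})"
    then show "t \<in> (\<lambda>t. (X t, Y t)) -` U \<inter> space M"
      using S(2) ball[of t] carr[of t] by (auto simp: G_def)
  qed
  also have "\<dots> \<in> sets M"
    using mE mF by (intro sets.countable_UN'' \<open>countable G\<close>) (auto split: prod.split)
  finally show "(\<lambda>t. (X t, Y t)) -` U \<inter> space M \<in> sets M" .
qed

text \<open>The map from (x, y) to x \<otimes> y is norm continuous by
  \<open>ndist_elem_tensor_le\<close>, so a function that is Lipschitz in the tensor is continuous
  on the product.\<close>

lemma borel_measurable_ball_space:
  fixes f :: "(nat \<Rightarrow> 'k) \<Rightarrow> (nat \<Rightarrow> 'k) \<Rightarrow> 'b::metric_space"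
  assumes lip: "\<And>x y x' y'. x \<in> carr E \<Longrightarrow> y \<in> carr F \<Longrightarrow> x' \<in> carr E \<Longrightarrow> y' \<in> carr F \<Longrightarrow>
    dist (f x y) (f x' y') \<le> ndist (alg_tensor E F) (elem_tensor E F x y) (elem_tensor E F x' y')"
  shows "(\<lambda>w. f (fst w) (snd w)) \<in> borel_measurable ball_space"
proof (rule borel_measurableI)
  fix A :: "'b set" assume A: "open A"
  let ?S = "{w \<in> carr E \<times> carr F. f (fst w) (snd w) \<in> A}"
  have "openin (prod_topology (norm_topology E) (norm_topology F)) ?S"
    unfolding openin_norm_prod_iff
  proof (intro conjI allI impI)
    fix x y assume xy: "(x, y) \<in> ?S"
    then have c: "x \<in> carr E" "y \<in> carr F" by auto
    obtain \<epsilon> where \<epsilon>: "\<epsilon> > 0" "\<And>z. dist z (f x y) < \<epsilon> \<Longrightarrow> z \<in> A"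
      using A xy unfolding open_dist by auto
    \<comment> \<open>The summand 1 allows for the norm of the nearby point y', at most that of y
      plus 1 because the radius is at most 1.\<close>
    define K where "K = nrm E x + nrm F y + 1"
    have K: "K > 0" using E.nrm_nonneg[OF c(1)] F.nrm_nonneg[OF c(2)] by (simp add: K_def)
    define r where "r = min 1 (\<epsilon> / K)"
    have r: "r > 0" "r \<le> 1" "r * K \<le> \<epsilon>"
      using \<epsilon> K by (auto simp: r_def min_def field_simps)
    have "f x' y' \<in> A" if c': "x' \<in> carr E" "y' \<in> carr F" and d: "ndist E x x' < r" "ndist F y y' < r" for x' y'
    proof (rule \<epsilon>(2))
      have dx: "ndist E x' x < r" "0 \<le> ndist E x' x" and dy: "ndist F y' y < r" "0 \<le> ndist F y' y"
        using d E.ndist_commute[OF c(1) c'(1)] F.ndist_commute[OF c(2) c'(2)]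
          E.ndist_nonneg[OF c'(1) c(1)] F.ndist_nonneg[OF c'(2) c(2)] by auto
      have ny: "nrm F y' \<le> nrm F y + 1"
        using F.nrm_triangle_diff[OF c'(2) c(2)] dy r by (simp add: F.ndist_eq)
      have "dist (f x' y') (f x y) \<le> ndist E x' x * nrm F y' + nrm E x * ndist F y' y"
        using lip[OF c' c] ndist_elem_tensor_le[OF c'(1) c(1) c'(2) c(2)] by linarith
      also have "\<dots> \<le> ndist E x' x * (nrm F y + 1) + nrm E x * r"
        using ny dx dy E.nrm_nonneg[OF c(1)] by (intro add_mono mult_left_mono) auto
      also have "\<dots> < r * (nrm F y + 1) + nrm E x * r"
        using dx F.nrm_nonneg[OF c(2)] by (intro add_strict_right_mono mult_strict_right_mono) auto
      also have "\<dots> = r * K" by (simp add: K_def algebra_simps)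
      finally show "dist (f x' y') (f x y) < \<epsilon>" using r by simp
    qed
    then show "\<exists>r>0. \<forall>x'\<in>carr E. \<forall>y'\<in>carr F. ndist E x x' < r \<longrightarrow> ndist F y y' < r \<longrightarrow> (x', y') \<in> ?S"
      using r(1) by (intro exI[of _ r]) auto
  qed auto
  then have "?S \<inter> balls \<in> sets ball_space"
    unfolding sets_ball_space by (intro sigma_sets.Basic) (auto simp: openin_subtopology)
  also have "?S \<inter> balls = (\<lambda>w. f (fst w) (snd w)) -` A \<inter> space ball_space"
    by (auto simp: space_ball_space unit_ball_def)
  finally show "(\<lambda>w. f (fst w) (snd w)) -` A \<inter> space ball_space \<in> sets ball_space" .
qed

lemma measurable_entry_product: "(\<lambda>w. fst w n * snd w m) \<in> borel_measurable ball_space"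
  using borel_measurable_ball_space[of "\<lambda>x y. x n * y m"] norm_entry_diff_le[OF elem_tensor_carr elem_tensor_carr]
  by (simp add: dist_norm entry_def elem_tensor_coord)

lemma measurable_ndist_elem_tensor:
  assumes v: "v \<in> carr (alg_tensor E F)"
  shows "(\<lambda>w. ndist (alg_tensor E F) (elem_tensor E F (fst w) (snd w)) v) \<in> borel_measurable ball_space"
proof (rule borel_measurable_ball_space)
  fix x y x' y' assume "x \<in> carr E" "y \<in> carr F" "x' \<in> carr E" "y' \<in> carr F"
  then have c: "elem_tensor E F x y \<in> carr (alg_tensor E F)" "elem_tensor E F x' y' \<in> carr (alg_tensor E F)"
    by (auto intro: elem_tensor_carr)
  show "dist (ndist (alg_tensor E F) (elem_tensor E F x y) v) (ndist (alg_tensor E F) (elem_tensor E F x' y') v)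
      \<le> ndist (alg_tensor E F) (elem_tensor E F x y) (elem_tensor E F x' y')"
    using T.ndist_triangle[OF c v] T.ndist_triangle[OF c(2) c(1) v] T.ndist_commute[OF c]
    by (simp add: dist_real_def abs_le_iff)
qed

text \<open>On \<open>A n\<close> and on its complement the last summand is constant and can be
  absorbed into the offset; this is why the offset \<open>v0\<close> is carried through the
  induction.\<close>

lemma measurable_ndist_simple:
  fixes n :: nat
  assumes "\<And>i. i < n \<Longrightarrow> A i \<in> sets ball_space" "\<And>i. i < n \<Longrightarrow> v i \<in> carr (alg_tensor E F)"
    "v0 \<in> carr (alg_tensor E F)"
  shows "(\<lambda>w. ndist (alg_tensor E F) (elem_tensor E F (fst w) (snd w))
    (\<lambda>B. v0 B + (\<Sum>i<n. if w \<in> A i then v i B else 0))) \<in> borel_measurable ball_space"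
  using assms
proof (induction n arbitrary: v0)
  case 0
  then show ?case by (simp add: measurable_ndist_elem_tensor)
next
  case (Suc n)
  let ?f = "\<lambda>v0 w. ndist (alg_tensor E F) (elem_tensor E F (fst w) (snd w))
    (\<lambda>B. v0 B + (\<Sum>i<n. if w \<in> A i then v i B else 0))"
  have "?f v0 \<in> borel_measurable ball_space" "?f (\<lambda>B. v0 B + v n B) \<in> borel_measurable ball_space"
    using Suc.prems by (auto intro!: Suc.IH T.add_carr)
  then have "(\<lambda>w. if w \<in> A n then ?f (\<lambda>B. v0 B + v n B) w else ?f v0 w) \<in> borel_measurable ball_space"
    using Suc.prems(1)[of n] by (intro measurable_If_set) auto
  also have "(\<lambda>w. if w \<in> A n then ?f (\<lambda>B. v0 B + v n B) w else ?f v0 w)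
      = (\<lambda>w. ndist (alg_tensor E F) (elem_tensor E F (fst w) (snd w))
          (\<lambda>B. v0 B + (\<Sum>i<Suc n. if w \<in> A i then v i B else 0)))"
    by (auto simp: add_ac)
  finally show ?case .
qed

end

section \<open>Integral representations\<close>

text \<open>Rounding to the centres of a finite cover of the compact unit ball, with the cover made
  disjoint by order of the list. The shape as a sum of conditionals matches
  \<open>simple_fun\<close>.\<close>

lemma finite_quantization:
  fixes \<delta> :: real
  assumes "\<delta> > 0"
  obtains J :: nat and D :: "nat \<Rightarrow> 'k::euclidean_space set" and v :: "nat \<Rightarrow> 'k"
  where "\<And>j. D j \<in> sets borel"
    "\<And>c. norm c \<le> 1 \<Longrightarrow> norm (c - (\<Sum>j<J. if c \<in> D j then v j else 0)) \<le> \<delta>"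
proof -
  obtain T :: "'k set" where T: "finite T" "cball 0 1 \<subseteq> (\<Union>t\<in>T. ball t \<delta>)"
  proof (rule compactE_image[OF compact_cball[of "0 :: 'k" 1], of UNIV "\<lambda>t. ball t \<delta>"])
    show "cball 0 1 \<subseteq> (\<Union>t. ball t \<delta>)" using centre_in_ball assms by blast
  qed auto
  obtain xs where xs: "set xs = T" using finite_list[OF T(1)] by blast
  define D where "D j = ball (xs ! j) \<delta> - (\<Union>i<j. ball (xs ! i) \<delta>)" for j
  have "norm (c - (\<Sum>j<length xs. if c \<in> D j then xs ! j else 0)) \<le> \<delta>" if "norm c \<le> 1" for c
  proof -
    have "\<exists>j<length xs. c \<in> ball (xs ! j) \<delta>"
      using T(2) that xs by (metis UN_E in_set_conv_nth mem_cball_0 subsetD)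
    then obtain j where j: "j < length xs" "c \<in> ball (xs ! j) \<delta>" "\<And>i. i < j \<Longrightarrow> c \<notin> ball (xs ! i) \<delta>"
      using exists_least_iff[of "\<lambda>j. j < length xs \<and> c \<in> ball (xs ! j) \<delta>"] by (metis less_trans)
    have "c \<in> D i \<longleftrightarrow> i = j" for i
      using j(2,3) unfolding D_def by (cases i j rule: linorder_cases) auto
    then have "(\<Sum>i<length xs. if c \<in> D i then xs ! i else 0) = xs ! j" using j(1) by simp
    then show ?thesis using j(2) by (simp add: dist_norm norm_minus_commute)
  qed
  moreover have "D j \<in> sets borel" for j by (simp add: D_def)
  ultimately show thesis using that by blast
qed

context ell_pair
begin

text \<open>The approximating simple functions are truncated matrices of x \<otimes> y with rounded
  entries. They converge pointwise and boundedly on the balls, so dominated convergence gives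
  convergence in L_1. Their integrals are finite matrices whose entries are close to the moments
  \<open>a\<close>, and \<open>nlimit_matrix_tensor\<close> identifies the limit with the class of
  \<open>s\<close>.\<close>

lemma has_bochner_int_tensor:
  assumes fin: "finite_measure \<mu>" and sets: "sets \<mu> = sets ball_space"
    and s: "s \<in> cauchy_seqs (alg_tensor E F)"
    and a: "\<And>n m. (\<lambda>k. entry (s k) n m) \<longlonglongrightarrow> a n m"
    and moments: "\<And>n m. (\<integral>w. fst w n * snd w m \<partial>\<mu>) = a n m"
  shows "has_bochner_int (proj_tensor E F) \<mu> (\<lambda>(x, y). tensor E F x y) (T.cls s)"
proof -
  interpret finite_measure \<mu> by (rule fin)
  let ?T = "alg_tensor E F" and ?P = "proj_tensor E F"
  have space: "space \<mu> = balls" using sets_eq_imp_space_eq[OF sets] by (simp add: space_ball_space)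
  note meas_cong = measurable_cong_sets[OF sets refl]
  have ball: "fst w \<in> carr E" "snd w \<in> carr F" "nrm E (fst w) \<le> 1" "nrm F (snd w) \<le> 1" if "w \<in> balls" for w
    using that by (auto simp: unit_ball_def)
  have norm_prod: "norm (fst w n * snd w m) \<le> 1" if w: "w \<in> balls" for w n m
    using coord_form_bound[OF ball(1,2)[OF w], of n m]
      mult_le_one[OF ball(3)[OF w] F.nrm_nonneg[OF ball(2)[OF w]] ball(4)[OF w]] by simp
  have meas_prod: "(\<lambda>w. fst w n * snd w m) \<in> borel_measurable \<mu>" for n m
    unfolding meas_cong by (rule measurable_entry_product)
  \<comment> \<open>The k-th truncation has k^2 entries, each entry error counting fully in
    \<open>ndist_matrix_tensor_le\<close>; the cubic rate leaves a total error of at most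
    1/(k+1).\<close>
  define \<delta> where "\<delta> k = 1 / real (Suc k) ^ 3" for k
  have "\<forall>k. \<exists>(J :: nat) D v. (\<forall>j. D j \<in> sets borel) \<and>
      (\<forall>c. norm c \<le> 1 \<longrightarrow> norm (c - (\<Sum>j<J. if c \<in> D j then v j else (0 :: 'k))) \<le> \<delta> k)"
  proof
    fix k
    have "\<delta> k > 0" by (simp add: \<delta>_def)
    then show "\<exists>(J :: nat) D v. (\<forall>j. D j \<in> sets borel) \<and>
      (\<forall>c. norm c \<le> 1 \<longrightarrow> norm (c - (\<Sum>j<J. if c \<in> D j then v j else (0 :: 'k))) \<le> \<delta> k)"
    proof (rule finite_quantization)
      fix J and D :: "nat \<Rightarrow> 'k set" and v
      assume "\<And>j. D j \<in> sets borel"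
        "\<And>c. norm c \<le> 1 \<Longrightarrow> norm (c - (\<Sum>j<J. if c \<in> D j then v j else 0)) \<le> \<delta> k"
      then show ?thesis by (intro exI[of _ J] exI[of _ D] exI[of _ v]) simp
    qed
  qed
  then obtain J :: "nat \<Rightarrow> nat" and D :: "nat \<Rightarrow> nat \<Rightarrow> 'k set" and v :: "nat \<Rightarrow> nat \<Rightarrow> 'k"
    where D: "\<And>k j. D k j \<in> sets borel"
      and quant: "\<And>k c. norm c \<le> 1 \<Longrightarrow> norm (c - (\<Sum>j<J k. if c \<in> D k j then v k j else 0)) \<le> \<delta> k"
    by metis
  define qt where "qt k c = (\<Sum>j<J k. if c \<in> D k j then v k j else 0)" for k c
  \<comment> \<open>Each triple gives one indicator: row, column and rounding cell. The bijection
    \<open>e\<close> flattens the triples to the natural indices that \<open>simple_data\<close>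
    expects.\<close>
  define I where "I k = {..<k} \<times> {..<k} \<times> {..<J k}" for k
  have "\<forall>k. \<exists>e. bij_betw e {..<card (I k)} (I k)"
    using ex_bij_betw_nat_finite[of "I k" for k] by (simp add: I_def lessThan_atLeast0)
  then obtain e where e: "\<And>k. bij_betw (e k) {..<card (I k)} (I k)" by metis
  define N where "N k = card (I k)" for k
  define A where "A k i = (case e k i of (n, m, j) \<Rightarrow> {w \<in> balls. fst w n * snd w m \<in> D k j})" for k i
  define V where "V k i = (case e k i of (n, m, j) \<Rightarrow> \<lambda>B. v k j * unit_tensor n m B)" for k i
  have sum_e: "(\<Sum>i<N k. f (e k i)) = (\<Sum>n<k. \<Sum>m<k. \<Sum>j<J k. f (n, m, j))"
    for f :: "nat \<times> nat \<times> nat \<Rightarrow> 'k" and k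
  proof -
    have "(\<Sum>i<N k. f (e k i)) = sum f (I k)"
      unfolding N_def by (rule sum.reindex_bij_betw[OF e])
    then show ?thesis by (simp add: I_def sum.cartesian_product)
  qed
  have A: "A k i \<in> sets \<mu>" for k i
  proof -
    have "(\<lambda>w. fst w n * snd w m) -` D k j \<inter> space \<mu> \<in> sets \<mu>" for n m j
      by (rule measurable_sets[OF meas_prod D])
    moreover have "(\<lambda>w. fst w n * snd w m) -` D k j \<inter> space \<mu> = {w \<in> balls. fst w n * snd w m \<in> D k j}" for n m j
      by (auto simp: space)
    ultimately show ?thesis by (simp add: A_def split: prod.split)
  qed
  have V: "V k i \<in> carr ?T" for k i
    by (auto simp: V_def intro: T.scl_carr unit_tensor_carr split: prod.split)
  have simple: "(\<lambda>B. \<Sum>i<N k. if w \<in> A k i then V k i B else 0) = matrix_tensor k (\<lambda>n m. qt k (fst w n * snd w m))"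
    if w: "w \<in> balls" for k w
  proof
    fix B
    have "(\<Sum>i<N k. if w \<in> A k i then V k i B else 0)
        = (\<Sum>i<N k. case e k i of (n, m, j) \<Rightarrow> if fst w n * snd w m \<in> D k j then v k j * unit_tensor n m B else 0)"
      using w by (intro sum.cong) (auto simp: A_def V_def split: prod.split)
    also have "\<dots> = (\<Sum>n<k. \<Sum>m<k. \<Sum>j<J k. if fst w n * snd w m \<in> D k j then v k j * unit_tensor n m B else 0)"
      by (subst sum_e) simp
    also have "\<dots> = matrix_tensor k (\<lambda>n m. qt k (fst w n * snd w m)) B"
      by (auto simp: matrix_tensor_def qt_def sum_distrib_right intro!: sum.cong)
    finally show "(\<Sum>i<N k. if w \<in> A k i then V k i B else 0) = matrix_tensor k (\<lambda>n m. qt k (fst w n * snd w m)) B" .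
  qed
  \<comment> \<open>The error is computed in the algebraic tensor product, where both tensors live
    before they are embedded; \<open>dist_eq\<close> transfers it to the completion.\<close>
  define G where "G k w = ndist ?T (elem_tensor E F (fst w) (snd w)) (\<lambda>B. \<Sum>i<N k. if w \<in> A k i then V k i B else 0)" for k w
  have G_meas: "G k \<in> borel_measurable \<mu>" for k
    using measurable_ndist_simple[of "N k" "A k" "V k" "\<lambda>B. 0"] A V T.zero_carr
    unfolding G_def[abs_def] meas_cong by (simp add: sets)
  have dist_eq: "ndist ?P ((\<lambda>(x, y). tensor E F x y) w) (simple_fun ?P (N k) (A k) (\<lambda>i. into_completion ?T (V k i)) w) = G k w"
    if w: "w \<in> balls" for k w
  proof -
    let ?f = "\<lambda>i B. if w \<in> A k i then V k i B else 0"
    have fc: "?f i \<in> carr ?T" for i using V T.zero_carr by (cases "w \<in> A k i") auto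
    have "(\<lambda>i. if w \<in> A k i then into_completion ?T (V k i) else zer ?P) = (\<lambda>i. into_completion ?T (?f i))"
      by (rule ext) (simp add: proj_tensor_def T.into_completion_zer)
    then have "simple_fun ?P (N k) (A k) (\<lambda>i. into_completion ?T (V k i)) w
        = into_completion ?T (\<lambda>B. \<Sum>i<N k. ?f i B)"
      unfolding simple_fun_def using T.partial_sum_into_completion[of "N k" ?f] fc by (simp add: proj_tensor_def)
    then show ?thesis
      using ball[OF w] T.sum_carr[of "{..<N k}" ?f] fc
      by (cases w) (simp add: G_def tensor_eq proj_tensor_def T.ndist_into_completion elem_tensor_carr)
  qed
  have \<delta>_sum: "real k * (real k * \<delta> k) \<le> 1 / real (Suc k)" for k
  proof -
    have "real k * (real k * \<delta> k) = (real k * real k) / (real (Suc k) * real (Suc k)) * (1 / real (Suc k))"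
      by (simp add: \<delta>_def power3_eq_cube del: of_nat_Suc)
    also have "(real k * real k) / (real (Suc k) * real (Suc k)) \<le> 1"
      by (subst divide_le_eq_1_pos) (auto intro!: mult_mono)
    then have "(real k * real k) / (real (Suc k) * real (Suc k)) * (1 / real (Suc k)) \<le> 1 * (1 / real (Suc k))"
      by (rule mult_right_mono) simp
    finally show ?thesis by simp
  qed
  have inv_lim: "(\<lambda>k. 1 / real (Suc k)) \<longlonglongrightarrow> 0" by (rule LIMSEQ_Suc[OF lim_1_over_n])
  have G_bound: "G k w \<le> (tail_E k (fst w) + tail_F k (snd w)) + 1 / real (Suc k)" if w: "w \<in> balls" for k w
  proof -
    note c = ball[OF w]
    have "G k w \<le> ndist ?T (elem_tensor E F (fst w) (snd w)) (matrix_tensor k (\<lambda>n m. fst w n * snd w m))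
        + ndist ?T (matrix_tensor k (\<lambda>n m. fst w n * snd w m)) (matrix_tensor k (\<lambda>n m. qt k (fst w n * snd w m)))"
      unfolding G_def simple[OF w] by (intro T.ndist_triangle elem_tensor_carr matrix_tensor_carr c)
    also have "ndist ?T (elem_tensor E F (fst w) (snd w)) (matrix_tensor k (\<lambda>n m. fst w n * snd w m))
        \<le> tail_E k (fst w) * nrm F (snd w) + nrm E (fst w) * tail_F k (snd w)"
      by (rule ndist_elem_tensor_matrix_tensor_le[OF c(1,2)])
    also have "tail_E k (fst w) * nrm F (snd w) + nrm E (fst w) * tail_F k (snd w)
        \<le> tail_E k (fst w) + tail_F k (snd w)"
      using c unfolding tail_E_def tail_F_def
      by (intro add_mono mult_left_le mult_left_le_one_le E.nrm_nonneg F.nrm_nonneg E.diff_carr F.diff_carr truncate_carr)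
    also have "ndist ?T (matrix_tensor k (\<lambda>n m. fst w n * snd w m)) (matrix_tensor k (\<lambda>n m. qt k (fst w n * snd w m)))
        \<le> (\<Sum>n<k. \<Sum>m<k. \<delta> k)"
      using quant norm_prod[OF w] unfolding qt_def
      by (intro order_trans[OF ndist_matrix_tensor_le] sum_mono) auto
    also have "\<dots> \<le> 1 / real (Suc k)" using \<delta>_sum[of k] by simp
    finally show ?thesis by simp
  qed
  have G_nonneg: "0 \<le> G k w" if "w \<in> balls" for k w
    unfolding G_def simple[OF that] by (intro T.ndist_nonneg elem_tensor_carr matrix_tensor_carr ball[OF that])
  \<comment> \<open>The two tails and the rounding error are each at most 1, and on a finite measure
    space the constant 3 is an integrable bound.\<close>
  have G_le: "G k w \<le> 3" if w: "w \<in> balls" for k w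
  proof -
    note c = ball[OF w]
    have "tail_E k (fst w) \<le> nrm E (fst w)" "tail_F k (snd w) \<le> nrm F (snd w)"
      unfolding tail_E_def tail_F_def using c(1,2) unfolding E_eq F_eq
      by (intro ell_nrm_mono[OF p] ell_nrm_mono[OF q]; simp)+
    moreover have "1 / real (Suc k) \<le> 1" by simp
    ultimately show ?thesis using G_bound[OF w, of k] c by linarith
  qed
  have G_lim: "(\<lambda>k. G k w) \<longlonglongrightarrow> 0" if w: "w \<in> balls" for w
  proof (rule tendsto_sandwich[of "\<lambda>_. 0" "\<lambda>k. G k w" _ "\<lambda>k. (tail_E k (fst w) + tail_F k (snd w)) + 1 / real (Suc k)"])
    have "(\<lambda>k. (tail_E k (fst w) + tail_F k (snd w)) + 1 / real (Suc k)) \<longlonglongrightarrow> (0 + 0) + 0"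
      using ball[OF w] by (intro tendsto_add tails_tendsto_0 inv_lim)
    then show "(\<lambda>k. (tail_E k (fst w) + tail_F k (snd w)) + 1 / real (Suc k)) \<longlonglongrightarrow> 0" by simp
  qed (use G_bound[OF w] G_nonneg[OF w] in \<open>auto intro!: always_eventually\<close>)
  have int_lim: "(\<lambda>k. \<integral>\<^sup>+w. ennreal (G k w) \<partial>\<mu>) \<longlonglongrightarrow> 0"
  proof -
    have "(\<lambda>k. \<integral>\<^sup>+w. ennreal (G k w) \<partial>\<mu>) \<longlonglongrightarrow> (\<integral>\<^sup>+w. 0 \<partial>\<mu>)"
    proof (rule nn_integral_dominated_convergence[where w = "\<lambda>_. 3"])
      show "(\<integral>\<^sup>+w. 3 \<partial>\<mu>) < \<infinity>"
        using emeasure_finite[of "space \<mu>"] by (simp add: less_top[symmetric] ennreal_mult_eq_top_iff)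
      show "AE w in \<mu>. (\<lambda>k. ennreal (G k w)) \<longlonglongrightarrow> 0"
        using G_lim by (auto intro!: AE_I2 tendsto_ennrealI[of _ 0, simplified] simp: space)
      show "AE w in \<mu>. ennreal (G k w) \<le> 3" for k
        using G_le[of _ k] by (auto intro!: AE_I2 ennreal_leI[of _ 3, simplified] simp: space)
    qed (use G_meas in auto)
    then show ?thesis by simp
  qed
  \<comment> \<open>The exact integrals of the rounded entries, and hence the entries of the
    integral of the k-th simple function.\<close>
  define Q where "Q k n m = (\<integral>w. qt k (fst w n * snd w m) \<partial>\<mu>)" for k n m
  have ind_int: "integrable \<mu> (\<lambda>w. if fst w n * snd w m \<in> D k j then v k j else 0)"
    "(\<integral>w. (if fst w n * snd w m \<in> D k j then v k j else 0) \<partial>\<mu>)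
      = of_real (measure \<mu> {w \<in> balls. fst w n * snd w m \<in> D k j}) * v k j" for k n m j
  proof -
    let ?S = "{w \<in> balls. fst w n * snd w m \<in> D k j}"
    have S: "?S \<in> sets \<mu>"
    proof -
      have "(\<lambda>w. fst w n * snd w m) -` D k j \<inter> space \<mu> \<in> sets \<mu>"
        by (rule measurable_sets[OF meas_prod D])
      also have "(\<lambda>w. fst w n * snd w m) -` D k j \<inter> space \<mu> = ?S" by (auto simp: space)
      finally show ?thesis .
    qed
    have "has_bochner_integral \<mu> (\<lambda>w. indicator ?S w *\<^sub>R v k j) (measure \<mu> ?S *\<^sub>R v k j)"
      by (rule has_bochner_integral_indicator[OF S]) (simp add: emeasure_finite less_top[symmetric])
    then have "has_bochner_integral \<mu> (\<lambda>w. if fst w n * snd w m \<in> D k j then v k j else 0) (measure \<mu> ?S *\<^sub>R v k j)"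
      by (subst has_bochner_integral_cong[OF refl _ refl, of _ _ "\<lambda>w. indicator ?S w *\<^sub>R v k j"])
        (auto simp: space indicator_def)
    then show "integrable \<mu> (\<lambda>w. if fst w n * snd w m \<in> D k j then v k j else 0)"
      "(\<integral>w. (if fst w n * snd w m \<in> D k j then v k j else 0) \<partial>\<mu>) = of_real (measure \<mu> ?S) * v k j"
      by (auto simp: has_bochner_integral_iff scaleR_conv_of_real)
  qed
  have int_eq: "simple_int ?P \<mu> (N k) (A k) (\<lambda>i. into_completion ?T (V k i)) = into_completion ?T (matrix_tensor k (Q k))" for k
  proof -
    have "(\<lambda>i. scl ?P (of_real (measure \<mu> (A k i))) (into_completion ?T (V k i)))
        = (\<lambda>i. into_completion ?T (\<lambda>B. of_real (measure \<mu> (A k i)) * V k i B))"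
      by (simp add: proj_tensor_def T.into_completion_scl V)
    then have "simple_int ?P \<mu> (N k) (A k) (\<lambda>i. into_completion ?T (V k i))
        = into_completion ?T (\<lambda>B. \<Sum>i<N k. of_real (measure \<mu> (A k i)) * V k i B)"
      unfolding simple_int_def proj_tensor_def
      by (simp only:) (rule T.partial_sum_into_completion, intro T.scl_carr V)
    also have "(\<lambda>B. \<Sum>i<N k. of_real (measure \<mu> (A k i)) * V k i B) = matrix_tensor k (Q k)"
    proof
      fix B
      have "(\<Sum>i<N k. of_real (measure \<mu> (A k i)) * V k i B)
          = (\<Sum>i<N k. case e k i of (n, m, j) \<Rightarrow>
              of_real (measure \<mu> {w \<in> balls. fst w n * snd w m \<in> D k j}) * (v k j * unit_tensor n m B))"
        by (intro sum.cong) (auto simp: A_def V_def split: prod.split)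
      also have "\<dots> = (\<Sum>n<k. \<Sum>m<k. \<Sum>j<J k.
          of_real (measure \<mu> {w \<in> balls. fst w n * snd w m \<in> D k j}) * (v k j * unit_tensor n m B))"
        by (subst sum_e) simp
      also have "\<dots> = matrix_tensor k (Q k) B"
        by (simp add: matrix_tensor_def Q_def qt_def integral_sum ind_int sum_distrib_right mult.assoc)
      finally show "(\<Sum>i<N k. of_real (measure \<mu> (A k i)) * V k i B) = matrix_tensor k (Q k) B" .
    qed
    finally show ?thesis .
  qed
  define W where "W = measure \<mu> (space \<mu>)"
  have Q_bound: "norm (Q k n m - a n m) \<le> W * \<delta> k" for k n m
  proof -
    have i1: "integrable \<mu> (\<lambda>w. qt k (fst w n * snd w m))"
      unfolding qt_def by (intro Bochner_Integration.integrable_sum ind_int)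
    have i2: "integrable \<mu> (\<lambda>w. fst w n * snd w m)"
      using norm_prod by (intro integrable_const_bound[of _ 1] meas_prod) (auto intro!: AE_I2 simp: space)
    have "Q k n m - a n m = (\<integral>w. qt k (fst w n * snd w m) - fst w n * snd w m \<partial>\<mu>)"
      using i1 i2 by (simp add: Q_def moments)
    also have "norm \<dots> \<le> (\<integral>w. norm (qt k (fst w n * snd w m) - fst w n * snd w m) \<partial>\<mu>)"
      by (rule Bochner_Integration.integral_norm_bound)
    also have "\<dots> \<le> (\<integral>w. \<delta> k \<partial>\<mu>)"
    proof (rule Bochner_Integration.integral_mono)
      show "norm (qt k (fst w n * snd w m) - fst w n * snd w m) \<le> \<delta> k" if "w \<in> space \<mu>" for w
        using quant[OF norm_prod, of w n m k] that by (simp add: space qt_def norm_minus_commute)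
    qed (use i1 i2 in auto)
    finally show ?thesis by (simp add: W_def)
  qed
  \<comment> \<open>Replacing \<open>Q k\<close> by the true moments changes the k-th matrix by at
    most W/(k+1); the matrices with the true entries converge already.\<close>
  have lim: "nlimit ?P (\<lambda>k. into_completion ?T (matrix_tensor k (Q k))) (T.cls s)"
    unfolding nlimit_def proj_tensor_def
  proof -
    let ?d = "\<lambda>k. ndist (completion ?T) (into_completion ?T (matrix_tensor k a)) (T.cls s)"
    let ?dQ = "\<lambda>k. ndist (completion ?T) (into_completion ?T (matrix_tensor k (Q k))) (T.cls s)"
    have "?d \<longlonglongrightarrow> 0" using nlimit_matrix_tensor[OF s a] by (simp add: nlimit_def)
    then have "(\<lambda>k. W * (1 / real (Suc k)) + ?d k) \<longlonglongrightarrow> W * 0 + 0"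
      by (intro tendsto_add tendsto_mult_left inv_lim)
    then have lim: "(\<lambda>k. W * (1 / real (Suc k)) + ?d k) \<longlonglongrightarrow> 0" by simp
    have le: "?dQ k \<le> W * (1 / real (Suc k)) + ?d k" for k
    proof -
      have "ndist ?T (matrix_tensor k (Q k)) (matrix_tensor k a) \<le> (\<Sum>n<k. \<Sum>m<k. W * \<delta> k)"
        using Q_bound by (intro order_trans[OF ndist_matrix_tensor_le] sum_mono) auto
      also have "\<dots> = W * (real k * (real k * \<delta> k))" by simp
      also have "\<dots> \<le> W * (1 / real (Suc k))" using \<delta>_sum by (intro mult_left_mono) (auto simp: W_def)
      finally show ?thesis
        using T.ndist_into_completion_triangle[OF matrix_tensor_carr matrix_tensor_carr s, of k "Q k" k a] by linarith
    qed
    have "0 \<le> ?dQ k" for k by (intro T.ndist_into_completion_cls_nonneg matrix_tensor_carr s)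
    with le show "?dQ \<longlonglongrightarrow> 0"
      by (intro tendsto_sandwich[OF _ _ tendsto_const lim] always_eventually allI)
  qed
  show ?thesis
    unfolding has_bochner_int_def
  proof (intro conjI ballI)
    show "T.cls s \<in> carr ?P" using s by (simp add: proj_tensor_def T.carr_completion)
    show "(case w of (x, y) \<Rightarrow> tensor E F x y) \<in> carr ?P" if "w \<in> space \<mu>" for w
      using ball[of w] that
      by (auto simp: space tensor_eq proj_tensor_def split: prod.split intro!: T.into_completion_carr elem_tensor_carr)
    let ?v = "\<lambda>k i. into_completion ?T (V k i)"
    let ?f = "\<lambda>k w. ndist ?P (case w of (x, y) \<Rightarrow> tensor E F x y) (simple_fun ?P (N k) (A k) (?v k) w)"
    have eq: "?f k w = G k w" if "w \<in> space \<mu>" for k w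
      using dist_eq that by (simp add: space)
    have "\<forall>k. simple_data ?P \<mu> (N k) (A k) (?v k)"
      using A V emeasure_finite
      by (auto simp: simple_data_def proj_tensor_def less_top[symmetric] intro!: T.into_completion_carr)
    moreover have "\<forall>k. ?f k \<in> borel_measurable \<mu>"
    proof
      fix k
      have "?f k \<in> borel_measurable \<mu> \<longleftrightarrow> G k \<in> borel_measurable \<mu>"
        by (rule measurable_cong) (rule eq)
      with G_meas show "?f k \<in> borel_measurable \<mu>" by simp
    qed
    moreover have "(\<lambda>k. \<integral>\<^sup>+w. ennreal (?f k w) \<partial>\<mu>) \<longlonglongrightarrow> 0"
    proof -
      have "(\<integral>\<^sup>+w. ennreal (?f k w) \<partial>\<mu>) = (\<integral>\<^sup>+w. ennreal (G k w) \<partial>\<mu>)" for k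
        by (intro nn_integral_cong) (simp only: eq)
      then show ?thesis using int_lim by simp
    qed
    moreover have "nlimit ?P (\<lambda>k. simple_int ?P \<mu> (N k) (A k) (?v k)) (T.cls s)"
      using lim by (simp add: int_eq)
    ultimately show "\<exists>n A v. (\<forall>k. simple_data ?P \<mu> (n k) (A k) (v k)) \<and>
        (\<forall>k. (\<lambda>w. ndist ?P (case w of (x, y) \<Rightarrow> tensor E F x y) (simple_fun ?P (n k) (A k) (v k) w)) \<in> borel_measurable \<mu>) \<and>
        (\<lambda>k. \<integral>\<^sup>+w. ennreal (ndist ?P (case w of (x, y) \<Rightarrow> tensor E F x y) (simple_fun ?P (n k) (A k) (v k) w)) \<partial>\<mu>) \<longlonglongrightarrow> 0 \<and>
        nlimit ?P (\<lambda>k. simple_int ?P \<mu> (n k) (A k) (v k)) (T.cls s)"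
      by (intro exI[of _ N] exI[of _ A] exI[of _ ?v] conjI)
  qed
qed

theorem INA_eq_carr: "INA E F = carr (proj_tensor E F)"
proof
  show "INA E F \<subseteq> carr (proj_tensor E F)" by (auto simp: INA_def)
  show "carr (proj_tensor E F) \<subseteq> INA E F"
  proof
    let ?T = "alg_tensor E F"
    fix u assume u: "u \<in> carr (proj_tensor E F)"
    then obtain s where s: "s \<in> cauchy_seqs ?T" "u = T.cls s"
      by (auto simp: proj_tensor_def T.carr_completion)
    have "\<forall>n m. \<exists>l. (\<lambda>k. entry (s k) n m) \<longlonglongrightarrow> l"
      using entry_convergent[OF s(1)] by (simp add: convergent_def)
    then obtain a where a: "\<And>n m. (\<lambda>k. entry (s k) n m) \<longlonglongrightarrow> a n m" by metis
    define W0 where "W0 = nrm (proj_tensor E F) u"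
    \<comment> \<open>The added 1/(k+1) leaves room for an almost optimal representation and keeps
      \<open>W k\<close> positive when the norm is 0.\<close>
    define W where "W k = nrm ?T (s k) + 1 / real (Suc k)" for k
    have W0: "(\<lambda>k. nrm ?T (s k)) \<longlonglongrightarrow> W0"
      using T.nrm_completion_tendsto[OF s(1)] by (simp add: W0_def s(2) proj_tensor_def)
    have W_lim: "W \<longlonglongrightarrow> W0"
      unfolding W_def using tendsto_add[OF W0 LIMSEQ_Suc[OF lim_1_over_n]] by simp
    have sc: "s k \<in> carr ?T" for k by (rule T.cauchy_seqs_carr[OF s(1)])
    have W0_nonneg: "0 \<le> W0" by (rule LIMSEQ_le_const[OF W0]) (use T.nrm_nonneg[OF sc] in auto)
    have "\<exists>n x y. is_tensor_rep E F (s k) n x y \<and> (\<Sum>i<n. nrm E (x i) * nrm F (y i)) < W k" for k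
    proof -
      have "1 / real (Suc k) > 0" by simp
      from alg_rep_approx[OF sc[of k] this] show ?thesis unfolding W_def by blast
    qed
    then obtain N x y where rep: "\<And>k. is_tensor_rep E F (s k) (N k) (x k) (y k)"
      and lt: "\<And>k. (\<Sum>i<N k. nrm E (x k i) * nrm F (y k i)) < W k"
      by metis
    have xy: "x k i \<in> carr E" "y k i \<in> carr F" if "i < N k" for k i
      using rep[of k] that by (auto simp: is_tensor_rep_def)
    define l where "l k i = nrm E (x k i) * nrm F (y k i)" for k i
    \<comment> \<open>The norms of the factors move into the weight \<open>l\<close>. Indices beyond
      the representation are unconstrained and are sent to the origin, since points of the ball are
      required for all indices.\<close>
    define X where "X k i = (if i < N k then (\<lambda>n. x k i n / of_real (nrm E (x k i))) else (\<lambda>n. 0))" for k i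
    define Y where "Y k i = (if i < N k then (\<lambda>n. y k i n / of_real (nrm F (y k i))) else (\<lambda>n. 0))" for k i
    have zero: "(\<lambda>n. 0) \<in> unit_ball E" "(\<lambda>n. 0) \<in> unit_ball F"
      by (simp_all add: unit_ball_def E.zero_carr F.zero_carr E.nrm_zero F.nrm_zero)
    have XY: "X k i \<in> unit_ball E" "Y k i \<in> unit_ball F" for k i
      using xy zero by (auto simp: X_def Y_def intro: E.normalized_in_unit_ball F.normalized_in_unit_ball)
    have l_nonneg: "0 \<le> l k i" if "i < N k" for k i
      using xy[OF that] by (simp add: l_def E.nrm_nonneg F.nrm_nonneg)
    have prod: "l k i *\<^sub>R (X k i n * Y k i m) = x k i n * y k i m" if i: "i < N k" for k i n m
    proof -
      \<comment> \<open>A factor of norm 0 has zero coordinates, so the convention for division by 0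
        does no harm.\<close>
      have 0: "nrm E (x k i) = 0 \<Longrightarrow> x k i n = 0" "nrm F (y k i) = 0 \<Longrightarrow> y k i m = 0"
        using norm_le_ell_nrm[OF p, of "x k i" n] norm_le_ell_nrm[OF q, of "y k i" m] xy[OF i]
        unfolding E_eq F_eq by auto
      show ?thesis
        using 0 i by (auto simp: l_def X_def Y_def scaleR_conv_of_real)
    qed
    have "entry (s k) n m = (\<Sum>i<N k. x k i n * y k i m)" for k n m
      using rep[of k] by (simp add: is_tensor_rep_def entry_sum_elem_tensor)
    then have "(\<Sum>i<N k. l k i *\<^sub>R (X k i n * Y k i m)) = entry (s k) n m" for k n m
      using prod by simp
    then have lim: "(\<lambda>k. \<Sum>i<N k. l k i *\<^sub>R (X k i n * Y k i m)) \<longlonglongrightarrow> a n m" for n m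
      using a by simp
    have W_pos: "0 < W k" for k
      unfolding W_def using T.nrm_nonneg[OF sc[of k]] by (intro add_nonneg_pos) auto
    have l_sum: "(\<Sum>i<N k. l k i) \<le> W k" for k using lt[of k] by (simp add: l_def)
    obtain M :: "real measure" and Z Z' :: "real \<Rightarrow> nat \<Rightarrow> 'k" where M: "real_distribution M"
      and Z: "\<And>n. (\<lambda>t. Z t n) \<in> borel_measurable borel" "\<And>n. (\<lambda>t. Z' t n) \<in> borel_measurable borel"
      and ball: "AE t in M. Z t \<in> unit_ball E \<and> Z' t \<in> unit_ball F"
      and moment: "\<And>n m. W0 *\<^sub>R (\<integral>t. Z t n * Z' t m \<partial>M) = a n m"
      using limit_measure_on_balls[OF p q XY[unfolded E_eq F_eq] l_nonneg l_sum W_pos W_lim lim]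
      unfolding E_eq F_eq by blast
    interpret real_distribution M by (rule M)
    define S where "S = {t. Z t \<in> unit_ball E \<and> Z' t \<in> unit_ball F}"
    have S: "S \<in> sets borel"
    proof -
      have "S = {t \<in> space borel. (\<forall>K. (\<Sum>n<K. norm (Z t n) powr p) \<le> 1) \<and> (\<forall>K. (\<Sum>n<K. norm (Z' t n) powr q) \<le> 1)}"
        by (simp add: S_def E_eq F_eq unit_ball_ell_iff p q)
      also have "\<dots> \<in> sets borel" using Z by measurable
      finally show ?thesis .
    qed
    \<comment> \<open>Redefining the coded pair as the origin on the exceptional null set puts it in
      the balls for every parameter, and leaves all moments unchanged.\<close>
    define g where "g t = (if t \<in> S then (Z t, Z' t) else ((\<lambda>n. 0), (\<lambda>n. 0)))" for t
    have g_fst: "fst (g t) = (\<lambda>n. if t \<in> S then Z t n else 0)" and g_snd: "snd (g t) = (\<lambda>n. if t \<in> S then Z' t n else 0)" for t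
      by (auto simp: g_def)
    have g_ball: "fst (g t) \<in> unit_ball E" "snd (g t) \<in> unit_ball F" for t
      using zero by (auto simp: g_def S_def)
    have g_meas: "g \<in> measurable M ball_space"
    proof -
      have "(\<lambda>t. (fst (g t), snd (g t))) \<in> measurable borel ball_space"
      proof (rule measurable_into_ball_space[OF _ _ g_ball])
        show "(\<lambda>t. fst (g t) n) \<in> borel_measurable borel" "(\<lambda>t. snd (g t) n) \<in> borel_measurable borel" for n
          unfolding g_fst g_snd using Z S by (auto intro!: measurable_If_set)
      qed
      then show ?thesis by (simp add: measurable_cong_sets[OF events_eq_borel refl])
    qed
    \<comment> \<open>The image of the probability measure \<open>M\<close>, rescaled to total mass
      \<open>W0\<close>; this includes the zero measure for a tensor of norm 0.\<close>
    define \<mu> where "\<mu> = density (distr M ball_space g) (\<lambda>_. ennreal W0)"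
    have sets_\<mu>: "sets \<mu> = sets ball_space" and space_\<mu>: "space \<mu> = balls"
      by (simp_all add: \<mu>_def space_ball_space)
    have total: "emeasure \<mu> balls = ennreal W0"
    proof -
      have "emeasure (distr M ball_space g) (space ball_space) = 1"
        using prob_space.emeasure_space_1[OF prob_space_distr[OF g_meas]] by simp
      moreover have "balls \<in> sets ball_space" using sets.top[of ball_space] by (simp add: space_ball_space)
      ultimately show ?thesis
        unfolding \<mu>_def by (simp add: emeasure_density_const space_ball_space)
    qed
    have fin: "finite_measure \<mu>"
      by (rule finite_measureI) (simp add: space_\<mu> total)
    have "(\<integral>w. fst w n * snd w m \<partial>\<mu>) = a n m" for n m
    proof -
      have "(\<integral>w. fst w n * snd w m \<partial>\<mu>) = (\<integral>w. W0 *\<^sub>R (fst w n * snd w m) \<partial>distr M ball_space g)"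
        unfolding \<mu>_def using W0_nonneg measurable_entry_product by (intro integral_density) auto
      also have "\<dots> = (\<integral>t. W0 *\<^sub>R (fst (g t) n * snd (g t) m) \<partial>M)"
        by (intro integral_distr[OF g_meas] borel_measurable_scaleR borel_measurable_const measurable_entry_product)
      also have "\<dots> = W0 *\<^sub>R (\<integral>t. fst (g t) n * snd (g t) m \<partial>M)"
        by simp
      also have "(\<integral>t. fst (g t) n * snd (g t) m \<partial>M) = (\<integral>t. Z t n * Z' t m \<partial>M)"
      proof (rule integral_cong_AE)
        have "(\<lambda>t. fst (g t) n * snd (g t) m) \<in> borel_measurable M"
          using measurable_compose[OF g_meas measurable_entry_product] .
        then show "(\<lambda>t. fst (g t) n * snd (g t) m) \<in> borel_measurable M" .
        show "(\<lambda>t. Z t n * Z' t m) \<in> borel_measurable M"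
          unfolding measurable_cong_sets[OF events_eq_borel refl] using Z by measurable
        show "AE t in M. fst (g t) n * snd (g t) m = Z t n * Z' t m"
          using ball by eventually_elim (simp add: g_def S_def)
      qed
      finally show ?thesis by (simp add: moment)
    qed
    from has_bochner_int_tensor[OF fin sets_\<mu> s(1) a this]
    have "has_bochner_int (proj_tensor E F) \<mu> (\<lambda>(x, y). tensor E F x y) u" by (simp add: s(2))
    moreover have "borel_measure_on_balls E F \<mu>"
      by (simp add: borel_measure_on_balls_def space_\<mu> sets_\<mu> sets_ball_space)
    moreover have "measure \<mu> balls = nrm (proj_tensor E F) u"
      using total W0_nonneg by (simp add: measure_def W0_def)
    ultimately show "u \<in> INA E F" using u fin by (auto simp: INA_def)
  qed
qed

end

theorem corollary4p9:
  fixes p q :: real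
  assumes "1 < p" and "1 < q" and "1 / p + 1 / q < 1"
  shows "(let E = (ell p :: (real, nat \<Rightarrow> real) nspace);
              F = (ell q :: (real, nat \<Rightarrow> real) nspace)
          in NA E F \<noteq> carr (proj_tensor E F) \<and> INA E F = carr (proj_tensor E F))
       \<and> (let E = (ell p :: (complex, nat \<Rightarrow> complex) nspace);
              F = (ell q :: (complex, nat \<Rightarrow> complex) nspace)
          in NA E F \<noteq> carr (proj_tensor E F) \<and> INA E F = carr (proj_tensor E F))"
proof -
  interpret R: ell_pair_strict p q "ell p :: (real, nat \<Rightarrow> real) nspace" "ell q"
    using assms by unfold_locales auto
  interpret C: ell_pair_strict p q "ell p :: (complex, nat \<Rightarrow> complex) nspace" "ell q"
    using assms by unfold_locales auto
  show ?thesis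
    unfolding Let_def
    using R.NA_neq_carr R.INA_eq_carr C.NA_neq_carr C.INA_eq_carr by blast
qed

end
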